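(* Let $\nu$ be a non-degenerate probability measure on $\mathbb{R}_+=[0,+\infty)$ with mean $m_0=m_0(\nu)>0$ and finite second moment, and let $$\gamma=\frac{\mathrm{Var}(\nu)}{(m_0(\nu))^2}=\frac{V_\nu(m_0)}{m_0^2}.$$ Then: (i) As $n\to+\infty$, $$D_{1/(nm_0^n)}\left(\left(\nu^{\boxtimes n}\right)^{\boxplus n}\right)\longrightarrow\eta_\gamma\quad\text{in distribution},$$ where $\eta_\gamma$ is a probability measure (with support bounded from below) such that $m_0(\eta_\gamma)=1$, $(m_-(\eta_\gamma),m_0(\eta_\gamma))\subset(0,1)$, and the variance function of the Cauchy-Stieltjes kernel family generated by $\eta_\gamma$ is given, for $m\in(m_-(\eta_\gamma),m_0(\eta_\gamma))$, by $$V_{\eta_\gamma}(m)=\frac{m(m-1)}{m_0^2\ln(m)}V_\nu(m_0)=\frac{\gamma m(m-1)}{\ln(m)}.$$ (ii) As $n\to+\infty$, $$D_{1/(nm_0^n)}\left(\left(\nu^{\boxtimes n}\right)^{\uplus n}\right)\longrightarrow\sigma_\gamma\quad\text{in distribution},$$ where $\sigma_\gamma$ is a probability measure (with support bounded from below) such that $m_0(\sigma_\gamma)=1$, $(m_-(\sigma_\gamma),m_0(\sigma_\gamma))\subset(0,1)$, and the variance function of the Cauchy-Stieltjes kernel family generated by $\sigma_\gamma$ is given, for all $m\in(m_-(\sigma_\gamma),m_0(\sigma_\gamma))$, by $$V_{\sigma_\gamma}(m)=\frac{m(m-1)}{m_0^2\ln(m)}V_\nu(m_0)+m(1-m)=\frac{\gamma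 m(m-1)}{\ln(m)}+m(1-m).$$
   Context: CSK families. Let $\mu$ be a non-degenerate (not a Dirac mass) probability measure on $\mathbb{R}$ with support bounded from below. Put $b=\min\{0,\inf\mathrm{supp}(\mu)\}$ and $\theta_-=1/b$ if $b<0$, $\theta_-=-\infty$ if $b=0$. For $\theta\in(\theta_-,0)$ let $M_\mu(\theta)=\int\frac{1}{1-\theta x}\mu(dx)$ and $P_{(\theta,\mu)}(dx)=\frac{1}{M_\mu(\theta)(1-\theta x)}\mu(dx)$. The (left-sided) Cauchy-Stieltjes kernel (CSK) family generated by $\mu$ is $\mathcal{K}_-(\mu)=\{P_{(\theta,\mu)}:\theta\in(\theta_-,0)\}$. The mean map $k_\mu(\theta)=\int xP_{(\theta,\mu)}(dx)$ is strictly increasing on $(\theta_-,0)$; its image is the domain of means $(m_-(\mu),m_0(\mu))$, where $m_0(\mu)=\int x\,\mu(dx)$. Let $\psi_\mu$ be the inverse of $k_\mu$ and $Q_{(m,\mu)}=P_{(\psi_\mu(m),\mu)}$, the element of the family with mean $m$. The variance function is $V_\mu(m)=\int(x-m)^2Q_{(m,\mu)}(dx)$, $m\in(m_-(\mu),m_0(\mu))$, and $V_\mu(m_0(\mu))$ denotes $\mathrm{Var}(\mu)$. Convolutions. $D_r(\mu)$ denotes the dilation of $\mu$ by $r\neq0$: $D_r(\mu)(U)=\mu(U/r)$. $\boxplus$ is the free additive convolution of probability measures on $\mathbb{R}$ (additivity of the $R$-transform $G_\mu^{-1}(z)-1/z$, where $G_\mu(z)=\int\frac{1}{z-x}\mu(dx)$),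 and $\mu^{\boxplus n}$ is the $n$-fold convolution. $\boxtimes$ is the free multiplicative convolution of probability measures on $\mathbb{R}_+$ (multiplicativity of the $S$-transform), and $\mu^{\boxtimes n}$ is the $n$-fold convolution. $\uplus$ is the Boolean additive convolution: $\mu_1\uplus\mu_2$ is the probability measure with $K_{\mu_1\uplus\mu_2}(z)=K_{\mu_1}(z)+K_{\mu_2}(z)$ for $z\in\mathbb{C}^+$, where $K_\mu(z)=z-1/G_\mu(z)$; $\mu^{\uplus n}$ is the $n$-fold convolution. *)

theory Defs
  imports "HOL-Probability.Probability"
begin

section \<open>Probability measures on the real line\<close>

definition msupport :: "real measure \<Rightarrow> real set" where
  "msupport \<mu> = {x. \<forall>e>0. measure \<mu> (ball x e) > 0}"

definition nondegenerate :: "real measure \<Rightarrow> bool" where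
  "nondegenerate \<mu> \<longleftrightarrow> (\<forall>a. \<mu> \<noteq> return borel a)"

definition mean :: "real measure \<Rightarrow> real" where
  "mean \<mu> = (\<integral>x. x \<partial>\<mu>)"

definition Var :: "real measure \<Rightarrow> real" where
  "Var \<mu> = (\<integral>x. (x - mean \<mu>)^2 \<partial>\<mu>)"

definition dilation :: "real \<Rightarrow> real measure \<Rightarrow> real measure" where
  "dilation r \<mu> = distr \<mu> borel (\<lambda>x. r * x)"

definition prob_on_nonneg :: "real measure \<Rightarrow> bool" where
  "prob_on_nonneg \<mu> \<longleftrightarrow> real_distribution \<mu> \<and> (AE x in \<mu>. 0 \<le> x)"

section \<open>Cauchy-Stieltjes kernel families\<close>

definition csk_generator :: "real measure \<Rightarrow> bool" where
  "csk_generator \<mu> \<longleftrightarrow> real_distribution \<mu> \<and> nondegenerate \<mu> \<and> bdd_below (msupport \<mu>)"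

definition csk_b :: "real measure \<Rightarrow> real" where
  "csk_b \<mu> = min 0 (Inf (msupport \<mu>))"

definition theta_minus :: "real measure \<Rightarrow> ereal" where
  "theta_minus \<mu> = (if csk_b \<mu> < 0 then ereal (1 / csk_b \<mu>) else - \<infinity>)"

definition csk_thetas :: "real measure \<Rightarrow> real set" where
  "csk_thetas \<mu> = {\<theta>. theta_minus \<mu> < ereal \<theta> \<and> \<theta> < 0}"

definition csk_M :: "real measure \<Rightarrow> real \<Rightarrow> real" where
  "csk_M \<mu> \<theta> = (\<integral>x. 1 / (1 - \<theta> * x) \<partial>\<mu>)"

definition csk_P :: "real measure \<Rightarrow> real \<Rightarrow> real measure" where
  "csk_P \<mu> \<theta> = density \<mu> (\<lambda>x. ennreal (1 / (csk_M \<mu> \<theta> * (1 - \<theta> * x))))"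

definition csk_k :: "real measure \<Rightarrow> real \<Rightarrow> real" where
  "csk_k \<mu> \<theta> = mean (csk_P \<mu> \<theta>)"

text \<open>The domain of means is the image of the strictly increasing mean map; its right end point
  is the mean of the generating measure, so only the left end point needs a name.\<close>

definition m_minus :: "real measure \<Rightarrow> real" where
  "m_minus \<mu> = Inf (csk_k \<mu> ` csk_thetas \<mu>)"

definition csk_psi :: "real measure \<Rightarrow> real \<Rightarrow> real" where
  "csk_psi \<mu> = the_inv_into (csk_thetas \<mu>) (csk_k \<mu>)"

definition csk_Q :: "real measure \<Rightarrow> real \<Rightarrow> real measure" where
  "csk_Q \<mu> m = csk_P \<mu> (csk_psi \<mu> m)"

definition csk_V :: "real measure \<Rightarrow> real \<Rightarrow> real" where
  "csk_V \<mu> m = (if m = mean \<mu> then Var \<mu> else (\<integral>x. (x - m)^2 \<partial>csk_Q \<mu> m))"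

section \<open>Convolutions\<close>

text \<open>The three convolutions are rendered as relations: \<open>conv \<mu> \<nu> \<rho>\<close> says that the probability
  measure \<open>\<rho>\<close> is the convolution of \<open>\<mu>\<close> and \<open>\<nu>\<close>, i.e. that its transform is the sum
  (or product) of the transforms of \<open>\<mu>\<close> and \<open>\<nu>\<close>. Classically such a \<open>\<rho>\<close> exists and is unique
  for all probability measures \<open>\<mu>\<close>, \<open>\<nu>\<close> (on \<open>[0, \<infinity>)\<close> in the multiplicative case).\<close>

definition cauchy_transform :: "real measure \<Rightarrow> complex \<Rightarrow> complex" where
  "cauchy_transform \<mu> z = (\<integral>x. 1 / (z - complex_of_real x) \<partial>\<mu>)"

subsection \<open>Free additive convolution\<close>

text \<open>For measures with unbounded support the inverse of the Cauchy transform exists only on the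
  reciprocals of a truncated cone \<open>{w. Im w > M, \<bar>Re w\<bar> < \<alpha> Im w}\<close> (Bercovici and Voiculescu).
  The branch of the inverse is singled out by being asymptotic to \<open>1 / z\<close> at \<open>0\<close>.\<close>

definition R_domain :: "real \<Rightarrow> real \<Rightarrow> complex set" where
  "R_domain \<alpha> M = {z. Im (1 / z) > M \<and> \<bar>Re (1 / z)\<bar> < \<alpha> * Im (1 / z)}"

definition inverse_cauchy_on :: "real measure \<Rightarrow> complex set \<Rightarrow> (complex \<Rightarrow> complex) \<Rightarrow> bool" where
  "inverse_cauchy_on \<mu> D K \<longleftrightarrow> K holomorphic_on D
     \<and> (\<forall>z\<in>D. Im (K z) > 0 \<and> cauchy_transform \<mu> (K z) = z)
     \<and> ((\<lambda>z. z * K z) \<longlongrightarrow> 1) (at 0 within D)"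

definition R_transform_on :: "real measure \<Rightarrow> complex set \<Rightarrow> (complex \<Rightarrow> complex) \<Rightarrow> bool" where
  "R_transform_on \<mu> D R \<longleftrightarrow> (\<exists>K. inverse_cauchy_on \<mu> D K \<and> (\<forall>z\<in>D. R z = K z - 1 / z))"

definition free_add_conv :: "real measure \<Rightarrow> real measure \<Rightarrow> real measure \<Rightarrow> bool" where
  "free_add_conv \<mu> \<nu> \<rho> \<longleftrightarrow>
     real_distribution \<mu> \<and> real_distribution \<nu> \<and> real_distribution \<rho> \<and>
     (\<exists>\<alpha>>0. \<exists>M>0. \<exists>R1 R2.
        R_transform_on \<mu> (R_domain \<alpha> M) R1 \<and> R_transform_on \<nu> (R_domain \<alpha> M) R2 \<and>
        R_transform_on \<rho> (R_domain \<alpha> M) (\<lambda>z. R1 z + R2 z))"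

subsection \<open>Free multiplicative convolution\<close>

text \<open>For a probability measure \<open>\<mu> \<noteq> \<delta>\<^sub>0\<close> on \<open>[0, \<infinity>)\<close> the function \<open>psi_transform \<mu>\<close> is a strictly
  increasing bijection from \<open>(-\<infinity>, 0)\<close> onto \<open>(\<mu>{0} - 1, 0)\<close>, so that the S-transform is
  defined on the latter interval. The Dirac mass at \<open>0\<close> has no S-transform and is absorbing.\<close>

definition psi_transform :: "real measure \<Rightarrow> real \<Rightarrow> real" where
  "psi_transform \<mu> t = (\<integral>x. t * x / (1 - t * x) \<partial>\<mu>)"

definition chi_transform :: "real measure \<Rightarrow> real \<Rightarrow> real" where
  "chi_transform \<mu> = the_inv_into {..<0} (psi_transform \<mu>)"

definition S_transform :: "real measure \<Rightarrow> real \<Rightarrow> real" where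
  "S_transform \<mu> u = chi_transform \<mu> u * (1 + u) / u"

definition S_domain :: "real measure \<Rightarrow> real set" where
  "S_domain \<mu> = {measure \<mu> {0} - 1<..<0}"

definition free_mult_conv :: "real measure \<Rightarrow> real measure \<Rightarrow> real measure \<Rightarrow> bool" where
  "free_mult_conv \<mu> \<nu> \<rho> \<longleftrightarrow>
     prob_on_nonneg \<mu> \<and> prob_on_nonneg \<nu> \<and> prob_on_nonneg \<rho> \<and>
     (if \<mu> = return borel 0 \<or> \<nu> = return borel 0 then \<rho> = return borel 0
      else \<rho> \<noteq> return borel 0 \<and>
        (\<forall>u \<in> S_domain \<mu> \<inter> S_domain \<nu> \<inter> S_domain \<rho>.
           S_transform \<rho> u = S_transform \<mu> u * S_transform \<nu> u))"

subsection \<open>Boolean additive convolution\<close>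

definition K_transform :: "real measure \<Rightarrow> complex \<Rightarrow> complex" where
  "K_transform \<mu> z = z - 1 / cauchy_transform \<mu> z"

definition boolean_conv :: "real measure \<Rightarrow> real measure \<Rightarrow> real measure \<Rightarrow> bool" where
  "boolean_conv \<mu> \<nu> \<rho> \<longleftrightarrow>
     real_distribution \<mu> \<and> real_distribution \<nu> \<and> real_distribution \<rho> \<and>
     (\<forall>z. Im z > 0 \<longrightarrow> K_transform \<rho> z = K_transform \<mu> z + K_transform \<nu> z)"

subsection \<open>Convolution powers\<close>

text \<open>\<open>conv_power conv \<mu> n \<rho>\<close>: the measure \<open>\<rho>\<close> is the \<open>n\<close>-fold convolution of \<open>\<mu>\<close> with itself,
  for \<open>n \<ge> 1\<close>.\<close>

inductive conv_power ::
  "(real measure \<Rightarrow> real measure \<Rightarrow> real measure \<Rightarrow> bool) \<Rightarrow> real measure \<Rightarrow> nat \<Rightarrow> real measure \<Rightarrow> bool"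
  for conv :: "real measure \<Rightarrow> real measure \<Rightarrow> real measure \<Rightarrow> bool" and \<mu> :: "real measure"
where
  one: "conv_power conv \<mu> 1 \<mu>"
| Suc: "conv_power conv \<mu> n \<rho> \<Longrightarrow> conv \<rho> \<mu> \<rho>' \<Longrightarrow> conv_power conv \<mu> (Suc n) \<rho>'"

end

theory Submission
  imports Defs "HOL-Complex_Analysis.Conformal_Mappings"
begin

text \<open>
  Everything is read off from \<open>psi\<close> on the negative half-line. The \<open>S\<close>-transform of
  \<open>\<nu>\<^sup>\<boxtimes>\<^sup>n\<close> is \<open>S\<^sub>\<nu>\<^sup>n\<close>, and \<open>m\<^sub>0 S\<^sub>\<nu>(v) = 1 - \<gamma> v + o(v)\<close> as \<open>v\<close> tends to \<open>0\<close> from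
  the left, so \<open>(m\<^sub>0 S\<^sub>\<nu>(u/n))\<^sup>n\<close> tends to \<open>exp (- \<gamma> u)\<close>. The \<open>n\<close>-fold free additive power multiplies
  \<open>psi\<close> by \<open>n\<close> after a subordination, the Boolean power multiplies \<open>q = psi / (1 + psi)\<close> by \<open>n\<close>. Both
  limits therefore satisfy \<open>q(t) exp (- \<gamma> \<phi>(q(t))) = t\<close> for \<open>t < 0\<close>, with
  \<open>\<phi>(q) = psi = q / (1 - q)\<close> in the free case and \<open>\<phi>(q) = q\<close> in the Boolean case. In the
  Cauchy-Stieltjes family \<open>q(\<theta>) / \<theta>\<close> is the mean \<open>m\<close> of the member with parameter \<open>\<theta>\<close>, hence
  \<open>\<gamma> \<phi>(q) = ln m\<close>, and the variance function is \<open>m (m - 1) / q + m (1 - m)\<close>.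
\<close>

section \<open>The Cauchy transform\<close>

text \<open>The additive convolutions are relations between transforms on the upper half-plane or on
  an unspecified cone, so two things have to be earned before \<open>psi\<close> can be used: the
  relations must be carried to the negative axis, and additive powers must be shown to stay on the
  half-line. For the second, the condition \<open>Im (z * G z) \<le> 0\<close> on the upper
  half-plane characterizes the measures on the half-line, and both additive powers preserve it: the
  free power acts on \<open>z * G z\<close> affinely after the subordination, the Boolean power acts
  affinely on its reciprocal. No limit law is written down in advance. Tightness of the rescaled
  powers produces it, and analytic continuation from the negative axis together with Stieltjes
  inversion identifies it. The a priori bound that must precede the passage to the limit is
  \<open>m\<^sub>0 * S \<ge> 1\<close>, a correlation inequality, which keeps \<open>q\<close>
  between \<open>t\<close> and \<open>0\<close> along the whole sequence.\<close>

lemma prob_on_nonneg_real_distribution: "prob_on_nonneg \<mu> \<Longrightarrow> real_distribution \<mu>"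
  by (simp add: prob_on_nonneg_def)

lemma prob_on_nonneg_AE: "prob_on_nonneg \<mu> \<Longrightarrow> AE x in \<mu>. x \<in> {0..}"
  by (simp add: prob_on_nonneg_def)

lemma finite_measure_integrable_bounded:
  fixes f :: "'a \<Rightarrow> 'b :: {banach, second_countable_topology}"
  assumes "finite_measure \<mu>" "f \<in> borel_measurable \<mu>" "AE x in \<mu>. norm (f x) \<le> B"
  shows "integrable \<mu> f"
  using finite_measure.integrable_const_bound[OF assms(1)] assms by blast

lemma dist_le_norm_diff_of_real:
  fixes z :: complex
  assumes "x \<in> C"
  shows "infdist z (complex_of_real ` C) \<le> norm (z - of_real x)"
  using infdist_le[of "complex_of_real x" "complex_of_real ` C" z] assms by (simp add: dist_norm)

lemma closed_of_real_image:
  assumes "closed C"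
  shows "closed (complex_of_real ` C)"
proof -
  have "complex_of_real ` C = {z. Im z = 0} \<inter> Re -` C"
    by (auto simp: complex_eq_iff image_iff)
  moreover have "closed (Re -` C)"
    using assms by (intro continuous_closed_vimage) auto
  ultimately show ?thesis
    by (simp add: closed_Int closed_halfspace_Im_eq)
qed

lemma infdist_of_real_image_pos:
  fixes z :: complex
  assumes "closed C" "C \<noteq> {}" "z \<notin> complex_of_real ` C"
  shows "infdist z (complex_of_real ` C) > 0"
proof -
  have "closed (complex_of_real ` C)"
    using assms(1) by (simp add: closed_of_real_image)
  then show ?thesis
    using assms in_closed_iff_infdist_zero[of "complex_of_real ` C" z] infdist_nonneg[of z "complex_of_real ` C"] 
    by force
qed

text \<open>Up to sign, these integrals are the difference quotients of the Cauchy transform when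
  \<open>z = w\<close>. The integrand is dominated by a constant because both points keep a positive
  distance from the carrier \<open>C\<close>.\<close>

lemma tendsto_cauchy_kernels:
  fixes z w :: complex
  assumes \<mu>: "real_distribution \<mu>" and C: "closed C" "C \<noteq> {}" and AE: "AE x in \<mu>. x \<in> C"
    and z: "z \<notin> complex_of_real ` C" and w: "w \<notin> complex_of_real ` C"
    and X: "X \<longlonglongrightarrow> w"
  shows "(\<lambda>n. \<integral>x. 1 / ((z - of_real x) * (X n - of_real x)) \<partial>\<mu>)
     \<longlonglongrightarrow> (\<integral>x. 1 / ((z - of_real x) * (w - of_real x)) \<partial>\<mu>)"
proof -
  interpret real_distribution \<mu> by fact
  \<comment> \<open>Half the distance of \<open>w\<close> from the carrier: once \<open>X n\<close>
    is within \<open>d\<close> of \<open>w\<close>, it is still at distance \<open>d\<close> from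
    the carrier.\<close>
  define d where "d = infdist w (complex_of_real ` C) / 2"
  define e where "e = infdist z (complex_of_real ` C)"
  have d: "d > 0" and e: "e > 0"
    using infdist_of_real_image_pos[OF C w] infdist_of_real_image_pos[OF C z] by (auto simp: d_def e_def)
  have "eventually (\<lambda>n. dist (X n) w < d) sequentially"
    using X d by (auto simp: tendsto_iff)
  then obtain N where N: "\<And>n. n \<ge> N \<Longrightarrow> dist (X n) w < d"
    by (auto simp: eventually_sequentially)
  have lb: "norm (X (n + N) - of_real x) \<ge> d" if "x \<in> C" for n x
  proof -
    have "2 * d \<le> norm (w - of_real x)"
      using dist_le_norm_diff_of_real[OF that, of w] by (simp add: d_def)
    also have "\<dots> \<le> norm (w - X (n + N)) + norm (X (n + N) - of_real x)"
      using norm_triangle_ineq[of "w - X (n + N)" "X (n + N) - of_real x"] by simp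
    finally show ?thesis
      using N[of "n + N"] by (simp add: dist_norm norm_minus_commute)
  qed
  have "(\<lambda>n. \<integral>x. 1 / ((z - of_real x) * (X (n + N) - of_real x)) \<partial>\<mu>)
     \<longlonglongrightarrow> (\<integral>x. 1 / ((z - of_real x) * (w - of_real x)) \<partial>\<mu>)"
  proof (rule integral_dominated_convergence[where w = "\<lambda>_. 1 / (e * d)"])
    show "AE x in \<mu>. (\<lambda>n. 1 / ((z - of_real x) * (X (n + N) - of_real x)))
            \<longlonglongrightarrow> 1 / ((z - of_real x) * (w - of_real x))"
      using AE
    proof eventually_elim
      case (elim x)
      then have "w - of_real x \<noteq> 0" "z - of_real x \<noteq> 0" using w z by auto
      then show ?case
        by (intro tendsto_intros LIMSEQ_ignore_initial_segment X) auto
    qed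
    show "AE x in \<mu>. norm (1 / ((z - complex_of_real x) * (X (n + N) - of_real x))) \<le> 1 / (e * d)" for n
      using AE
    proof eventually_elim
      case (elim x)
      have "e * d \<le> norm (z - of_real x) * norm (X (n + N) - of_real x)"
        using lb[OF elim] dist_le_norm_diff_of_real[OF elim, of z] d e
        by (intro mult_mono) (auto simp: e_def)
      then show ?case using d e
        by (simp add: norm_divide norm_mult frac_le)
    qed
  qed simp_all
  then show ?thesis by (rule LIMSEQ_offset)
qed

lemma integrable_cauchy_kernel:
  fixes z :: complex
  assumes \<mu>: "real_distribution \<mu>" and C: "closed C" "C \<noteq> {}" and AE: "AE x in \<mu>. x \<in> C"
    and z: "z \<notin> complex_of_real ` C"
  shows "integrable \<mu> (\<lambda>x. 1 / (z - of_real x))"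
proof -
  interpret real_distribution \<mu> by fact
  define e where "e = infdist z (complex_of_real ` C)"
  have e: "e > 0"
    using infdist_of_real_image_pos[OF C z] by (auto simp: e_def)
  show ?thesis
  proof (rule finite_measure_integrable_bounded[where B = "1 / e"])
    show "AE x in \<mu>. norm (1 / (z - complex_of_real x)) \<le> 1 / e"
      using AE
    proof eventually_elim
      case (elim x)
      then show ?case using e dist_le_norm_diff_of_real[OF elim, of z] 
        by (simp add: norm_divide divide_simps e_def)
    qed
  qed (auto intro: finite_measure_axioms)
qed

text \<open>The resolvent identity, integrated. It serves twice: for the derivative of the
  transform, and later to show that two points with the same transform give a vanishing
  integral.\<close>

lemma cauchy_transform_diff:
  fixes z w :: complex
  assumes \<mu>: "real_distribution \<mu>" and C: "closed C" "C \<noteq> {}" and AE: "AE x in \<mu>. x \<in> C"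
    and z: "z \<notin> complex_of_real ` C" and w: "w \<notin> complex_of_real ` C"
  shows "cauchy_transform \<mu> z - cauchy_transform \<mu> w
    = - (z - w) * (\<integral>x. 1 / ((w - of_real x) * (z - of_real x)) \<partial>\<mu>)"
proof -
  have "cauchy_transform \<mu> z - cauchy_transform \<mu> w
     = (\<integral>x. 1 / (z - of_real x) - 1 / (w - of_real x) \<partial>\<mu>)"
    unfolding cauchy_transform_def
    by (rule Bochner_Integration.integral_diff[symmetric]) (rule integrable_cauchy_kernel[OF \<mu> C AE], fact)+
  also have "\<dots> = (\<integral>x. - (z - w) * (1 / ((w - of_real x) * (z - of_real x))) \<partial>\<mu>)"
  proof (rule integral_cong_AE)
    interpret real_distribution \<mu> by fact
    show "AE x in \<mu>. 1 / (z - of_real x) - 1 / (w - of_real x) = - (z - w) * (1 / ((w - of_real x) * (z - of_real x)))"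
      using AE
    proof eventually_elim
      case (elim x)
      then have "w - of_real x \<noteq> 0" "z - of_real x \<noteq> 0" using w z by auto
      then show ?case by (simp add: divide_simps)
    qed
    show "(\<lambda>x. 1 / (z - complex_of_real x) - 1 / (w - complex_of_real x)) \<in> borel_measurable \<mu>"
      "(\<lambda>x. - (z - w) * (1 / ((w - complex_of_real x) * (z - complex_of_real x)))) \<in> borel_measurable \<mu>"
      by measurable
  qed
  finally show ?thesis by (simp only: integral_mult_right_zero)
qed

text \<open>The carrier is arbitrary because two instances are needed: \<open>UNIV\<close> for the
  upper half-plane, and \<open>{0..}\<close> for the slit plane, which joins the upper half-plane to
  the negative axis.\<close>

lemma cauchy_transform_holomorphic:
  assumes \<mu>: "real_distribution \<mu>" and C: "closed C" "C \<noteq> {}" and AE: "AE x in \<mu>. x \<in> C"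
  shows "cauchy_transform \<mu> holomorphic_on - (complex_of_real ` C)"
proof -
  have op: "open (- (complex_of_real ` C))"
    using C(1) by (simp add: closed_of_real_image open_Compl)
  have "(cauchy_transform \<mu> has_field_derivative
      - (\<integral>x. 1 / ((w - of_real x) * (w - of_real x)) \<partial>\<mu>)) (at w)"
    if w: "w \<in> - (complex_of_real ` C)" for w
    unfolding has_field_derivative_iff tendsto_at_iff_sequentially
  proof (intro allI impI, unfold o_def)
    fix X assume X: "\<forall>i. X i \<in> UNIV - {w}" "X \<longlonglongrightarrow> w"
    have lim: "(\<lambda>n. - (\<integral>x. 1 / ((w - of_real x) * (X n - of_real x)) \<partial>\<mu>))
        \<longlonglongrightarrow> - (\<integral>x. 1 / ((w - of_real x) * (w - of_real x)) \<partial>\<mu>)"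
      using w X by (intro tendsto_minus tendsto_cauchy_kernels[OF \<mu> C AE]) auto
    have "eventually (\<lambda>n. X n \<in> - (complex_of_real ` C)) sequentially"
      using topological_tendstoD[OF X(2) op w] .
    then have ev: "eventually (\<lambda>n. - (\<integral>x. 1 / ((w - of_real x) * (X n - of_real x)) \<partial>\<mu>)
        = (cauchy_transform \<mu> (X n) - cauchy_transform \<mu> w) / (X n - w)) sequentially"
    proof eventually_elim
      case (elim n)
      have "X n \<noteq> w" using X by auto
      then show ?case
        using cauchy_transform_diff[OF \<mu> C AE, of "X n" w] elim w by (simp add: field_simps)
    qed
    show "(\<lambda>n. (cauchy_transform \<mu> (X n) - cauchy_transform \<mu> w) / (X n - w))
        \<longlonglongrightarrow> - (\<integral>x. 1 / ((w - of_real x) * (w - of_real x)) \<partial>\<mu>)"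
      using tendsto_cong[OF ev] lim by simp
  qed
  then show ?thesis
    using op by (auto simp: holomorphic_on_open)
qed

section \<open>The Cauchy transform on the upper half-plane\<close>

lemma upper_half_plane_subset: "{z. Im z > 0} \<subseteq> - (complex_of_real ` C)"
  by auto

lemma upper_half_plane_open: "open {z. Im z > 0}"
  by (simp add: open_halfspace_Im_gt)

lemma upper_half_plane_connected: "connected {z. Im z > 0}"
  by (intro convex_connected) (simp add: convex_halfspace_Im_gt)

lemma cauchy_transform_holomorphic_upper:
  assumes "real_distribution \<mu>"
  shows "cauchy_transform \<mu> holomorphic_on {z. Im z > 0}"
  by (rule holomorphic_on_subset[OF cauchy_transform_holomorphic[OF assms, of UNIV]])
     (use upper_half_plane_subset in auto)

lemma integrable_cauchy_kernel_upper:
  assumes "real_distribution \<mu>" "Im z > 0"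
  shows "integrable \<mu> (\<lambda>x. 1 / (z - of_real x))"
  using assms upper_half_plane_subset[of UNIV] by (intro integrable_cauchy_kernel[of _ UNIV]) auto

lemma Re_cauchy_kernel: "Re (1 / (z - of_real x)) = (Re z - x) / ((Re z - x)\<^sup>2 + (Im z)\<^sup>2)"
  by (simp add: Re_divide)

lemma Im_cauchy_kernel: "Im (1 / (z - of_real x)) = - (Im z / ((Re z - x)\<^sup>2 + (Im z)\<^sup>2))"
  by (simp add: Im_divide)

lemma Re_cauchy_transform:
  assumes "real_distribution \<mu>" "Im z > 0"
  shows "Re (cauchy_transform \<mu> z) = (\<integral>x. (Re z - x) / ((Re z - x)\<^sup>2 + (Im z)\<^sup>2) \<partial>\<mu>)"
  unfolding cauchy_transform_def Re_cauchy_kernel[symmetric]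
  by (rule integral_Re[symmetric]) (rule integrable_cauchy_kernel_upper[OF assms])

lemma Im_cauchy_transform:
  assumes "real_distribution \<mu>" "Im z > 0"
  shows "Im (cauchy_transform \<mu> z) = - (\<integral>x. Im z / ((Re z - x)\<^sup>2 + (Im z)\<^sup>2) \<partial>\<mu>)"
proof -
  have "Im (cauchy_transform \<mu> z) = (\<integral>x. Im (1 / (z - of_real x)) \<partial>\<mu>)"
    unfolding cauchy_transform_def
    by (rule integral_Im[symmetric]) (rule integrable_cauchy_kernel_upper[OF assms])
  then show ?thesis unfolding Im_cauchy_kernel by simp
qed

lemma Im_cauchy_transform_neg:
  assumes "real_distribution \<mu>" "Im z > 0"
  shows "Im (cauchy_transform \<mu> z) < 0"
proof -
  interpret real_distribution \<mu> by fact
  have pos: "Im z / ((Re z - x)\<^sup>2 + (Im z)\<^sup>2) > 0" for x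
    using assms(2) by (intro divide_pos_pos add_nonneg_pos) auto
  have int: "integrable \<mu> (\<lambda>x. Im z / ((Re z - x)\<^sup>2 + (Im z)\<^sup>2))"
    using integrable_Im[OF integrable_cauchy_kernel_upper[OF assms]]
    unfolding Im_cauchy_kernel by simp
  have "(\<integral>x. 0 \<partial>\<mu>) < (\<integral>x. Im z / ((Re z - x)\<^sup>2 + (Im z)\<^sup>2) \<partial>\<mu>)"
    by (rule integral_less_AE_space) (use int pos emeasure_space_1 in auto)
  then show ?thesis using Im_cauchy_transform[OF assms] by simp
qed

section \<open>Stieltjes inversion\<close>

lemma integrable_indicator_Icc_bounded:
  fixes f :: "real \<Rightarrow> real"
  assumes [measurable]: "f \<in> borel_measurable borel" and B: "\<And>s. s \<in> {a..b} \<Longrightarrow> \<bar>f s\<bar> \<le> B"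
  shows "integrable lborel (\<lambda>s. indicator {a..b} s * f s)"
proof (rule Bochner_Integration.integrable_bound)
  show "integrable lborel (\<lambda>s. indicator {a..b} s * B)"
    by (cases "a \<le> b") auto
  show "AE s in lborel. norm (indicator {a..b} s * f s) \<le> norm (indicator {a..b} s * B)"
    using B by (intro AE_I2) (auto simp: indicator_def intro: order_trans[OF _ abs_ge_self])
qed measurable

lemma poisson_kernel_le:
  fixes e d :: real
  assumes "e > 0"
  shows "e / (d\<^sup>2 + e\<^sup>2) \<le> 1 / e"
  using assms by (simp add: divide_simps power2_eq_square add_pos_nonneg add_nonneg_pos)

lemma poisson_kernel_nonneg:
  fixes e d :: real
  assumes "e > 0"
  shows "0 \<le> e / (d\<^sup>2 + e\<^sup>2)"
  using assms by simp

lemma conjugate_poisson_kernel_le: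
  fixes e d :: real
  shows "\<bar>e * d / (d\<^sup>2 + e\<^sup>2)\<bar> \<le> 1"
proof (cases "d = 0 \<and> e = 0")
  case False
  then have "d\<^sup>2 + e\<^sup>2 > 0" by (auto simp: sum_power2_gt_zero_iff)
  moreover have "\<bar>e * d\<bar> \<le> d\<^sup>2 + e\<^sup>2"
  proof -
    have "0 \<le> (\<bar>e\<bar> - \<bar>d\<bar>)\<^sup>2" by simp
    then have "2 * (\<bar>e\<bar> * \<bar>d\<bar>) \<le> d\<^sup>2 + e\<^sup>2" by (simp add: power2_diff)
    moreover have "0 \<le> \<bar>e\<bar> * \<bar>d\<bar>" by simp
    ultimately show ?thesis unfolding abs_mult by linarith
  qed
  ultimately show ?thesis by simp
qed auto

lemma integral_poisson_kernel:
  fixes e x a b :: real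
  assumes "e > 0" "a \<le> b"
  shows "(\<integral>s. indicator {a..b} s * (e / ((s - x)\<^sup>2 + e\<^sup>2)) \<partial>lborel)
     = arctan ((b - x) / e) - arctan ((a - x) / e)"
proof -
  have "(\<integral>s. indicator {a..b} s *\<^sub>R (e / ((s - x)\<^sup>2 + e\<^sup>2)) \<partial>lborel)
     = arctan ((b - x) / e) - arctan ((a - x) / e)"
  proof (rule integral_FTC_atLeastAtMost)
    fix s
    have "inverse (1 + ((s - x) / e)\<^sup>2) * (1 / e) = e / ((s - x)\<^sup>2 + e\<^sup>2)"
      using assms by (simp add: divide_simps power2_eq_square)
    moreover have "((\<lambda>s. arctan ((s - x) / e)) has_field_derivative
          inverse (1 + ((s - x) / e)\<^sup>2) * (1 / e)) (at s within {a..b})"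
      using assms by (auto intro!: derivative_eq_intros)
    ultimately show "((\<lambda>s. arctan ((s - x) / e)) has_vector_derivative e / ((s - x)\<^sup>2 + e\<^sup>2)) (at s within {a..b})"
      by (simp add: has_real_derivative_iff_has_vector_derivative)
  next
    have "(s - x)\<^sup>2 + e\<^sup>2 \<noteq> 0" for s using assms by (simp add: add_nonneg_eq_0_iff)
    then show "continuous_on {a..b} (\<lambda>s. e / ((s - x)\<^sup>2 + e\<^sup>2))"
      by (intro continuous_intros) auto
  qed fact
  then show ?thesis by simp
qed

lemma tendsto_arctan_div_Suc:
  "(\<lambda>n. arctan (c / (1 / real (Suc n)))) \<longlonglongrightarrow> pi / 2 * sgn c"
proof -
  have top: "filterlim (\<lambda>n. \<bar>c\<bar> * real (Suc n)) at_top sequentially" if "c \<noteq> 0"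
    using that
    by (intro filterlim_tendsto_pos_mult_at_top[OF tendsto_const] filterlim_compose[OF filterlim_real_sequentially filterlim_Suc]) auto
  consider "c = 0" | "c > 0" | "c < 0" by linarith
  then show ?thesis
  proof cases
    case 2
    then show ?thesis
      using filterlim_compose[OF tendsto_arctan_at_top top] by simp
  next
    case 3
    then have "(\<lambda>n. - arctan (\<bar>c\<bar> * real (Suc n))) \<longlonglongrightarrow> - (pi / 2)"
      by (intro tendsto_minus filterlim_compose[OF tendsto_arctan_at_top top]) auto
    then show ?thesis using 3 by (simp add: arctan_minus[symmetric] del: arctan_minus)
  qed simp
qed

text \<open>Fubini turns the integral into the mean of a difference of two arctangents. It converges
  boundedly to \<open>pi\<close> inside the interval and to \<open>pi / 2\<close> at either end
  point, hence the two half-open intervals with weight \<open>pi / 2\<close> each.\<close>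

lemma stieltjes_inversion:
  assumes \<mu>: "real_distribution \<mu>" and ab: "a < b"
  shows "(\<lambda>n. \<integral>s. indicator {a..b} s * (- Im (cauchy_transform \<mu> (Complex s (1 / real (Suc n))))) \<partial>lborel)
    \<longlonglongrightarrow> pi / 2 * (measure \<mu> {a<..b} + measure \<mu> {a..<b})"
proof -
  interpret real_distribution \<mu> by fact
  interpret P: pair_sigma_finite \<mu> lborel ..
  have fub: "(\<integral>s. indicator {a..b} s * (- Im (cauchy_transform \<mu> (Complex s e))) \<partial>lborel)
     = (\<integral>x. arctan ((b - x) / e) - arctan ((a - x) / e) \<partial>\<mu>)" if e: "e > 0" for e
  proof -
    have int: "integrable (\<mu> \<Otimes>\<^sub>M lborel) (\<lambda>(x, s). indicator {a..b} s * (e / ((s - x)\<^sup>2 + e\<^sup>2)))"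
    proof (rule Bochner_Integration.integrable_bound)
      show "integrable (\<mu> \<Otimes>\<^sub>M lborel) (\<lambda>p. indicator (space \<mu> \<times> {a..b}) p * (1 / e))"
        using lborel.emeasure_pair_measure_Times[of "space \<mu>" \<mu> "{a..b}"] ab emeasure_space_1
        by (intro integrable_mult_left integrable_real_indicator) (auto simp: ennreal_mult_less_top)
      show "AE p in \<mu> \<Otimes>\<^sub>M lborel. norm (case p of (x, s) \<Rightarrow> indicator {a..b} s * (e / ((s - x)\<^sup>2 + e\<^sup>2)))
         \<le> norm (indicator (space \<mu> \<times> {a..b}) p * (1 / e))"
        using poisson_kernel_le[OF e] e by (intro AE_I2) (auto simp: indicator_def space_pair_measure)
    qed measurable
    have "(\<integral>s. indicator {a..b} s * (- Im (cauchy_transform \<mu> (Complex s e))) \<partial>lborel)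
       = (\<integral>s. (\<integral>x. indicator {a..b} s * (e / ((s - x)\<^sup>2 + e\<^sup>2)) \<partial>\<mu>) \<partial>lborel)"
      unfolding Bochner_Integration.integral_mult_right_zero using e by (simp add: Im_cauchy_transform[OF \<mu>])
    also have "\<dots> = (\<integral>x. (\<integral>s. indicator {a..b} s * (e / ((s - x)\<^sup>2 + e\<^sup>2)) \<partial>lborel) \<partial>\<mu>)"
      by (rule P.Fubini_integral[OF int])
    also have "\<dots> = (\<integral>x. arctan ((b - x) / e) - arctan ((a - x) / e) \<partial>\<mu>)"
      using integral_poisson_kernel[OF e] ab by simp
    finally show ?thesis .
  qed
  have "(\<lambda>n. \<integral>x. arctan ((b - x) / (1 / real (Suc n))) - arctan ((a - x) / (1 / real (Suc n))) \<partial>\<mu>)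
     \<longlonglongrightarrow> (\<integral>x. pi / 2 * sgn (b - x) - pi / 2 * sgn (a - x) \<partial>\<mu>)"
  proof (rule integral_dominated_convergence[where w = "\<lambda>_. pi"])
    show "AE x in \<mu>. (\<lambda>n. arctan ((b - x) / (1 / real (Suc n))) - arctan ((a - x) / (1 / real (Suc n))))
       \<longlonglongrightarrow> pi / 2 * sgn (b - x) - pi / 2 * sgn (a - x)"
      by (intro AE_I2 tendsto_diff tendsto_arctan_div_Suc)
    have "norm (arctan u - arctan v) \<le> pi" for u v
      using arctan_bounded[of u] arctan_bounded[of v] by auto
    then show "AE x in \<mu>. norm (arctan ((b - x) / (1 / real (Suc n))) - arctan ((a - x) / (1 / real (Suc n)))) \<le> pi" for n
      by blast
  qed simp_all
  moreover have "(\<lambda>x. pi / 2 * sgn (b - x) - pi / 2 * sgn (a - x))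
      = (\<lambda>x. pi / 2 * (indicator {a<..b} x + indicator {a..<b} x))"
    using ab by (auto simp: indicator_def sgn_if fun_eq_iff)
  moreover have "(\<integral>x. pi / 2 * (indicator {a<..b} x + indicator {a..<b} x) \<partial>\<mu>)
      = pi / 2 * (measure \<mu> {a<..b} + measure \<mu> {a..<b})"
    by (subst Bochner_Integration.integral_mult_right_zero, subst Bochner_Integration.integral_add) (auto simp: less_top[symmetric])
  ultimately show ?thesis
    by (simp only: fub[OF of_nat_0_less_iff[THEN iffD2, OF zero_less_Suc, THEN divide_pos_pos[OF zero_less_one]]])
qed

text \<open>Inversion only sees intervals whose end points count half. Possible atoms at the end
  points are dealt with by enlarging the interval to some \<open>c > b\<close> and using right
  continuity; an inequality is enough, since the hypothesis is symmetric.\<close>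

lemma cauchy_transform_eq_imp_cdf_le:
  assumes \<mu>: "real_distribution \<mu>" and \<nu>: "real_distribution \<nu>"
    and eq: "\<And>z. Im z > 0 \<Longrightarrow> cauchy_transform \<mu> z = cauchy_transform \<nu> z"
  shows "cdf \<mu> b \<le> cdf \<nu> b"
proof -
  interpret M: real_distribution \<mu> by fact
  interpret N: real_distribution \<nu> by fact
  have inv: "measure \<mu> {a<..c} + measure \<mu> {a..<c} = measure \<nu> {a<..c} + measure \<nu> {a..<c}" if "a < c" for a c
  proof -
    have "(\<lambda>n. \<integral>s. indicator {a..c} s * (- Im (cauchy_transform \<mu> (Complex s (1 / real (Suc n))))) \<partial>lborel)
      \<longlonglongrightarrow> pi / 2 * (measure \<nu> {a<..c} + measure \<nu> {a..<c})"
      using stieltjes_inversion[OF \<nu> that] by (simp add: eq)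
    from LIMSEQ_unique[OF this stieltjes_inversion[OF \<mu> that]] show ?thesis by simp
  qed
  \<comment> \<open>\<open>{a<..b}\<close> lies in both half-open intervals with right end
    \<open>c\<close>, and both of these lie in \<open>{..c}\<close>, so end point masses do no
    harm.\<close>
  have le: "cdf \<mu> b - cdf \<mu> a \<le> cdf \<nu> c" if "a < b" "b < c" for a c
  proof -
    have "2 * measure \<mu> {a<..b} \<le> measure \<mu> {a<..c} + measure \<mu> {a..<c}"
      using M.finite_measure_mono[of "{a<..b}" "{a<..c}"] M.finite_measure_mono[of "{a<..b}" "{a..<c}"] that
      by fastforce
    also have "\<dots> = measure \<nu> {a<..c} + measure \<nu> {a..<c}"
      using that by (intro inv) auto
    also have "\<dots> \<le> 2 * cdf \<nu> c"
      using N.finite_measure_mono[of "{a<..c}" "{..c}"] N.finite_measure_mono[of "{a..<c}" "{..c}"]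
      unfolding cdf_def by fastforce
    finally show ?thesis using M.cdf_diff_eq[of a b] that by simp
  qed
  have le2: "cdf \<mu> b \<le> cdf \<nu> c" if "b < c" for c
  proof (rule tendsto_upperbound)
    show "((\<lambda>a. cdf \<mu> b - cdf \<mu> a) \<longlongrightarrow> cdf \<mu> b) at_bot"
      using tendsto_diff[OF tendsto_const M.cdf_lim_at_bot, of "cdf \<mu> b"] by simp
    show "eventually (\<lambda>a. cdf \<mu> b - cdf \<mu> a \<le> cdf \<nu> c) at_bot"
      using eventually_gt_at_bot[of b] le that by (auto elim!: eventually_mono simp: eventually_at_bot_dense)
  qed auto
  show ?thesis
  proof (rule tendsto_lowerbound)
    show "(cdf \<nu> \<longlongrightarrow> cdf \<nu> b) (at_right b)"
      using N.cdf_is_right_cont[of b] by (simp add: continuous_within)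
    show "eventually (\<lambda>c. cdf \<mu> b \<le> cdf \<nu> c) (at_right b)"
      using le2 by (auto simp: eventually_at_right_field intro: exI[of _ "b + 1"])
  qed auto
qed

lemma cauchy_transform_determines_measure:
  assumes "real_distribution \<mu>" "real_distribution \<nu>"
    and "\<And>z. Im z > 0 \<Longrightarrow> cauchy_transform \<mu> z = cauchy_transform \<nu> z"
  shows "\<mu> = \<nu>"
  using cauchy_transform_eq_imp_cdf_le[of \<mu> \<nu>] cauchy_transform_eq_imp_cdf_le[of \<nu> \<mu>] assms
  by (intro cdf_unique) (auto simp: fun_eq_iff intro: antisym)

text \<open>The hypothesis says that the imaginary part of the Cauchy transform near a point of the
  negative axis is dominated by \<open>\<epsilon>\<close> times the real part, which vanishes in the limit.\<close>

lemma Im_mult_cauchy_transform_nonpos_imp_nonneg: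
  assumes \<mu>: "real_distribution \<mu>"
    and Im: "\<And>z. Im z > 0 \<Longrightarrow> Im (z * cauchy_transform \<mu> z) \<le> 0"
  shows "prob_on_nonneg \<mu>"
proof -
  interpret real_distribution \<mu> by fact
  \<comment> \<open>\<open>I\<close> is minus the imaginary part of the transform at
    \<open>s + i e\<close>, and \<open>R\<close> is \<open>e\<close> times its real part. The factor
    \<open>e\<close> is what keeps \<open>R\<close> bounded by \<open>1\<close>.\<close>
  define I where "I s e = (\<integral>x. e / ((s - x)\<^sup>2 + e\<^sup>2) \<partial>\<mu>)" for s e
  define R where "R s e = (\<integral>x. e * (s - x) / ((s - x)\<^sup>2 + e\<^sup>2) \<partial>\<mu>)" for s e
  have I_bound: "\<bar>I s e\<bar> \<le> 1 / e" if "e > 0" for s e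
  proof -
    have "norm (e / ((s - x)\<^sup>2 + e\<^sup>2)) \<le> 1 / e" for x
      using poisson_kernel_le[OF that] poisson_kernel_nonneg[OF that] by (simp only: real_norm_def abs_of_nonneg)
    then have "norm (I s e) \<le> (\<integral>x. 1 / e \<partial>\<mu>)"
      unfolding I_def 
      by - (intro Bochner_Integration.integral_norm_bound_integral finite_measure_integrable_bounded[where B = "1 / e"],
         use that in \<open>auto intro: finite_measure_axioms\<close>)
    then show ?thesis using prob_space by simp
  qed
  have R_bound: "\<bar>R s e\<bar> \<le> 1" for s e
  proof -
    have "norm (e * (s - x) / ((s - x)\<^sup>2 + e\<^sup>2)) \<le> 1" for x
      using conjugate_poisson_kernel_le by simp
    then have "norm (R s e) \<le> (\<integral>x. 1 \<partial>\<mu>)"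
      unfolding R_def 
      by - (intro Bochner_Integration.integral_norm_bound_integral finite_measure_integrable_bounded[where B = 1],
         auto intro: finite_measure_axioms)
    then show ?thesis using prob_space by simp
  qed
  have R_lim: "(\<lambda>n. R s (1 / real (Suc n))) \<longlonglongrightarrow> 0" for s
  proof -
    have "(\<lambda>n. R s (1 / real (Suc n))) \<longlonglongrightarrow> (\<integral>x. 0 \<partial>\<mu>)"
      unfolding R_def
    proof (rule integral_dominated_convergence[where w = "\<lambda>_. 1"])
      have "(\<lambda>n. (1 / real (Suc n)) * (s - x) / ((s - x)\<^sup>2 + (1 / real (Suc n))\<^sup>2)) \<longlonglongrightarrow> 0" for x
      proof (cases "s = x")
        case False
        have "(\<lambda>n. (1 / real (Suc n)) * (s - x) / ((s - x)\<^sup>2 + (1 / real (Suc n))\<^sup>2)) \<longlonglongrightarrow> 0 * (s - x) / ((s - x)\<^sup>2 + 0\<^sup>2)"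
          using LIMSEQ_inverse_real_of_nat False
          by (intro tendsto_intros) (auto simp: inverse_eq_divide)
        then show ?thesis by simp
      qed simp
      then show "AE x in \<mu>. (\<lambda>n. (1 / real (Suc n)) * (s - x) / ((s - x)\<^sup>2 + (1 / real (Suc n))\<^sup>2)) \<longlonglongrightarrow> 0"
        by blast
      show "AE x in \<mu>. norm (1 / real (Suc n) * (s - x) / ((s - x)\<^sup>2 + (1 / real (Suc n))\<^sup>2)) \<le> 1" for n
        using conjugate_poisson_kernel_le by (intro AE_I2) (simp only: real_norm_def)
    qed auto
    then show ?thesis by simp
  qed
  \<comment> \<open>For \<open>s < 0\<close> the imaginary part of \<open>(s + i e) * G\<close> is
    \<open>\<bar>s\<bar> * I s e + R s e\<close>, which is nonpositive by hypothesis.\<close>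
  have le: "\<bar>s\<bar> * I s e \<le> \<bar>R s e\<bar>" if "s < 0" "e > 0" for s e
  proof -
    have "R s e = e * Re (cauchy_transform \<mu> (Complex s e))"
      using that unfolding R_def times_divide_eq_right[symmetric] Bochner_Integration.integral_mult_right_zero
      by (simp only: Re_cauchy_transform[OF \<mu>] complex.sel)
    moreover have "Im (cauchy_transform \<mu> (Complex s e)) = - I s e"
      using that by (simp add: Im_cauchy_transform[OF \<mu>] I_def)
    ultimately show ?thesis
      using Im[of "Complex s e"] that by simp
  qed
  have [measurable]: "(\<lambda>s. R s e) \<in> borel_measurable borel" "(\<lambda>s. I s e) \<in> borel_measurable borel" for e
    unfolding R_def I_def by measurable
  have null: "measure \<mu> {a<..b} = 0" if ab: "a < b" "b < 0" for a b
  proof -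
    have "(\<lambda>n. \<integral>s. indicator {a..b} s * (\<bar>R s (1 / real (Suc n))\<bar> / \<bar>b\<bar>) \<partial>lborel) \<longlonglongrightarrow> (\<integral>s. 0 \<partial>(lborel :: real measure))"
    proof (rule integral_dominated_convergence[where w = "\<lambda>s. indicator {a..b} s * (1 / \<bar>b\<bar>)"])
      show "integrable lborel (\<lambda>s. indicator {a..b} s * (1 / \<bar>b\<bar>))"
        by (rule integrable_indicator_Icc_bounded[where B = "1 / \<bar>b\<bar>"]) auto
      show "AE s in lborel. (\<lambda>n. indicator {a..b} s * (\<bar>R s (1 / real (Suc n))\<bar> / \<bar>b\<bar>)) \<longlonglongrightarrow> 0"
        using ab by (intro AE_I2 tendsto_mult_right_zero tendsto_divide_zero tendsto_rabs_zero R_lim)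
      show "AE s in lborel. norm (indicator {a..b} s * (\<bar>R s (1 / real (Suc n))\<bar> / \<bar>b\<bar>)) \<le> indicator {a..b} s * (1 / \<bar>b\<bar>)" for n
        using R_bound by (intro AE_I2) (auto simp: indicator_def intro!: divide_right_mono)
    qed auto
    then have lim0: "(\<lambda>n. \<integral>s. indicator {a..b} s * (\<bar>R s (1 / real (Suc n))\<bar> / \<bar>b\<bar>) \<partial>lborel) \<longlonglongrightarrow> 0"
      by simp
    have "pi / 2 * (measure \<mu> {a<..b} + measure \<mu> {a..<b}) \<le> 0"
    proof (rule LIMSEQ_le[OF stieltjes_inversion[OF \<mu> ab(1)] lim0], intro exI allI impI)
      fix n :: nat
      define e where "e = 1 / real (Suc n)"
      have e: "e > 0" by (simp add: e_def)
      have "(\<integral>s. indicator {a..b} s * I s e \<partial>lborel) \<le> (\<integral>s. indicator {a..b} s * (\<bar>R s e\<bar> / \<bar>b\<bar>) \<partial>lborel)"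
      proof (rule integral_mono)
        show "integrable lborel (\<lambda>s. indicator {a..b} s * I s e)"
          using I_bound[OF e] by (intro integrable_indicator_Icc_bounded[where B = "1 / e"]) auto
        show "integrable lborel (\<lambda>s. indicator {a..b} s * (\<bar>R s e\<bar> / \<bar>b\<bar>))"
          using R_bound by (intro integrable_indicator_Icc_bounded[where B = "1 / \<bar>b\<bar>"]) (auto intro!: divide_right_mono)
        fix s
        have "I s e \<le> \<bar>R s e\<bar> / \<bar>b\<bar>" if "s \<in> {a..b}"
        proof -
          have "I s e \<ge> 0" unfolding I_def using e by (intro integral_nonneg_AE) auto
          then have "\<bar>b\<bar> * I s e \<le> \<bar>s\<bar> * I s e" using that ab by (intro mult_right_mono) auto
          also have "\<dots> \<le> \<bar>R s e\<bar>" using that ab e by (intro le) auto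
          finally show ?thesis using ab by (simp add: field_simps)
        qed
        then show "indicator {a..b} s * I s e \<le> indicator {a..b} s * (\<bar>R s e\<bar> / \<bar>b\<bar>)"
          by (auto simp: indicator_def)
      qed
      then show "(\<integral>s. indicator {a..b} s * (- Im (cauchy_transform \<mu> (Complex s (1 / real (Suc n))))) \<partial>lborel)
          \<le> (\<integral>s. indicator {a..b} s * (\<bar>R s (1 / real (Suc n))\<bar> / \<bar>b\<bar>) \<partial>lborel)"
        using e by (simp add: Im_cauchy_transform[OF \<mu>] I_def flip: e_def del: of_nat_Suc)
    qed
    then have "measure \<mu> {a<..b} + measure \<mu> {a..<b} \<le> 0"
      using pi_gt_zero by (simp add: mult_le_0_iff)
    then show ?thesis
      using measure_nonneg[of \<mu> "{a<..b}"] measure_nonneg[of \<mu> "{a..<b}"] by linarith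
  qed
  \<comment> \<open>These intervals exhaust the negative axis. Starting at index 2 makes every left
    end strictly smaller than the right end, as \<open>null\<close> demands.\<close>
  have "AE x in \<mu>. \<forall>n. x \<notin> {- real (Suc (Suc n))<..- (1 / real (Suc (Suc n)))}"
    unfolding AE_all_countable
  proof
    fix n
    have "- real (Suc (Suc n)) < - (1 / real (Suc (Suc n)))"
      by (rule less_le_trans[of _ "- 1"]) (simp, simp only: neg_le_iff_le, simp)
    then have "{- real (Suc (Suc n))<..- (1 / real (Suc (Suc n)))} \<in> null_sets \<mu>"
      using null[of "- real (Suc (Suc n))" "- (1 / real (Suc (Suc n)))"]
      by (intro null_setsI) (simp_all only: emeasure_eq_measure, simp_all)
    then show "AE x in \<mu>. x \<notin> {- real (Suc (Suc n))<..- (1 / real (Suc (Suc n)))}"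
      by (rule AE_not_in)
  qed
  then have "AE x in \<mu>. 0 \<le> x"
  proof eventually_elim
    case (elim x)
    show ?case
    proof (rule ccontr)
      assume "\<not> 0 \<le> x"
      then have x: "x < 0" by simp
      obtain n where n: "real n > max (- x) (1 / - x)" using reals_Archimedean2 by blast
      have "real (Suc (Suc n)) > 1 / (- x)" using n by simp
      then have "x \<le> - (1 / real (Suc (Suc n)))" using x by (simp add: field_simps del: of_nat_Suc)
      moreover have "- real (Suc (Suc n)) < x" using n by simp
      ultimately show False using elim by auto
    qed
  qed
  then show ?thesis using \<mu> by (simp add: prob_on_nonneg_def)
qed

section \<open>The psi-transform on the negative half-line\<close>

lemma AE_eq_imp_return:
  assumes \<mu>: "real_distribution \<mu>" and AE: "AE x in \<mu>. x = a"
  shows "\<mu> = return borel a"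
proof -
  interpret real_distribution \<mu> by fact
  show ?thesis
  proof (rule measure_eqI)
    fix A assume A: "A \<in> sets \<mu>"
    have "emeasure \<mu> A = (\<integral>\<^sup>+x. indicator A x \<partial>\<mu>)" using A by simp
    also have "\<dots> = (\<integral>\<^sup>+x. indicator A a \<partial>\<mu>)"
      using AE by (intro nn_integral_cong_AE) auto
    also have "\<dots> = indicator A a" using emeasure_space_1 by simp
    finally show "emeasure \<mu> A = emeasure (return borel a) A" using A by simp
  qed simp
qed

lemma psi_kernel_bounds:
  fixes t x :: real
  assumes "t < 0" "0 \<le> x"
  shows "1 \<le> 1 - t * x" "- 1 \<le> t * x / (1 - t * x)" "t * x / (1 - t * x) \<le> 0"
    "0 < 1 / (1 - t * x)" "1 / (1 - t * x) \<le> 1" "1 / (1 - t * x) = 1 + t * x / (1 - t * x)"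
proof -
  have "t * x \<le> 0" using assms by (simp add: mult_nonpos_nonneg)
  then show "1 \<le> 1 - t * x" "- 1 \<le> t * x / (1 - t * x)" "t * x / (1 - t * x) \<le> 0"
    "0 < 1 / (1 - t * x)" "1 / (1 - t * x) \<le> 1" "1 / (1 - t * x) = 1 + t * x / (1 - t * x)"
    by (simp_all add: divide_simps)
qed

locale nonneg_prob = real_distribution \<mu> for \<mu> :: "real measure" +
  assumes AE_nonneg: "AE x in \<mu>. 0 \<le> x"

lemma prob_on_nonneg_iff: "prob_on_nonneg \<mu> \<longleftrightarrow> nonneg_prob \<mu>"
  by (simp add: prob_on_nonneg_def nonneg_prob_def nonneg_prob_axioms_def)

context nonneg_prob
begin

lemma real_distribution: "real_distribution \<mu>" ..

lemma psi_integrable: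
  assumes "t < 0" shows "integrable \<mu> (\<lambda>x. t * x / (1 - t * x))"
proof (rule finite_measure_integrable_bounded[where B = 1])
  show "AE x in \<mu>. norm (t * x / (1 - t * x)) \<le> 1"
    using AE_nonneg
  proof eventually_elim
    case (elim x)
    then show ?case using psi_kernel_bounds[OF assms elim] by (simp only: real_norm_def abs_le_iff) linarith
  qed
qed (auto intro: finite_measure_axioms)

lemma M_integrable:
  assumes "t < 0" shows "integrable \<mu> (\<lambda>x. 1 / (1 - t * x))"
proof (rule finite_measure_integrable_bounded[where B = 1])
  show "AE x in \<mu>. norm (1 / (1 - t * x)) \<le> 1"
    using AE_nonneg
  proof eventually_elim
    case (elim x)
    then show ?case using psi_kernel_bounds(4,5)[OF assms elim] by (simp only: real_norm_def abs_of_pos)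
  qed
qed (auto intro: finite_measure_axioms)

lemma M_eq_psi:
  assumes "t < 0" shows "(\<integral>x. 1 / (1 - t * x) \<partial>\<mu>) = 1 + psi_transform \<mu> t"
proof -
  have "(\<integral>x. 1 / (1 - t * x) \<partial>\<mu>) = (\<integral>x. 1 + t * x / (1 - t * x) \<partial>\<mu>)"
    using AE_nonneg by (intro integral_cong_AE) (auto elim!: eventually_mono simp: psi_kernel_bounds(6)[OF assms])
  then show ?thesis
    using prob_space psi_integrable[OF assms] by (simp add: psi_transform_def)
qed

lemma psi_nonpos:
  assumes "t < 0" shows "psi_transform \<mu> t \<le> 0"
proof -
  have "psi_transform \<mu> t \<le> (\<integral>x. 0 \<partial>\<mu>)"
    unfolding psi_transform_def using AE_nonneg psi_kernel_bounds(3)[OF assms]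
    by (intro integral_mono_AE psi_integrable assms) (auto elim!: eventually_mono)
  then show ?thesis by simp
qed

lemma psi_gt_minus_1:
  assumes "t < 0" shows "- 1 < psi_transform \<mu> t"
proof -
  have "(\<integral>x. 0 \<partial>\<mu>) < (\<integral>x. 1 / (1 - t * x) \<partial>\<mu>)"
    using AE_nonneg psi_kernel_bounds(4)[OF assms] M_integrable[OF assms] emeasure_space_1
    by (intro integral_less_AE_space) (auto elim!: eventually_mono)
  then show ?thesis using M_eq_psi[OF assms] by simp
qed

text \<open>The bridge between the two kinds of transform: identities between complex transforms,
  once carried to the reciprocal \<open>1 / t\<close>, become identities for the real function
  \<open>psi\<close> at \<open>t\<close>.\<close>

lemma cauchy_transform_neg:
  assumes "t < 0"
  shows "cauchy_transform \<mu> (of_real (1 / t)) = of_real (t * (1 + psi_transform \<mu> t))"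
proof -
  have "cauchy_transform \<mu> (of_real (1 / t)) = (\<integral>x. of_real (t * (1 / (1 - t * x))) \<partial>\<mu>)"
    unfolding cauchy_transform_def
  proof (rule integral_cong_AE)
    show "AE x in \<mu>. 1 / (complex_of_real (1 / t) - complex_of_real x) = of_real (t * (1 / (1 - t * x)))"
      using AE_nonneg
    proof eventually_elim
      case (elim x)
      have "1 / (1 / t - x) = t * (1 / (1 - t * x))"
        using assms psi_kernel_bounds(1)[OF assms elim] by (auto simp: divide_simps mult.commute[of x])
      then show ?case by (metis of_real_1 of_real_diff of_real_divide)
    qed
  qed auto
  also have "\<dots> = of_real (t * (1 + psi_transform \<mu> t))"
    using M_eq_psi[OF assms] by (simp only: integral_complex_of_real Bochner_Integration.integral_mult_right_zero)
  finally show ?thesis .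
qed

lemma psi_tendsto:
  assumes t: "t < 0" and X: "X \<longlonglongrightarrow> t" "\<And>n. X n < 0"
  shows "(\<lambda>n. psi_transform \<mu> (X n)) \<longlonglongrightarrow> psi_transform \<mu> t"
  unfolding psi_transform_def
proof (rule integral_dominated_convergence[where w = "\<lambda>_. 1"])
  show "AE x in \<mu>. (\<lambda>n. X n * x / (1 - X n * x)) \<longlonglongrightarrow> t * x / (1 - t * x)"
    using AE_nonneg
  proof eventually_elim
    case (elim x)
    show ?case using psi_kernel_bounds(1)[OF t elim] by (intro tendsto_intros X) auto
  qed
  show "AE x in \<mu>. norm (X n * x / (1 - X n * x)) \<le> 1" for n
    using AE_nonneg
  proof eventually_elim
    case (elim x)
    then show ?case using psi_kernel_bounds[OF X(2) elim, of n] by (simp only: real_norm_def abs_le_iff) linarith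
  qed
qed auto

lemma psi_continuous_on: "continuous_on {..<0} (psi_transform \<mu>)"
  unfolding continuous_on_sequentially
  by (auto simp: o_def intro!: psi_tendsto)

lemma psi_tendsto_0: "((\<lambda>t. psi_transform \<mu> t) \<longlongrightarrow> 0) (at_left 0)"
proof (rule tendsto_at_left_sequentially[where b = "-1"])
  fix X :: "nat \<Rightarrow> real" assume X: "\<And>n. X n < 0" "X \<longlonglongrightarrow> 0"
  have "(\<lambda>n. psi_transform \<mu> (X n)) \<longlonglongrightarrow> (\<integral>x. 0 \<partial>\<mu>)"
    unfolding psi_transform_def
  proof (rule integral_dominated_convergence[where w = "\<lambda>_. 1"])
    show "AE x in \<mu>. (\<lambda>n. X n * x / (1 - X n * x)) \<longlonglongrightarrow> 0"
    proof (intro AE_I2)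
      fix x
      have "(\<lambda>n. X n * x / (1 - X n * x)) \<longlonglongrightarrow> 0 * x / (1 - 0 * x)"
        by (intro tendsto_intros X) auto
      then show "(\<lambda>n. X n * x / (1 - X n * x)) \<longlonglongrightarrow> 0" by simp
    qed
    show "AE x in \<mu>. norm (X n * x / (1 - X n * x)) \<le> 1" for n
      using AE_nonneg
    proof eventually_elim
      case (elim x)
      then show ?case using psi_kernel_bounds[OF X(1) elim, of n] by (simp only: real_norm_def abs_le_iff) linarith
    qed
  qed auto
  then show "(\<lambda>n. psi_transform \<mu> (X n)) \<longlonglongrightarrow> 0" by simp
qed auto

lemma psi_tendsto_at_bot: "(\<lambda>n. psi_transform \<mu> (- real (Suc n))) \<longlonglongrightarrow> measure \<mu> {0} - 1"
proof -
  have "(\<lambda>n. psi_transform \<mu> (- real (Suc n))) \<longlonglongrightarrow> (\<integral>x. indicator {0} x - 1 \<partial>\<mu>)"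
    unfolding psi_transform_def
  proof (rule integral_dominated_convergence[where w = "\<lambda>_. 1"])
    show "AE x in \<mu>. (\<lambda>n. - real (Suc n) * x / (1 - - real (Suc n) * x)) \<longlonglongrightarrow> indicator {0} x - 1"
      using AE_nonneg
    proof eventually_elim
      case (elim x)
      show ?case
      proof (cases "x = 0")
        case False
        then have x: "x > 0" using elim by simp
        have "(\<lambda>n. - x / (inverse (real (Suc n)) + x)) \<longlonglongrightarrow> - x / (0 + x)"
          using x by (intro tendsto_intros LIMSEQ_inverse_real_of_nat) auto
        moreover have "- x / (inverse (real (Suc n)) + x) = - real (Suc n) * x / (1 - - real (Suc n) * x)" for n
          using x by (simp add: field_simps del: of_nat_Suc)
        ultimately show ?thesis using x by simp
      qed simp
    qed
    show "AE x in \<mu>. norm (- real (Suc n) * x / (1 - - real (Suc n) * x)) \<le> 1" for n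
      using AE_nonneg
    proof eventually_elim
      case (elim x)
      have "- real (Suc n) < 0" by simp
      from psi_kernel_bounds[OF this elim] show ?case by (simp only: real_norm_def abs_le_iff) linarith
    qed
  qed auto
  moreover have "(\<integral>x. indicator {0} x - 1 \<partial>\<mu>) = measure \<mu> {0} - 1"
    using prob_space by (subst Bochner_Integration.integral_diff) (auto simp: less_top[symmetric])
  ultimately show ?thesis by simp
qed

lemma psi_div_eq:
  assumes "t < 0" shows "psi_transform \<mu> t / t = (\<integral>x. x / (1 - t * x) \<partial>\<mu>)"
    and "integrable \<mu> (\<lambda>x. x / (1 - t * x))"
proof -
  have eq: "(\<lambda>x. x / (1 - t * x)) = (\<lambda>x. (1 / t) * (t * x / (1 - t * x)))"
    using assms by (auto simp: fun_eq_iff)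
  show "integrable \<mu> (\<lambda>x. x / (1 - t * x))"
    unfolding eq by (intro integrable_mult_right psi_integrable assms)
  show "psi_transform \<mu> t / t = (\<integral>x. x / (1 - t * x) \<partial>\<mu>)"
    unfolding eq Bochner_Integration.integral_mult_right_zero psi_transform_def by simp
qed

text \<open>The integrand \<open>x / (1 - t * x)\<close> increases with \<open>t\<close> for each
  \<open>x \<ge> 0\<close>. This bounds the slope at \<open>t\<close> by a slope taken closer to
  \<open>0\<close>, where the S-transform of a power is known.\<close>

lemma psi_div_mono:
  assumes "s \<le> t" "t < 0" shows "psi_transform \<mu> s / s \<le> psi_transform \<mu> t / t"
proof -
  have s: "s < 0" using assms by simp
  show ?thesis
    unfolding psi_div_eq(1)[OF s] psi_div_eq(1)[OF assms(2)]
  proof (rule integral_mono_AE[OF psi_div_eq(2)[OF s] psi_div_eq(2)[OF assms(2)]])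
    show "AE x in \<mu>. x / (1 - s * x) \<le> x / (1 - t * x)"
      using AE_nonneg
    proof eventually_elim
      case (elim x)
      have "1 - t * x \<le> 1 - s * x" using elim assms by (simp add: mult_right_mono)
      then show ?case using psi_kernel_bounds(1)[OF s elim] psi_kernel_bounds(1)[OF assms(2) elim] elim
        by (intro divide_left_mono) auto
    qed
  qed
qed

lemma emeasure_pos:
  assumes "\<mu> \<noteq> return borel 0" shows "emeasure \<mu> {0<..} \<noteq> 0"
proof
  assume "emeasure \<mu> {0<..} = 0"
  then have "AE x in \<mu>. x \<notin> {0<..}" by (intro AE_not_in null_setsI) auto
  with AE_nonneg have "AE x in \<mu>. x = 0" by eventually_elim auto
  then show False using AE_eq_imp_return[OF real_distribution] assms by blast
qed

lemma psi_strict_mono: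
  assumes nz: "\<mu> \<noteq> return borel 0" and st: "s < t" "t < 0"
  shows "psi_transform \<mu> s < psi_transform \<mu> t"
  unfolding psi_transform_def
proof (rule integral_less_AE[where A = "{0<..}"])
  have s: "s < 0" using st by simp
  have *: "t * x / (1 - t * x) - s * x / (1 - s * x) = (t - s) * x / ((1 - t * x) * (1 - s * x))" if "0 \<le> x" for x
    using psi_kernel_bounds(1)[OF s that] psi_kernel_bounds(1)[OF st(2) that] 
    by (simp add: divide_simps) (simp add: algebra_simps)
  show "AE x in \<mu>. x \<in> {0<..} \<longrightarrow> s * x / (1 - s * x) \<noteq> t * x / (1 - t * x)"
  proof (intro AE_I2 impI)
    fix x :: real assume "x \<in> {0<..}"
    then have x: "x \<ge> 0" "x > 0" by auto
    have "(t - s) * x / ((1 - t * x) * (1 - s * x)) > 0"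
      using psi_kernel_bounds(1)[OF s x(1)] psi_kernel_bounds(1)[OF st(2) x(1)] x st
      by (intro divide_pos_pos mult_pos_pos) auto
    then show "s * x / (1 - s * x) \<noteq> t * x / (1 - t * x)" using *[OF x(1)] by auto
  qed
  show "AE x in \<mu>. s * x / (1 - s * x) \<le> t * x / (1 - t * x)"
    using AE_nonneg
  proof eventually_elim
    case (elim x)
    have "(t - s) * x / ((1 - t * x) * (1 - s * x)) \<ge> 0"
      using psi_kernel_bounds(1)[OF s elim] psi_kernel_bounds(1)[OF st(2) elim] elim st
      by (intro divide_nonneg_nonneg mult_nonneg_nonneg) auto
    then show ?case using *[OF elim] by linarith
  qed
  show "emeasure \<mu> {0<..} \<noteq> 0" by (rule emeasure_pos[OF nz])
qed (use st in \<open>auto intro: psi_integrable\<close>)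

lemma psi_neg:
  assumes nz: "\<mu> \<noteq> return borel 0" and t: "t < 0"
  shows "psi_transform \<mu> t < 0"
  using psi_strict_mono[OF nz, of t "t / 2"] psi_nonpos[of "t / 2"] t by simp

lemma psi_gt_atom:
  assumes nz: "\<mu> \<noteq> return borel 0" and t: "t < 0"
  shows "measure \<mu> {0} - 1 < psi_transform \<mu> t"
proof -
  \<comment> \<open>The detour through \<open>t - 1\<close> restores the strictness that is lost in
    the limit.\<close>
  have "measure \<mu> {0} - 1 \<le> psi_transform \<mu> (t - 1)"
  proof (rule tendsto_upperbound[OF psi_tendsto_at_bot])
    obtain N where N: "- (t - 1) < real N" using reals_Archimedean2 by blast
    show "eventually (\<lambda>n. psi_transform \<mu> (- real (Suc n)) \<le> psi_transform \<mu> (t - 1)) sequentially"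
      unfolding eventually_sequentially
    proof (intro exI allI impI)
      fix n assume "N \<le> n"
      then have "- real (Suc n) < t - 1" using N by simp
      then show "psi_transform \<mu> (- real (Suc n)) \<le> psi_transform \<mu> (t - 1)"
        using psi_strict_mono[OF nz] t by (simp add: less_imp_le)
    qed
  qed auto
  also have "\<dots> < psi_transform \<mu> t" using psi_strict_mono[OF nz, of "t - 1" t] t by simp
  finally show ?thesis .
qed

section \<open>The inverse of psi and the S-transform\<close>

lemma psi_surj:
  assumes nz: "\<mu> \<noteq> return borel 0" and u: "u \<in> S_domain \<mu>"
  obtains t where "t < 0" "psi_transform \<mu> t = u"
proof -
  have u': "measure \<mu> {0} - 1 < u" "u < 0" using u by (auto simp: S_domain_def)
  have "eventually (\<lambda>n. psi_transform \<mu> (- real (Suc n)) < u) sequentially"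
    using order_tendstoD(2)[OF psi_tendsto_at_bot u'(1)] .
  then obtain n where n: "psi_transform \<mu> (- real (Suc n)) < u" by (auto simp: eventually_sequentially)
  have "eventually (\<lambda>t. u < psi_transform \<mu> t \<and> - real (Suc n) < t \<and> t < 0) (at_left 0)"
    using order_tendstoD(1)[OF psi_tendsto_0 u'(2)] eventually_at_left[of "- real (Suc n)" "0::real"]
    by (intro eventually_conj) (auto intro!: exI[of _ "- real (Suc n)"] simp: eventually_at_filter)
  then obtain t where t: "u < psi_transform \<mu> t" "- real (Suc n) < t" "t < 0"
    using eventually_happens'[of "at_left (0::real)"] by auto
  have "\<exists>c\<ge>- real (Suc n). c \<le> t \<and> psi_transform \<mu> c = u"
    using n t by (intro IVT' continuous_on_subset[OF psi_continuous_on]) auto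
  then obtain c where "c \<le> t" "psi_transform \<mu> c = u" by blast
  then show ?thesis using t that[of c] by simp
qed

lemma psi_inj_on: "\<mu> \<noteq> return borel 0 \<Longrightarrow> inj_on (psi_transform \<mu>) {..<0}"
  by (intro linorder_inj_onI) (auto dest: psi_strict_mono)

lemma chi_psi: "\<mu> \<noteq> return borel 0 \<Longrightarrow> t < 0 \<Longrightarrow> chi_transform \<mu> (psi_transform \<mu> t) = t"
  unfolding chi_transform_def by (intro the_inv_into_f_f psi_inj_on) auto

lemma psi_chi:
  assumes "\<mu> \<noteq> return borel 0" "u \<in> S_domain \<mu>"
  shows "chi_transform \<mu> u < 0" "psi_transform \<mu> (chi_transform \<mu> u) = u"
  using psi_surj[OF assms] chi_psi[OF assms(1)] by metis+

lemma S_transform_psi: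
  assumes "\<mu> \<noteq> return borel 0" "t < 0"
  shows "S_transform \<mu> (psi_transform \<mu> t) = t * (1 + psi_transform \<mu> t) / psi_transform \<mu> t"
  by (simp add: S_transform_def chi_psi[OF assms])

lemma S_transform_pos:
  assumes "\<mu> \<noteq> return borel 0" "u \<in> S_domain \<mu>"
  shows "S_transform \<mu> u > 0"
proof -
  have "- 1 < u" using psi_gt_minus_1 psi_chi[OF assms] by metis
  moreover have "u < 0" using assms by (simp add: S_domain_def)
  ultimately show ?thesis
    using psi_chi(1)[OF assms] by (simp add: S_transform_def zero_less_divide_iff mult_less_0_iff)
qed

lemma atom_lt_1:
  assumes "\<mu> \<noteq> return borel 0" shows "measure \<mu> {0} < 1"
  using psi_gt_atom[OF assms, of "-1"] psi_neg[OF assms, of "-1"] by simp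

end

text \<open>Equality of \<open>psi\<close> is equality of the Cauchy transforms on the negative
  axis. The identity theorem on the plane slit along \<open>[0, infinity)\<close> extends it to the
  upper half-plane, where inversion applies.\<close>

lemma nonneg_measure_eqI:
  assumes \<mu>: "prob_on_nonneg \<mu>" and \<nu>: "prob_on_nonneg \<nu>"
    and eq: "\<And>t. t < 0 \<Longrightarrow> psi_transform \<mu> t = psi_transform \<nu> t"
  shows "\<mu> = \<nu>"
proof (rule cauchy_transform_determines_measure)
  interpret M: nonneg_prob \<mu> using \<mu> by (simp add: prob_on_nonneg_iff)
  interpret N: nonneg_prob \<nu> using \<nu> by (simp add: prob_on_nonneg_iff)
  show "real_distribution \<mu>" "real_distribution \<nu>" ..
  let ?S = "- (complex_of_real ` {0..})"
  have conn: "connected ?S"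
  proof -
    \<comment> \<open>Seen from \<open>-1\<close>, a segment meets the slit only if its other end
      already lies on the slit.\<close>
    have "starlike ?S"
      unfolding starlike_def
    proof (intro bexI ballI subsetI)
      fix z w assume z: "z \<in> ?S" and "w \<in> closed_segment (- 1) z"
      then obtain u where u: "0 \<le> u" "u \<le> 1" "w = (1 - u) *\<^sub>R (- 1) + u *\<^sub>R z"
        by (auto simp: in_segment)
      show "w \<in> ?S"
      proof
        assume "w \<in> complex_of_real ` {0..}"
        then obtain x where x: "x \<ge> 0" "w = of_real x" by auto
        then have *: "Im w = 0" "Re w \<ge> 0" by auto
        have "u * Im z = 0" "u * Re z \<ge> 1 - u" using * u by auto
        then have "Im z = 0 \<and> Re z \<ge> 0" using u
          by (cases "u = 0") (auto simp: zero_le_mult_iff intro: order_trans[rotated], smt (verit) mult_pos_neg)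
        then have "z = of_real (Re z)" "Re z \<in> {0..}" by (auto simp: complex_eq_iff)
        then show False using z by blast
      qed
    qed (auto simp: complex_eq_iff)
    then show ?thesis by (rule starlike_imp_connected)
  qed
  have op: "open ?S" by (intro open_Compl closed_of_real_image) auto
  have hol: "(\<lambda>z. cauchy_transform \<mu> z - cauchy_transform \<nu> z) holomorphic_on ?S"
    by (intro holomorphic_intros cauchy_transform_holomorphic prob_on_nonneg_real_distribution prob_on_nonneg_AE \<mu> \<nu>) auto
  fix z assume z: "Im z > 0"
  have "cauchy_transform \<mu> z - cauchy_transform \<nu> z = 0"
  proof (rule analytic_continuation[OF hol op conn, where U = "complex_of_real ` {..<0}" and \<xi> = "- 1"])
    show "- 1 islimpt complex_of_real ` {..<0}"
      unfolding islimpt_sequential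
    proof (intro exI conjI allI)
      show "(\<lambda>n. complex_of_real (- 1 - 1 / real (Suc n))) \<longlonglongrightarrow> - 1"
        using tendsto_of_real[OF tendsto_diff[OF tendsto_const[of "- 1"] LIMSEQ_inverse_real_of_nat], where 'a = complex]
        by (simp add: inverse_eq_divide)
      fix n
      have "- 1 - 1 / real (Suc n) \<noteq> - 1" "- 1 - 1 / real (Suc n) < 0"
        by (simp_all add: less_trans[OF neg_less_0_iff_less[THEN iffD2, OF zero_less_one] zero_less_divide_iff[THEN iffD2]] less_le_trans[OF _ zero_le_divide_iff[THEN iffD2], of "-1"])
      then show "complex_of_real (- 1 - 1 / real (Suc n)) \<in> complex_of_real ` {..<0} - {- 1}"
        by (auto simp: complex_eq_iff)
    qed
    fix w assume "w \<in> complex_of_real ` {..<0}"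
    \<comment> \<open>The double reciprocal matches the form \<open>1 / t\<close> at which
      \<open>cauchy_transform_neg\<close> is stated.\<close>
    then obtain x where x: "x < 0" "w = of_real (1 / (1 / x))" by auto
    have "1 / x < 0" using x by simp
    then show "cauchy_transform \<mu> w - cauchy_transform \<nu> w = 0"
      unfolding x(2) by (simp only: M.cauchy_transform_neg N.cauchy_transform_neg eq) simp
  qed (use z in \<open>auto simp: complex_eq_iff\<close>)
  then show "cauchy_transform \<mu> z = cauchy_transform \<nu> z" by simp
qed

section \<open>A continuity theorem for the psi-transform\<close>

text \<open>Markov's inequality: at \<open>t = - 1 / y\<close> the negated kernel is
  \<open>x / (y + x)\<close>, which is at least \<open>1 / 2\<close> beyond
  \<open>y\<close>.\<close>

lemma (in nonneg_prob) tail_le_psi: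
  assumes "y > 0"
  shows "measure \<mu> {y<..} \<le> - 2 * psi_transform \<mu> (- (1 / y))"
proof -
  have t: "- (1 / y) < 0" using assms by simp
  have "measure \<mu> {y<..} = (\<integral>x. indicator {y<..} x \<partial>\<mu>)" by simp
  also have "\<dots> \<le> (\<integral>x. - 2 * (- (1 / y) * x / (1 - - (1 / y) * x)) \<partial>\<mu>)"
  proof (rule integral_mono_AE)
    show "integrable \<mu> (\<lambda>x. - 2 * (- (1 / y) * x / (1 - - (1 / y) * x)))"
      by (intro integrable_mult_right psi_integrable t)
    show "AE x in \<mu>. indicator {y<..} x \<le> - 2 * (- (1 / y) * x / (1 - - (1 / y) * x))"
      using AE_nonneg
    proof eventually_elim
      case (elim x)
      have "- (1 / y) * x / (1 - - (1 / y) * x) = - (x / (y + x))"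
        using assms elim by (simp add: divide_simps)
      then show ?case using assms elim by (auto simp: indicator_def divide_simps)
    qed
  qed (auto simp: less_top[symmetric])
  also have "\<dots> = - 2 * psi_transform \<mu> (- (1 / y))"
    unfolding psi_transform_def by (rule Bochner_Integration.integral_mult_right_zero)
  finally show ?thesis .
qed

text \<open>Replacing \<open>x\<close> by \<open>max 0 x\<close> alters the kernel on a null set
  only and makes it bounded and continuous on the whole line, so that it can be tested against weak
  convergence.\<close>

lemma (in nonneg_prob) M_eq_bounded_continuous:
  assumes "t < 0"
  shows "(\<integral>x. 1 / (1 - t * max 0 x) \<partial>\<mu>) = 1 + psi_transform \<mu> t"
  unfolding M_eq_psi[OF assms, symmetric]
  by (intro integral_cong_AE) (use AE_nonneg in \<open>auto elim!: eventually_mono simp: max_def\<close>)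

lemma weak_limit_nonneg:
  assumes \<mu>: "\<And>n. prob_on_nonneg (\<mu> n)" and M: "real_distribution M" and lim: "weak_conv_m \<mu> M"
  shows "prob_on_nonneg M"
proof -
  interpret M: real_distribution M by fact
  \<comment> \<open>A bounded continuous function that is positive exactly on the negative
    axis.\<close>
  let ?f = "\<lambda>x::real. max 0 (min 1 (- x))"
  have "(\<lambda>n. integral\<^sup>L (\<mu> n) ?f) \<longlonglongrightarrow> integral\<^sup>L M ?f"
    by (rule weak_conv_imp_integral_bdd_continuous_conv[OF prob_on_nonneg_real_distribution[OF \<mu>] M lim, where B = 1])
       (auto intro!: continuous_intros)
  moreover have "integral\<^sup>L (\<mu> n) ?f = (\<integral>x. 0 \<partial>\<mu> n)" for n
  proof (rule integral_cong_AE)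
    interpret nonneg_prob "\<mu> n" using \<mu>[of n] by (simp add: prob_on_nonneg_iff)
    show "AE x in \<mu> n. ?f x = 0" using AE_nonneg by eventually_elim auto
  qed (use prob_on_nonneg_real_distribution[OF \<mu>[of n]] in
     \<open>auto simp: real_distribution_def real_distribution_axioms_def cong: measurable_cong_sets\<close>)
  ultimately have "(\<lambda>n. 0) \<longlonglongrightarrow> integral\<^sup>L M ?f" by simp
  then have 0: "integral\<^sup>L M ?f = 0" using LIMSEQ_unique[OF tendsto_const] by metis
  have "integrable M ?f"
    by (rule finite_measure_integrable_bounded[where B = 1]) (auto intro: M.finite_measure_axioms)
  then have "AE x in M. ?f x = 0"
    using 0 by (subst integral_nonneg_eq_0_iff_AE[symmetric]) auto
  then have "AE x in M. 0 \<le> x" by eventually_elim (auto simp: max_def min_def split: if_splits)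
  then show ?thesis using M by (simp add: prob_on_nonneg_def)
qed

lemma weak_limit_psi:
  assumes \<mu>: "\<And>n. prob_on_nonneg (\<mu> n)" and M: "real_distribution M" and lim: "weak_conv_m \<mu> M" and t: "t < 0"
  shows "(\<lambda>n. psi_transform (\<mu> n) t) \<longlonglongrightarrow> psi_transform M t"
proof -
  interpret M: nonneg_prob M using weak_limit_nonneg[OF \<mu> M lim] by (simp add: prob_on_nonneg_iff)
  have pos: "1 - t * max 0 x \<ge> 1" for x
    using psi_kernel_bounds(1)[OF t, of "max 0 x"] by simp
  have "(\<lambda>n. \<integral>x. 1 / (1 - t * max 0 x) \<partial>\<mu> n) \<longlonglongrightarrow> (\<integral>x. 1 / (1 - t * max 0 x) \<partial>M)"
  proof (rule weak_conv_imp_integral_bdd_continuous_conv[OF prob_on_nonneg_real_distribution[OF \<mu>] M lim, where B = 1])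
    show "isCont (\<lambda>x. 1 / (1 - t * max 0 x)) x" for x
      using pos[of x] by (intro continuous_intros) auto
    show "norm (1 / (1 - t * max 0 x)) \<le> 1" for x
      using pos[of x] by (simp add: norm_divide)
  qed
  moreover have "(\<integral>x. 1 / (1 - t * max 0 x) \<partial>\<mu> n) = 1 + psi_transform (\<mu> n) t" for n
    by (rule nonneg_prob.M_eq_bounded_continuous[OF _ t]) (use \<mu> in \<open>simp add: prob_on_nonneg_iff\<close>)
  ultimately have "(\<lambda>n. 1 + psi_transform (\<mu> n) t) \<longlonglongrightarrow> 1 + psi_transform M t"
    by (simp only: M.M_eq_bounded_continuous[OF t])
  then show ?thesis using tendsto_diff[OF _ tendsto_const[of 1]] by fastforce
qed

text \<open>Mass can escape only to plus infinity, and \<open>tail_le_psi\<close> controls the tail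
  beyond \<open>- 1 / t\<close> by \<open>psi\<close> at \<open>t\<close>. Since \<open>u\<close>
  vanishes at \<open>0\<close>, some \<open>t\<close> makes this tail smaller than
  \<open>\<epsilon>\<close> for all large \<open>n\<close>.\<close>

lemma psi_limit_tight:
  assumes \<mu>: "\<And>n. prob_on_nonneg (\<mu> n)"
    and lim: "\<And>t. t < 0 \<Longrightarrow> (\<lambda>n. psi_transform (\<mu> n) t) \<longlonglongrightarrow> u t"
    and u0: "(u \<longlongrightarrow> 0) (at_left 0)"
  shows "tight \<mu>"
  unfolding tight_def
proof (intro conjI allI impI prob_on_nonneg_real_distribution[OF \<mu>])
  fix \<epsilon> :: real assume \<epsilon>: "\<epsilon> > 0"
  have "eventually (\<lambda>t. - (\<epsilon> / 2) < u t \<and> t < 0) (at_left 0)"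
    using order_tendstoD(1)[OF u0, of "- (\<epsilon> / 2)"] \<epsilon>
    by (intro eventually_conj) (auto simp: eventually_at_filter)
  then obtain t where t: "- (\<epsilon> / 2) < u t" "t < 0"
    using eventually_happens'[of "at_left (0::real)"] by auto
  define y where "y = - (1 / t)"
  have y: "y > 0" "- (1 / y) = t" using t by (auto simp: y_def)
  \<comment> \<open>The left end \<open>-1\<close> lies below the half-line, so that a half-open
    interval also contains an atom at \<open>0\<close>.\<close>
  have tail: "measure (\<mu> n) {-1<..c} = 1 - measure (\<mu> n) {c<..}" if "c > 0" for n c
  proof -
    interpret nonneg_prob "\<mu> n" using \<mu>[of n] by (simp add: prob_on_nonneg_iff)
    have "measure (\<mu> n) {-1<..c} = measure (\<mu> n) (UNIV - {c<..})"
      using AE_nonneg that by (intro finite_measure_eq_AE) (auto elim!: eventually_mono)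
    then show ?thesis using prob_compl[of "{c<..}"] by simp
  qed
  obtain N where N: "\<And>n. n \<ge> N \<Longrightarrow> - (\<epsilon> / 2) < psi_transform (\<mu> n) t"
    using order_tendstoD(1)[OF lim[OF t(2)] t(1)] by (auto simp: eventually_sequentially)
  have "\<exists>c. c > 0 \<and> measure (\<mu> n) {c<..} < \<epsilon>" for n
  proof -
    interpret nonneg_prob "\<mu> n" using \<mu>[of n] by (simp add: prob_on_nonneg_iff)
    have "eventually (\<lambda>c. 1 - \<epsilon> < cdf (\<mu> n) c \<and> c > 0) at_top"
      using order_tendstoD(1)[OF cdf_lim_at_top_prob, of "1 - \<epsilon>"] \<epsilon> 
      by (intro eventually_conj eventually_gt_at_top) auto
    then obtain c where c: "1 - \<epsilon> < cdf (\<mu> n) c" "c > 0"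
      using eventually_happens'[of "at_top :: real filter"] by auto
    have "UNIV - {c<..} = {..c}" by auto
    then have "measure (\<mu> n) {c<..} = 1 - cdf (\<mu> n) c"
      using prob_compl[of "{c<..}"] by (simp add: cdf_def)
    then show ?thesis using c by auto
  qed
  then obtain c where c: "\<And>n. c n > 0" "\<And>n. measure (\<mu> n) {c n<..} < \<epsilon>" by metis
  \<comment> \<open>The bound from \<open>psi\<close> covers all indices from \<open>N\<close> on;
    each of the finitely many others contributes its own truncation point.\<close>
  define b where "b = Max (insert y (c ` {..<N}))"
  have b: "b \<ge> y" "\<And>n. n < N \<Longrightarrow> b \<ge> c n" by (auto simp: b_def)
  have "measure (\<mu> n) {b<..} < \<epsilon>" for n
  proof -
    interpret nonneg_prob "\<mu> n" using \<mu>[of n] by (simp add: prob_on_nonneg_iff)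
    show ?thesis
    proof (cases "n < N")
      case True
      have "measure (\<mu> n) {b<..} \<le> measure (\<mu> n) {c n<..}"
        using b(2)[OF True] by (intro finite_measure_mono) auto
      then show ?thesis using c(2)[of n] by simp
    next
      case False
      have "measure (\<mu> n) {b<..} \<le> measure (\<mu> n) {y<..}"
        using b(1) by (intro finite_measure_mono) auto
      also have "\<dots> \<le> - 2 * psi_transform (\<mu> n) t" using tail_le_psi[OF y(1)] y(2) by simp
      finally show ?thesis using N[of n] False by simp
    qed
  qed
  then have "1 - \<epsilon> < measure (\<mu> n) {-1<..b}" for n
    using tail[of b n] b(1) y(1) by (smt (verit))
  then show "\<exists>a b. a < b \<and> (\<forall>n. 1 - \<epsilon> < measure (\<mu> n) {a<..b})"
    using b(1) y(1) by (intro exI[of _ "-1"] exI[of _ b]) auto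
qed

text \<open>Every subsequential limit has transform \<open>u\<close>, and the transform determines
  the law, so tightness yields convergence of the whole sequence. That \<open>u\<close> belongs to a
  probability law at all is part of the conclusion; this is how the limit laws come into
  being.\<close>

theorem psi_continuity:
  assumes \<mu>: "\<And>n. prob_on_nonneg (\<mu> n)"
    and lim: "\<And>t. t < 0 \<Longrightarrow> (\<lambda>n. psi_transform (\<mu> n) t) \<longlonglongrightarrow> u t"
    and u0: "(u \<longlongrightarrow> 0) (at_left 0)"
  obtains M where "prob_on_nonneg M" "weak_conv_m \<mu> M" "\<And>t. t < 0 \<Longrightarrow> psi_transform M t = u t"
proof -
  note tight = psi_limit_tight[OF assms]
  have sub: "prob_on_nonneg \<nu> \<and> (\<forall>t<0. psi_transform \<nu> t = u t)"
    if s: "strict_mono s" and \<nu>: "real_distribution \<nu>" and w: "weak_conv_m (\<mu> \<circ> s) \<nu>" for s \<nu>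
  proof (intro conjI allI impI)
    have p: "prob_on_nonneg ((\<mu> \<circ> s) n)" for n using \<mu> by simp
    show "prob_on_nonneg \<nu>" by (rule weak_limit_nonneg[OF p \<nu> w])
    fix t :: real assume t: "t < 0"
    have "(\<lambda>n. psi_transform ((\<mu> \<circ> s) n) t) \<longlonglongrightarrow> u t"
      using LIMSEQ_subseq_LIMSEQ[OF lim[OF t] s] by (simp add: o_def)
    then show "psi_transform \<nu> t = u t"
      using weak_limit_psi[OF p \<nu> w t] LIMSEQ_unique by blast
  qed
  obtain r M where M: "strict_mono (r :: nat \<Rightarrow> nat)" "real_distribution M" "weak_conv_m (\<mu> \<circ> id \<circ> r) M"
    using tight_imp_convergent_subsubsequence[OF tight strict_mono_id] by blast
  then have M': "prob_on_nonneg M" "\<And>t. t < 0 \<Longrightarrow> psi_transform M t = u t"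
    using sub[of r M] by auto
  have "weak_conv_m \<mu> M"
  proof (rule tight_subseq_weak_converge[OF prob_on_nonneg_real_distribution[OF \<mu>] M(2) tight])
    fix s \<nu> assume *: "strict_mono s" "real_distribution \<nu>" "weak_conv_m (\<mu> \<circ> s) \<nu>"
    have "\<nu> = M" using sub[OF *] M' by (intro nonneg_measure_eqI) auto
    then show "weak_conv_m (\<mu> \<circ> s) M" using * by simp
  qed
  then show thesis using M' that by blast
qed

section \<open>Free multiplicative powers\<close>

text \<open>\<open>free_mult_conv\<close> constrains \<open>S\<^sub>\<rho>\<close> only on the common domain, which might a priori shrink
  with every further factor. A larger atom of \<open>\<rho>\<close> at \<open>0\<close> is impossible because \<open>S\<^sub>\<rho>\<close> would be
  unbounded at an interior point of the two other domains.\<close>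

lemma free_mult_conv_atom_le:
  assumes conv: "free_mult_conv \<mu> \<nu> \<rho>" and nz: "\<mu> \<noteq> return borel 0" "\<nu> \<noteq> return borel 0"
  shows "measure \<rho> {0} \<le> max (measure \<mu> {0}) (measure \<nu> {0})"
proof (rule ccontr)
  have \<rho>0: "\<rho> \<noteq> return borel 0"
    and S: "\<And>u. u \<in> S_domain \<mu> \<inter> S_domain \<nu> \<inter> S_domain \<rho> \<Longrightarrow> S_transform \<rho> u = S_transform \<mu> u * S_transform \<nu> u"
    using conv nz by (auto simp: free_mult_conv_def)
  interpret M: nonneg_prob \<mu> using conv by (simp add: free_mult_conv_def prob_on_nonneg_iff)
  interpret N: nonneg_prob \<nu> using conv by (simp add: free_mult_conv_def prob_on_nonneg_iff)
  interpret R: nonneg_prob \<rho> using conv by (simp add: free_mult_conv_def prob_on_nonneg_iff)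
  assume "\<not> ?thesis"
  then have gt: "measure \<rho> {0} > measure \<mu> {0}" "measure \<rho> {0} > measure \<nu> {0}" by auto
  define a where "a = measure \<rho> {0} - 1"
  have aM: "a \<in> S_domain \<mu>" and aN: "a \<in> S_domain \<nu>"
    using gt R.atom_lt_1[OF \<rho>0] by (auto simp: S_domain_def a_def)
  define C where "C = chi_transform \<mu> a * chi_transform \<nu> a"
  have C: "C > 0" using M.psi_chi(1)[OF nz(1) aM] N.psi_chi(1)[OF nz(2) aN] by (simp add: C_def mult_neg_neg)
  define u0 where "u0 = psi_transform \<rho> (- 1)"
  have u0: "u0 < 0" "- 1 < u0" using R.psi_neg[OF \<rho>0] R.psi_gt_minus_1 by (auto simp: u0_def)
  \<comment> \<open>The product formula says \<open>t = chi_transform \<mu> u * chi_transform \<nu>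
    u * (1 + u) / u\<close> with \<open>u = psi_transform \<rho> t\<close>. For
    \<open>a < u \<le> u0\<close> the right-hand side is at least \<open>C * (1 + 1 / u0)\<close>,
    and \<open>t\<close> is chosen below that.\<close>
  define t where "t = min (- 1) (C * (1 + 1 / u0) - 1)"
  have t: "t < 0" "t \<le> -1" "t < C * (1 + 1 / u0)" by (auto simp: t_def)
  define u where "u = psi_transform \<rho> t"
  have u: "a < u" "u \<le> u0" "- 1 < u" "u < 0"
    using R.psi_gt_atom[OF \<rho>0 t(1)] R.psi_strict_mono[OF \<rho>0, of t "- 1"] t R.psi_neg[OF \<rho>0 t(1)] R.psi_gt_minus_1[OF t(1)]
    by (cases "t = - 1"; auto simp: a_def u_def u0_def)+
  have dom: "u \<in> S_domain \<mu>" "u \<in> S_domain \<nu>" "u \<in> S_domain \<rho>"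
    using u aM aN by (auto simp: S_domain_def a_def)
  have chi_ge: "a' < chi_transform \<kappa> u"
    if "nonneg_prob \<kappa>" "\<kappa> \<noteq> return borel 0" "u \<in> S_domain \<kappa>" "a \<in> S_domain \<kappa>" "a' = chi_transform \<kappa> a" for \<kappa> a'
  proof (rule ccontr)
    interpret nonneg_prob \<kappa> by fact
    assume "\<not> a' < chi_transform \<kappa> u"
    then have "psi_transform \<kappa> (chi_transform \<kappa> u) \<le> psi_transform \<kappa> (chi_transform \<kappa> a)"
      using psi_strict_mono[OF that(2), of "chi_transform \<kappa> u" "chi_transform \<kappa> a"] psi_chi(1)[OF that(2,4)] that(5)
      by (cases "a' = chi_transform \<kappa> u") auto
    then show False using psi_chi(2)[OF that(2,3)] psi_chi(2)[OF that(2,4)] u by simp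
  qed
  have chiM: "chi_transform \<mu> a < chi_transform \<mu> u"
    using chi_ge[OF M.nonneg_prob_axioms nz(1) dom(1) aM] by simp
  have chiN: "chi_transform \<nu> a < chi_transform \<nu> u"
    using chi_ge[OF N.nonneg_prob_axioms nz(2) dom(2) aN] by simp
  define k where "k = (1 + u) / u"
  have k: "k < 0" using u by (simp add: k_def divide_neg_pos divide_pos_neg)
  have "t * k = S_transform \<rho> u"
    unfolding u_def R.S_transform_psi[OF \<rho>0 t(1)] by (simp add: k_def u_def)
  also have "\<dots> = chi_transform \<mu> u * chi_transform \<nu> u * k\<^sup>2"
    using S[of u] dom by (simp add: S_transform_def k_def power2_eq_square)
  finally have "t * k = (chi_transform \<mu> u * chi_transform \<nu> u * k) * k" by (simp only: power2_eq_square mult.assoc)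
  then have "t = chi_transform \<mu> u * chi_transform \<nu> u * k" by (rule mult_right_cancel[THEN iffD1, OF less_imp_neq[OF k]])
  moreover have "chi_transform \<mu> u * chi_transform \<nu> u \<le> C"
    using mult_mono[of "- chi_transform \<mu> u" "- chi_transform \<mu> a" "- chi_transform \<nu> u" "- chi_transform \<nu> a"]
      chiM chiN M.psi_chi(1)[OF nz(1) dom(1)] N.psi_chi(1)[OF nz(2) dom(2)]
    unfolding C_def by auto
  ultimately have "C * k \<le> t" using k by (simp add: mult_right_mono_neg)
  moreover have "1 + 1 / u0 \<le> k"
  proof -
    have "k = 1 + 1 / u" using u by (simp add: k_def field_simps)
    moreover have "1 / u0 \<le> 1 / u" using u u0 by (simp add: divide_simps)
    ultimately show ?thesis by simp
  qed
  then have "C * (1 + 1 / u0) \<le> C * k" using C by simp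
  ultimately show False using t by simp
qed

text \<open>The inclusion of domains is the invariant that makes the induction work: by the bound on
  atoms, the interval on which the product formula is known does not shrink from one factor to the
  next.\<close>

lemma free_mult_power_S_transform:
  assumes "conv_power free_mult_conv \<nu> n \<rho>" and \<nu>: "prob_on_nonneg \<nu>" "\<nu> \<noteq> return borel 0"
  shows "prob_on_nonneg \<rho> \<and> \<rho> \<noteq> return borel 0 \<and> S_domain \<nu> \<subseteq> S_domain \<rho>
    \<and> (\<forall>u\<in>S_domain \<nu>. S_transform \<rho> u = S_transform \<nu> u ^ n)"
  using assms(1)
proof induction
  case one
  then show ?case using \<nu> by simp
next
  case (Suc n \<rho> \<rho>')
  have "prob_on_nonneg \<rho>'" "\<rho>' \<noteq> return borel 0"
    and S: "\<And>u. u \<in> S_domain \<rho> \<inter> S_domain \<nu> \<inter> S_domain \<rho>' \<Longrightarrow> S_transform \<rho>' u = S_transform \<rho> u * S_transform \<nu> u"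
    using Suc \<nu> by (auto simp: free_mult_conv_def)
  moreover have "S_domain \<nu> \<subseteq> S_domain \<rho>'"
    using free_mult_conv_atom_le[OF Suc(2)] Suc.IH \<nu>(2) by (fastforce simp: S_domain_def)
  ultimately show ?case using Suc.IH by (auto simp: mult.commute)
qed

section \<open>The S-transform near zero\<close>

lemma norm_divide_le_self:
  fixes a c :: real
  assumes "0 \<le> a" "1 \<le> c" shows "norm (a / c) \<le> a"
  using divide_left_mono[of 1 c a] assms by simp

locale square_integrable_law = nonneg_prob \<nu> for \<nu> :: "real measure" +
  assumes square_integrable: "integrable \<nu> (\<lambda>x. x\<^sup>2)" and mean_pos: "mean \<nu> > 0"
begin

lemma mean_integrable: "integrable \<nu> (\<lambda>x. x)"
  using square_integrable by (rule square_integrable_imp_integrable[rotated]) auto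

lemma not_return_0: "\<nu> \<noteq> return borel 0"
proof
  assume "\<nu> = return borel 0"
  then have "mean \<nu> = 0" by (simp add: mean_def integral_return)
  then show False using mean_pos by simp
qed

lemma Var_eq: "Var \<nu> = (\<integral>x. x\<^sup>2 \<partial>\<nu>) - (mean \<nu>)\<^sup>2"
proof -
  have "Var \<nu> = (\<integral>x. x\<^sup>2 - 2 * mean \<nu> * x + (mean \<nu>)\<^sup>2 \<partial>\<nu>)"
    unfolding Var_def by (intro Bochner_Integration.integral_cong) (auto simp: power2_eq_square algebra_simps)
  also have "\<dots> = (\<integral>x. x\<^sup>2 \<partial>\<nu>) - 2 * mean \<nu> * (\<integral>x. x \<partial>\<nu>) + (mean \<nu>)\<^sup>2"
    using square_integrable mean_integrable prob_space by simp
  finally show ?thesis by (simp add: mean_def[symmetric] power2_eq_square)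
qed

lemma Var_pos:
  assumes "nondegenerate \<nu>" shows "Var \<nu> > 0"
proof (rule ccontr)
  have int: "integrable \<nu> (\<lambda>x. (x - mean \<nu>)\<^sup>2)"
    using square_integrable mean_integrable by (simp add: power2_diff)
  assume "\<not> Var \<nu> > 0"
  moreover have "Var \<nu> \<ge> 0" unfolding Var_def by (intro integral_nonneg_AE) auto
  ultimately have "Var \<nu> = 0" by simp
  then have "AE x in \<nu>. (x - mean \<nu>)\<^sup>2 = 0"
    unfolding Var_def using int by (subst integral_nonneg_eq_0_iff_AE[symmetric]) auto
  then have "AE x in \<nu>. x = mean \<nu>" by eventually_elim auto
  then show False using AE_eq_imp_return[OF real_distribution] assms by (auto simp: nondegenerate_def)
qed

lemma psi_div_le_mean:
  assumes t: "t < 0" shows "psi_transform \<nu> t / t \<le> mean \<nu> * (1 + psi_transform \<nu> t)"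
proof -
  let ?m = "mean \<nu>"
  have "(\<integral>x. x / (1 - t * x) - ?m * (1 / (1 - t * x)) \<partial>\<nu>) \<le> (\<integral>x. (x - ?m) / (1 - t * ?m) \<partial>\<nu>)"
  proof (rule integral_mono_AE)
    show "AE x in \<nu>. x / (1 - t * x) - ?m * (1 / (1 - t * x)) \<le> (x - ?m) / (1 - t * ?m)"
      using AE_nonneg
    proof eventually_elim
      case (elim x)
      have p: "1 - t * x > 0" "1 - t * ?m > 0"
        using psi_kernel_bounds(1)[OF t elim] psi_kernel_bounds(1)[OF t, of ?m] mean_pos by auto
      have "(x - ?m) / (1 - t * ?m) - (x - ?m) / (1 - t * x) = (- t) * (x - ?m)\<^sup>2 / ((1 - t * ?m) * (1 - t * x))"
      proof -
        have "(x - ?m) / (1 - t * ?m) - (x - ?m) / (1 - t * x)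
            = ((x - ?m) * (1 - t * x) - (x - ?m) * (1 - t * ?m)) / ((1 - t * ?m) * (1 - t * x))"
          using p by (intro diff_frac_eq) auto
        moreover have "(x - ?m) * (1 - t * x) - (x - ?m) * (1 - t * ?m) = (- t) * (x - ?m)\<^sup>2"
          by (simp add: power2_eq_square algebra_simps)
        ultimately show ?thesis by simp
      qed
      also have "\<dots> \<ge> 0" using p t by (intro divide_nonneg_pos mult_nonneg_nonneg mult_pos_pos) auto
      finally show ?case by (simp add: diff_divide_distrib)
    qed
    show "integrable \<nu> (\<lambda>x. x / (1 - t * x) - ?m * (1 / (1 - t * x)))"
      by (intro Bochner_Integration.integrable_diff integrable_mult_right psi_div_eq(2)[OF t] M_integrable[OF t])
    show "integrable \<nu> (\<lambda>x. (x - ?m) / (1 - t * ?m))"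
      using mean_integrable by simp
  qed
  also have "\<dots> = 0" using mean_integrable prob_space by (simp add: mean_def)
  also have "(\<integral>x. x / (1 - t * x) - ?m * (1 / (1 - t * x)) \<partial>\<nu>) = psi_transform \<nu> t / t - ?m * (1 + psi_transform \<nu> t)"
    unfolding psi_div_eq(1)[OF t] M_eq_psi[OF t, symmetric]
    by (subst Bochner_Integration.integral_diff)
       (rule psi_div_eq(2)[OF t] integrable_mult_right M_integrable[OF t] | simp only: Bochner_Integration.integral_mult_right_zero)+
  finally show ?thesis by simp
qed

text \<open>The correlation inequality rewritten for \<open>S\<close>. Raised to the
  \<open>n\<close>-th power it gives the a priori bounds on both kinds of power.\<close>

lemma mean_S_ge_1:
  assumes u: "u \<in> S_domain \<nu>" shows "mean \<nu> * S_transform \<nu> u \<ge> 1"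
proof -
  define t where "t = chi_transform \<nu> u"
  have t: "t < 0" "psi_transform \<nu> t = u" using psi_chi[OF not_return_0 u] by (auto simp: t_def)
  have u': "u < 0" "- 1 < u" using psi_gt_minus_1[OF t(1)] t u by (auto simp: S_domain_def)
  have "u / t \<le> mean \<nu> * (1 + u)" using psi_div_le_mean[OF t(1)] t by simp
  moreover have "u / t > 0" using u' t by (simp add: divide_neg_neg)
  ultimately have "1 \<le> mean \<nu> * (1 + u) / (u / t)" by (simp only: le_divide_eq_1 simp_thms)
  then show ?thesis by (simp add: S_transform_def t_def mult.commute mult.left_commute)
qed

section \<open>Second-order behaviour of psi and S at zero\<close>

lemma psi_div_tendsto_mean: "((\<lambda>t. psi_transform \<nu> t / t) \<longlongrightarrow> mean \<nu>) (at_left 0)"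
proof (rule tendsto_at_left_sequentially[where b = "-1"])
  fix X :: "nat \<Rightarrow> real" assume X: "\<And>n. X n < 0" "X \<longlonglongrightarrow> 0"
  have "(\<lambda>n. \<integral>x. x / (1 - X n * x) \<partial>\<nu>) \<longlonglongrightarrow> (\<integral>x. x \<partial>\<nu>)"
  proof (rule integral_dominated_convergence[where w = "\<lambda>x. x"])
    show "AE x in \<nu>. (\<lambda>n. x / (1 - X n * x)) \<longlonglongrightarrow> x"
    proof (intro AE_I2)
      fix x
      have "(\<lambda>n. x / (1 - X n * x)) \<longlonglongrightarrow> x / (1 - 0 * x)" by (intro tendsto_intros X) auto
      then show "(\<lambda>n. x / (1 - X n * x)) \<longlonglongrightarrow> x" by simp
    qed
    show "AE x in \<nu>. norm (x / (1 - X n * x)) \<le> x" for n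
      using AE_nonneg
    proof eventually_elim
      case (elim x)
      show ?case by (intro norm_divide_le_self elim psi_kernel_bounds(1)[OF X(1) elim])
    qed
  qed (simp, simp, rule mean_integrable)
  then show "(\<lambda>n. psi_transform \<nu> (X n) / X n) \<longlonglongrightarrow> mean \<nu>"
    by (simp only: psi_div_eq(1)[OF X(1)] mean_def)
qed auto

lemma second_moment_tendsto: "((\<lambda>t. (\<integral>x. x\<^sup>2 / (1 - t * x) \<partial>\<nu>)) \<longlongrightarrow> (\<integral>x. x\<^sup>2 \<partial>\<nu>)) (at_left 0)"
proof (rule tendsto_at_left_sequentially[where b = "-1"])
  fix X :: "nat \<Rightarrow> real" assume X: "\<And>n. X n < 0" "X \<longlonglongrightarrow> 0"
  show "(\<lambda>n. \<integral>x. x\<^sup>2 / (1 - X n * x) \<partial>\<nu>) \<longlonglongrightarrow> (\<integral>x. x\<^sup>2 \<partial>\<nu>)"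
  proof (rule integral_dominated_convergence[where w = "\<lambda>x. x\<^sup>2"])
    show "AE x in \<nu>. (\<lambda>n. x\<^sup>2 / (1 - X n * x)) \<longlonglongrightarrow> x\<^sup>2"
    proof (intro AE_I2)
      fix x
      have "(\<lambda>n. x\<^sup>2 / (1 - X n * x)) \<longlonglongrightarrow> x\<^sup>2 / (1 - 0 * x)" by (intro tendsto_intros X) auto
      then show "(\<lambda>n. x\<^sup>2 / (1 - X n * x)) \<longlonglongrightarrow> x\<^sup>2" by simp
    qed
    show "AE x in \<nu>. norm (x\<^sup>2 / (1 - X n * x)) \<le> x\<^sup>2" for n
      using AE_nonneg
    proof eventually_elim
      case (elim x)
      show ?case by (intro norm_divide_le_self zero_le_power2 psi_kernel_bounds(1)[OF X(1) elim])
    qed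
  qed (simp, simp, rule square_integrable)
qed auto

lemma second_moment_integrable:
  assumes "t < 0" shows "integrable \<nu> (\<lambda>x. x\<^sup>2 / (1 - t * x))"
proof (rule Bochner_Integration.integrable_bound[OF square_integrable])
  show "AE x in \<nu>. norm (x\<^sup>2 / (1 - t * x)) \<le> norm (x\<^sup>2)"
    using AE_nonneg
  proof eventually_elim
    case (elim x)
    show ?case
      using norm_divide_le_self[OF zero_le_power2 psi_kernel_bounds(1)[OF assms elim]] by simp
  qed
qed auto

lemma psi_expansion:
  assumes t: "t < 0" shows "psi_transform \<nu> t / t = mean \<nu> + t * (\<integral>x. x\<^sup>2 / (1 - t * x) \<partial>\<nu>)"
proof -
  have "(\<integral>x. x / (1 - t * x) \<partial>\<nu>) = (\<integral>x. x + t * (x\<^sup>2 / (1 - t * x)) \<partial>\<nu>)"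
  proof (rule integral_cong_AE)
    show "AE x in \<nu>. x / (1 - t * x) = x + t * (x\<^sup>2 / (1 - t * x))"
      using AE_nonneg
    proof eventually_elim
      case (elim x)
      then show ?case using psi_kernel_bounds(1)[OF t elim]
        by (simp add: divide_simps) (auto simp: power2_eq_square algebra_simps)
    qed
  qed auto
  also have "\<dots> = (\<integral>x. x \<partial>\<nu>) + (\<integral>x. t * (x\<^sup>2 / (1 - t * x)) \<partial>\<nu>)"
    by (intro Bochner_Integration.integral_add mean_integrable integrable_mult_right second_moment_integrable t)
  finally show ?thesis
    unfolding psi_div_eq(1)[OF t] mean_def Bochner_Integration.integral_mult_right_zero .
qed

text \<open>With \<open>p = psi_transform \<nu> t\<close> and \<open>A\<close> the damped second
  moment, the quotient equals \<open>(mean \<nu> * (p / t) - A) / (p / t)^2\<close> exactly. Letting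
  \<open>t\<close> tend to \<open>0\<close> gives \<open>mean^2\<close> minus the second moment,
  over \<open>mean^2\<close>.\<close>

lemma S_transform_derivative_psi:
  "((\<lambda>t. (mean \<nu> * S_transform \<nu> (psi_transform \<nu> t) - 1) / psi_transform \<nu> t) \<longlongrightarrow> - (Var \<nu> / (mean \<nu>)\<^sup>2)) (at_left 0)"
proof -
  let ?p = "\<lambda>t. psi_transform \<nu> t" and ?A = "\<lambda>t. \<integral>x. x\<^sup>2 / (1 - t * x) \<partial>\<nu>"
  have "((\<lambda>t. (mean \<nu> * (?p t / t) - ?A t) / (?p t / t)\<^sup>2) \<longlongrightarrow>
      (mean \<nu> * mean \<nu> - (\<integral>x. x\<^sup>2 \<partial>\<nu>)) / (mean \<nu>)\<^sup>2) (at_left 0)"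
    using mean_pos by (intro tendsto_intros psi_div_tendsto_mean second_moment_tendsto) auto
  also have "(mean \<nu> * mean \<nu> - (\<integral>x. x\<^sup>2 \<partial>\<nu>)) / (mean \<nu>)\<^sup>2 = - (Var \<nu> / (mean \<nu>)\<^sup>2)"
    using mean_pos by (simp add: Var_eq power2_eq_square divide_simps)
  also have "((\<lambda>t. (mean \<nu> * (?p t / t) - ?A t) / (?p t / t)\<^sup>2) \<longlongrightarrow> - (Var \<nu> / (mean \<nu>)\<^sup>2)) (at_left 0)
    \<longleftrightarrow> ?thesis"
  proof (rule tendsto_cong)
    have "eventually (\<lambda>t::real. t < 0) (at_left 0)" by (auto simp: eventually_at_filter)
    then show "eventually (\<lambda>t. (mean \<nu> * (?p t / t) - ?A t) / (?p t / t)\<^sup>2 = (mean \<nu> * S_transform \<nu> (?p t) - 1) / ?p t) (at_left 0)"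
    proof eventually_elim
      case (elim t)
      define p where "p = ?p t"
      have p: "p < 0" using psi_neg[OF not_return_0 elim] by (simp add: p_def)
      have A: "?A t = (p / t - mean \<nu>) / t" using psi_expansion[OF elim] elim by (simp add: p_def)
      have S: "S_transform \<nu> p = t * (1 + p) / p"
        using S_transform_psi[OF not_return_0 elim] by (simp add: p_def)
      show ?case
        unfolding p_def[symmetric] A S using p elim
        by (simp add: divide_simps power2_eq_square) (simp add: algebra_simps)
    qed
  qed
  finally show ?thesis .
qed

lemma chi_tendsto_0:
  assumes v: "\<And>n. v n \<in> S_domain \<nu>" "v \<longlonglongrightarrow> 0"
  shows "filterlim (\<lambda>n. chi_transform \<nu> (v n)) (at_left 0) sequentially"
proof -
  note chi = psi_chi[OF not_return_0 v(1)]
  have "(\<lambda>n. chi_transform \<nu> (v n)) \<longlonglongrightarrow> 0"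
  proof (rule order_tendstoI)
    fix a :: real assume a: "a < 0"
    have "eventually (\<lambda>n. psi_transform \<nu> a < v n) sequentially"
      using order_tendstoD(1)[OF v(2) psi_neg[OF not_return_0 a]] .
    then show "eventually (\<lambda>n. a < chi_transform \<nu> (v n)) sequentially"
    proof eventually_elim
      case (elim n)
      show ?case
      proof (rule ccontr)
        assume "\<not> ?thesis"
        then have "psi_transform \<nu> (chi_transform \<nu> (v n)) \<le> psi_transform \<nu> a"
          using psi_strict_mono[OF not_return_0, of "chi_transform \<nu> (v n)" a] a
          by (cases "chi_transform \<nu> (v n) = a") auto
        then show False using elim chi by simp
      qed
    qed
  next
    fix a :: real assume "a > 0"
    then show "eventually (\<lambda>n. chi_transform \<nu> (v n) < a) sequentially"
      using chi(1) less_trans by (intro always_eventually) blast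
  qed
  then show ?thesis using chi(1) by (intro tendsto_imp_filterlim_at_left) auto
qed

lemma S_transform_derivative:
  assumes v: "\<And>n. v n \<in> S_domain \<nu>" "v \<longlonglongrightarrow> 0"
  shows "(\<lambda>n. (mean \<nu> * S_transform \<nu> (v n) - 1) / v n) \<longlonglongrightarrow> - (Var \<nu> / (mean \<nu>)\<^sup>2)"
  using filterlim_compose[OF S_transform_derivative_psi chi_tendsto_0[OF v]]
  by (simp add: psi_chi(2)[OF not_return_0 v(1)])

text \<open>After taking logarithms, \<open>k * ln (mean * S v)\<close> differs from
  \<open>- g * f\<close> by \<open>k * v * (L + g) - g * (k * v - f)\<close>, where \<open>L\<close>
  tends to \<open>- g\<close>. Only boundedness of \<open>f\<close> is asked for, because in the
  application \<open>f n = \<phi> (q n)\<close> and the convergence of \<open>q\<close> is what is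
  to be shown.\<close>

lemma S_transform_power_limit:
  assumes v: "\<And>n. v n \<in> S_domain \<nu>" "v \<longlonglongrightarrow> 0"
    and f: "(\<lambda>n. real (k n) * v n - f n) \<longlonglongrightarrow> 0" and bdd: "Bseq f"
  shows "(\<lambda>n. (mean \<nu> * S_transform \<nu> (v n)) ^ k n * exp (Var \<nu> / (mean \<nu>)\<^sup>2 * f n)) \<longlonglongrightarrow> 1"
proof -
  define g where "g = Var \<nu> / (mean \<nu>)\<^sup>2"
  define s where "s n = mean \<nu> * S_transform \<nu> (v n)" for n
  define L where "L n = ln (s n) / v n" for n
  have s1: "s n \<ge> 1" for n using mean_S_ge_1[OF v(1)] by (simp add: s_def)
  have v0: "v n \<noteq> 0" for n using v(1)[of n] by (simp add: S_domain_def)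
  have d: "(\<lambda>n. (s n - 1) / v n) \<longlonglongrightarrow> - g"
    using S_transform_derivative[OF v] by (simp add: s_def g_def)
  have sl: "(\<lambda>n. s n - 1) \<longlonglongrightarrow> 0"
    using tendsto_mult[OF d v(2)] v0 by simp
  have "(\<lambda>n. L n - (s n - 1) / v n) \<longlonglongrightarrow> 0"
  proof (rule Lim_null_comparison)
    show "(\<lambda>n. 2 * \<bar>(s n - 1) / v n\<bar> * \<bar>s n - 1\<bar>) \<longlonglongrightarrow> 0"
      using tendsto_mult[OF tendsto_mult[OF tendsto_const[of 2] tendsto_rabs[OF d]] tendsto_rabs[OF sl]] by simp
    \<comment> \<open>The quadratic bound for the logarithm is available within distance
      \<open>1 / 2\<close> of \<open>1\<close>.\<close>
    have "eventually (\<lambda>n. \<bar>s n - 1\<bar> < 1 / 2) sequentially"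
      using tendstoD[OF sl, of "1 / 2"] by (simp only: dist_real_def) simp
    then show "eventually (\<lambda>n. norm (L n - (s n - 1) / v n) \<le> 2 * \<bar>(s n - 1) / v n\<bar> * \<bar>s n - 1\<bar>) sequentially"
    proof eventually_elim
      case (elim n)
      then have "\<bar>ln (1 + (s n - 1)) - (s n - 1)\<bar> \<le> 2 * (s n - 1)\<^sup>2"
        by (intro abs_ln_one_plus_x_minus_x_bound) auto
      then have "\<bar>ln (s n) - (s n - 1)\<bar> / \<bar>v n\<bar> \<le> 2 * (s n - 1)\<^sup>2 / \<bar>v n\<bar>"
        by (intro divide_right_mono) auto
      then show ?case
        by (simp add: L_def diff_divide_distrib[symmetric] power2_eq_square abs_mult[symmetric])
    qed
  qed
  from tendsto_add[OF this d] have "L \<longlonglongrightarrow> - g" by simp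
  from tendsto_add[OF this tendsto_const[of g]] have L: "(\<lambda>n. L n + g) \<longlonglongrightarrow> 0" by simp
  obtain K where K: "\<And>n. norm (f n) \<le> K" using bdd by (auto simp: Bseq_def)
  have "(\<lambda>n. f n * (L n + g)) \<longlonglongrightarrow> 0"
  proof (rule Lim_null_comparison)
    show "eventually (\<lambda>n. norm (f n * (L n + g)) \<le> K * \<bar>L n + g\<bar>) sequentially"
      using K by (intro always_eventually allI) (simp add: abs_mult mult_right_mono)
    show "(\<lambda>n. K * \<bar>L n + g\<bar>) \<longlonglongrightarrow> 0"
      using tendsto_mult[OF tendsto_const[of K] tendsto_rabs[OF L]] by simp
  qed
  from tendsto_add[OF this tendsto_mult[OF f L]]
  have "(\<lambda>n. real (k n) * v n * (L n + g)) \<longlonglongrightarrow> 0"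
    by (simp add: algebra_simps)
  from tendsto_diff[OF this tendsto_mult[OF tendsto_const[of g] f]]
  have "(\<lambda>n. real (k n) * v n * L n + g * f n) \<longlonglongrightarrow> 0"
    by (simp add: algebra_simps)
  then have "(\<lambda>n. exp (real (k n) * v n * L n + g * f n)) \<longlonglongrightarrow> exp 0" by (rule tendsto_exp)
  moreover have "exp (real (k n) * v n * L n + g * f n) = s n ^ k n * exp (g * f n)" for n
  proof -
    have "real (k n) * v n * L n = real (k n) * ln (s n)" using v0 by (simp add: L_def)
    then have "exp (real (k n) * v n * L n) = exp (ln (s n)) ^ k n" by (simp only: exp_of_nat_mult)
    then show ?thesis using s1[of n] by (simp add: exp_add)
  qed
  ultimately show ?thesis by (simp add: s_def g_def)
qed

end

section \<open>Free additive powers and subordination\<close>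

lemma R_domain_mono: "\<beta> \<le> \<alpha> \<Longrightarrow> M \<le> N \<Longrightarrow> 0 \<le> N \<Longrightarrow> R_domain \<beta> N \<subseteq> R_domain \<alpha> M"
  unfolding R_domain_def by (auto intro: less_le_trans[OF _ mult_right_mono])

lemma R_domain_nonzero: "0 \<le> M \<Longrightarrow> z \<in> R_domain \<alpha> M \<Longrightarrow> z \<noteq> 0"
  by (auto simp: R_domain_def)

lemma R_domain_open:
  assumes "0 \<le> M" shows "open (R_domain \<alpha> M)"
proof -
  let ?T = "{w. M < Im w} \<inter> {w. \<bar>Re w\<bar> < \<alpha> * Im w}"
  have "open ?T"
    by (intro open_Int open_Collect_less continuous_intros)
  moreover have "continuous_on (- {0}) (\<lambda>z::complex. 1 / z)"
    by (intro continuous_intros) auto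
  \<comment> \<open>Since \<open>1 / 0 = 0\<close> has imaginary part \<open>0\<close>, the point
    \<open>0\<close> is outside the domain, and removing it only secures continuity of the
    reciprocal.\<close>
  moreover have "R_domain \<alpha> M = (\<lambda>z. 1 / z) -` ?T \<inter> - {0}"
    using assms by (auto simp: R_domain_def)
  ultimately show ?thesis
    by (metis continuous_on_open_vimage open_Compl closed_singleton)
qed

lemma R_domain_nonempty:
  assumes "\<alpha> > 0" "M \<ge> 0" shows "\<exists>z. z \<in> R_domain \<alpha> M"
proof
  have "1 / (1 / (\<i> * complex_of_real (M + 1))) = \<i> * complex_of_real (M + 1)" by simp
  then show "1 / (\<i> * complex_of_real (M + 1)) \<in> R_domain \<alpha> M"
    unfolding R_domain_def using assms by simp
qed

lemma R_domain_norm_le: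
  assumes "z \<in> R_domain \<alpha> M" "M > 0" shows "norm z \<le> 1 / M"
proof -
  have "M < norm (1 / z)" using assms abs_Im_le_cmod[of "1 / z"] unfolding R_domain_def mem_Collect_eq by linarith
  moreover have "z \<noteq> 0" by (rule R_domain_nonzero[OF less_imp_le[OF assms(2)] assms(1)])
  ultimately show ?thesis using assms by (simp add: norm_divide field_simps)
qed

text \<open>Supplies the dominating constant for \<open>inverse_cauchy_unique\<close>. The last
  hypothesis is a quantitative form of \<open>z * w\<close> being close to \<open>1\<close>; it
  keeps \<open>w\<close> at height at least half that of \<open>1 / z\<close>, while in the cone the
  modulus of \<open>1 / z\<close> is at most \<open>1 + \<beta>\<close> times its height.\<close>

lemma cone_kernel_bound:
  fixes z w :: complex
  assumes z: "z \<in> R_domain \<beta> N" and \<beta>: "\<beta> > 0" and N: "N \<ge> 0"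
    and w: "Re (z * w) - (1 + \<beta>) * \<bar>Im (z * w)\<bar> \<ge> 1 / 2"
  shows "norm (1 / (z * (w - of_real x))) \<le> 2 * (1 + \<beta>)"
proof -
  define \<zeta> where "\<zeta> = 1 / z"
  have z0: "z \<noteq> 0" using R_domain_nonzero N z by blast
  have \<zeta>: "Im \<zeta> > 0" "\<bar>Re \<zeta>\<bar> < \<beta> * Im \<zeta>" using z N by (auto simp: R_domain_def \<zeta>_def)
  have n\<zeta>: "norm \<zeta> \<le> (1 + \<beta>) * Im \<zeta>"
    using cmod_le[of \<zeta>] \<zeta> by (simp add: algebra_simps)
  have "w = \<zeta> * (z * w)" using z0 by (simp add: \<zeta>_def)
  then have Imw: "Im w = Im \<zeta> * Re (z * w) + Re \<zeta> * Im (z * w)"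
    by (metis add.commute times_complex.simps(2))
  have "\<bar>Re \<zeta> * Im (z * w)\<bar> \<le> (1 + \<beta>) * Im \<zeta> * \<bar>Im (z * w)\<bar>"
    unfolding abs_mult using \<zeta> by (intro mult_right_mono) (auto simp: algebra_simps)
  then have "Im w \<ge> Im \<zeta> * (Re (z * w) - (1 + \<beta>) * \<bar>Im (z * w)\<bar>)"
    unfolding Imw by (simp add: algebra_simps)
  moreover have "Im \<zeta> * (Re (z * w) - (1 + \<beta>) * \<bar>Im (z * w)\<bar>) \<ge> Im \<zeta> * (1 / 2)"
    using w \<zeta> by (intro mult_left_mono) auto
  ultimately have 1: "Im \<zeta> / 2 \<le> Im w" by simp
  also have "\<dots> \<le> norm (w - of_real x)" using abs_Im_le_cmod[of "w - of_real x"] by simp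
  finally have 2: "Im \<zeta> / 2 \<le> norm (w - of_real x)" .
  then have pos: "norm (w - of_real x) > 0" using \<zeta> by linarith
  have "norm (1 / (z * (w - of_real x))) = norm \<zeta> / norm (w - of_real x)"
    by (simp add: \<zeta>_def norm_divide norm_mult)
  also have "\<dots> \<le> (1 + \<beta>) * Im \<zeta> / norm (w - of_real x)"
    using n\<zeta> pos by (intro divide_right_mono) auto
  also have "\<dots> \<le> 2 * (1 + \<beta>)"
  proof -
    have "(1 + \<beta>) * Im \<zeta> \<le> (1 + \<beta>) * (2 * norm (w - of_real x))" using 2 \<beta> by (intro mult_left_mono) auto
    then show ?thesis using pos by (simp only: pos_divide_le_eq mult_ac)
  qed
  finally show ?thesis .
qed

text \<open>If \<open>K z = w\<close> and \<open>K' z = w'\<close> differ, then equality of the Cauchy transforms at \<open>w\<close> and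
  \<open>w'\<close> forces \<open>\<integral> 1 / ((w' - x) (w - x)) d\<mu> = 0\<close>; but \<open>z\<^sup>-\<^sup>2\<close> times this integral tends to \<open>1\<close> as
  \<open>z\<close> tends to \<open>0\<close> in a cone.\<close>

lemma inverse_cauchy_unique:
  assumes \<mu>: "real_distribution \<mu>" and pos: "\<alpha> > 0" "\<alpha>' > 0" "M > 0" "M' > 0"
    and K: "inverse_cauchy_on \<mu> (R_domain \<alpha> M) K" and K': "inverse_cauchy_on \<mu> (R_domain \<alpha>' M') K'"
  shows "\<exists>N\<ge>max M M'. \<forall>z\<in>R_domain (min \<alpha> \<alpha>') N. K z = K' z"
proof (rule ccontr)
  interpret real_distribution \<mu> by fact
  define \<beta> where "\<beta> = min \<alpha> \<alpha>'"
  \<comment> \<open>Growing heights force the points of disagreement to tend to \<open>0\<close>,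
    where the two branches are known to be asymptotic to \<open>1 / z\<close>.\<close>
  define N where "N n = max M M' + real (Suc n)" for n
  assume "\<not> ?thesis"
  then have "\<forall>N\<ge>max M M'. \<exists>z\<in>R_domain \<beta> N. K z \<noteq> K' z" by (auto simp: \<beta>_def)
  moreover have "max M M' \<le> N n" for n by (simp add: N_def)
  ultimately have "\<forall>n. \<exists>z\<in>R_domain \<beta> (N n). K z \<noteq> K' z" by blast
  then obtain z where z: "\<And>n. z n \<in> R_domain \<beta> (N n)" "\<And>n. K (z n) \<noteq> K' (z n)" by metis
  have \<beta>: "\<beta> > 0" using pos by (simp add: \<beta>_def)
  have Npos: "N n > 0" for n using pos by (simp add: N_def add_pos_pos)
  have z0: "z n \<noteq> 0" for n using R_domain_nonzero[OF less_imp_le[OF Npos] z(1)] .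
  have zD: "z n \<in> R_domain \<alpha> M" "z n \<in> R_domain \<alpha>' M'" for n
    using z(1)[of n] R_domain_mono[of \<beta> \<alpha> M "N n"] R_domain_mono[of \<beta> \<alpha>' M' "N n"] Npos[of n]
    \<open>max M M' \<le> N n\<close> by (auto simp: \<beta>_def)
  have "z \<longlonglongrightarrow> 0"
  proof (rule Lim_null_comparison)
    show "eventually (\<lambda>n. norm (z n) \<le> 1 / real (Suc n)) sequentially"
    proof (intro always_eventually allI)
      fix n :: nat
      have "norm (z n) \<le> 1 / N n" by (rule R_domain_norm_le[OF z(1) Npos])
      also have "\<dots> \<le> 1 / real (Suc n)" using pos by (intro divide_left_mono) (auto simp: N_def)
      finally show "norm (z n) \<le> 1 / real (Suc n)" .
    qed
    show "(\<lambda>n. 1 / real (Suc n)) \<longlonglongrightarrow> 0"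
      using LIMSEQ_inverse_real_of_nat by (simp add: inverse_eq_divide)
  qed
  have lim: "(\<lambda>n. z n * \<kappa> (z n)) \<longlonglongrightarrow> 1"
    if "((\<lambda>z. z * \<kappa> z) \<longlongrightarrow> 1) (at 0 within D)" "\<And>n. z n \<in> D" for \<kappa> D
    using that(1) \<open>z \<longlonglongrightarrow> 0\<close> z0 that(2) unfolding tendsto_at_iff_sequentially o_def by auto
  define w where "w n = K (z n)" for n
  define w' where "w' n = K' (z n)" for n
  have w: "(\<lambda>n. z n * w n) \<longlonglongrightarrow> 1" "\<And>n. Im (w n) > 0" "\<And>n. cauchy_transform \<mu> (w n) = z n"
    using K zD(1) lim[of K "R_domain \<alpha> M"] by (auto simp: inverse_cauchy_on_def w_def)
  have w': "(\<lambda>n. z n * w' n) \<longlonglongrightarrow> 1" "\<And>n. Im (w' n) > 0" "\<And>n. cauchy_transform \<mu> (w' n) = z n"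
    using K' zD(2) lim[of K' "R_domain \<alpha>' M'"] by (auto simp: inverse_cauchy_on_def w'_def)
  have J0: "(\<integral>x. 1 / ((w' n - of_real x) * (w n - of_real x)) \<partial>\<mu>) = 0" for n
  proof -
    have "w n \<notin> complex_of_real ` UNIV" "w' n \<notin> complex_of_real ` UNIV"
      using w(2)[of n] w'(2)[of n] by auto
    from cauchy_transform_diff[OF \<mu> _ _ _ this] show ?thesis
      using w(3)[of n] w'(3)[of n] z(2)[of n] by (simp add: w_def w'_def)
  qed
  \<comment> \<open>The left-hand side tends to \<open>1\<close>, so the hypothesis of
    \<open>cone_kernel_bound\<close> holds from some index on.\<close>
  have ev: "eventually (\<lambda>n. Re (z n * \<kappa> n) - (1 + \<beta>) * \<bar>Im (z n * \<kappa> n)\<bar> > 1 / 2) sequentially"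
    if "(\<lambda>n. z n * \<kappa> n) \<longlonglongrightarrow> 1" for \<kappa>
  proof (rule order_tendstoD(1))
    show "(\<lambda>n. Re (z n * \<kappa> n) - (1 + \<beta>) * \<bar>Im (z n * \<kappa> n)\<bar>) \<longlonglongrightarrow> Re 1 - (1 + \<beta>) * \<bar>Im 1\<bar>"
      by (intro tendsto_intros that)
  qed simp
  obtain n0 where n0: "\<And>n. n \<ge> n0 \<Longrightarrow> Re (z n * w n) - (1 + \<beta>) * \<bar>Im (z n * w n)\<bar> > 1 / 2"
      "\<And>n. n \<ge> n0 \<Longrightarrow> Re (z n * w' n) - (1 + \<beta>) * \<bar>Im (z n * w' n)\<bar> > 1 / 2"
    using eventually_conj[OF ev[OF w(1)] ev[OF w'(1)]] unfolding eventually_sequentially by blast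
  have "(\<lambda>n. \<integral>x. (1 / (z (n + n0) * (w' (n + n0) - of_real x))) * (1 / (z (n + n0) * (w (n + n0) - of_real x))) \<partial>\<mu>)
     \<longlonglongrightarrow> (\<integral>x. 1 \<partial>\<mu>)"
  proof (rule integral_dominated_convergence[where w = "\<lambda>_. (2 * (1 + \<beta>)) * (2 * (1 + \<beta>))"])
    have l1: "(\<lambda>n. 1 / (z (n + n0) * (\<kappa> (n + n0) - of_real x))) \<longlonglongrightarrow> 1"
      if "(\<lambda>n. z n * \<kappa> n) \<longlonglongrightarrow> 1" for \<kappa> and x :: real
    proof -
      have "(\<lambda>n. 1 / (z n * \<kappa> n - z n * of_real x)) \<longlonglongrightarrow> 1 / (1 - 0 * of_real x)"
        by (intro tendsto_intros that \<open>z \<longlonglongrightarrow> 0\<close>) auto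
      from LIMSEQ_ignore_initial_segment[OF this, of n0] show ?thesis by (simp add: algebra_simps)
    qed
    show "AE x in \<mu>. (\<lambda>n. (1 / (z (n + n0) * (w' (n + n0) - of_real x))) * (1 / (z (n + n0) * (w (n + n0) - of_real x)))) \<longlonglongrightarrow> 1"
      using tendsto_mult[OF l1[OF w'(1)] l1[OF w(1)]] by (intro AE_I2) (simp only: mult_1)
    show "AE x in \<mu>. norm ((1 / (z (n + n0) * (w' (n + n0) - complex_of_real x))) * (1 / (z (n + n0) * (w (n + n0) - complex_of_real x))))
        \<le> (2 * (1 + \<beta>)) * (2 * (1 + \<beta>))" for n
      unfolding norm_mult[of "1 / _" "1 / _"]
      using n0(1)[of "n + n0"] n0(2)[of "n + n0"] \<beta>
      by (intro AE_I2 mult_mono cone_kernel_bound[OF z(1) \<beta> less_imp_le[OF Npos]]) auto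
  qed auto
  moreover have "(\<integral>x. (1 / (z n * (w' n - of_real x))) * (1 / (z n * (w n - of_real x))) \<partial>\<mu>) = 0" for n
  proof -
    have "(\<integral>x. (1 / (z n * (w' n - of_real x))) * (1 / (z n * (w n - of_real x))) \<partial>\<mu>)
       = (\<integral>x. (1 / (z n)\<^sup>2) * (1 / ((w' n - of_real x) * (w n - of_real x))) \<partial>\<mu>)"
      by (intro Bochner_Integration.integral_cong refl) (simp add: power2_eq_square)
    then show ?thesis by (simp only: Bochner_Integration.integral_mult_right_zero J0 mult_zero_right)
  qed
  ultimately have "(\<lambda>n. 0) \<longlonglongrightarrow> (1 :: complex)" using prob_space by simp
  then show False using LIMSEQ_unique[OF tendsto_const] by fastforce
qed

text \<open>The relation \<open>free_add_conv\<close> only asserts that some branches exist on some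
  cone. Uniqueness on a smaller cone lets the branches supplied by successive convolution steps be
  identified with one another.\<close>

lemma R_transform_unique:
  assumes "real_distribution \<mu>" "\<alpha> > 0" "\<alpha>' > 0" "M > 0" "M' > 0"
    and "R_transform_on \<mu> (R_domain \<alpha> M) R" "R_transform_on \<mu> (R_domain \<alpha>' M') R'"
  shows "\<exists>\<beta>>0. \<exists>N>0. \<forall>z\<in>R_domain \<beta> N. R z = R' z"
proof -
  from assms(6,7) obtain K K' where K: "inverse_cauchy_on \<mu> (R_domain \<alpha> M) K" "\<And>z. z\<in>R_domain \<alpha> M \<Longrightarrow> R z = K z - 1 / z"
     "inverse_cauchy_on \<mu> (R_domain \<alpha>' M') K'" "\<And>z. z\<in>R_domain \<alpha>' M' \<Longrightarrow> R' z = K' z - 1 / z"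
    by (auto simp: R_transform_on_def)
  obtain N where N: "N \<ge> max M M'" "\<And>z. z\<in>R_domain (min \<alpha> \<alpha>') N \<Longrightarrow> K z = K' z"
    using inverse_cauchy_unique[OF assms(1-5) K(1,3)] by blast
  have "R z = R' z" if z: "z \<in> R_domain (min \<alpha> \<alpha>') N" for z
  proof -
    have "z \<in> R_domain \<alpha> M" "z \<in> R_domain \<alpha>' M'"
      using z R_domain_mono[of "min \<alpha> \<alpha>'" \<alpha> M N] R_domain_mono[of "min \<alpha> \<alpha>'" \<alpha>' M' N] N(1) assms(4) by auto
    then show ?thesis using K N(2)[OF z] by simp
  qed
  then show ?thesis
    using N(1) assms(2-4) by (intro exI[of _ "min \<alpha> \<alpha>'"] exI[of _ N] conjI) auto
qed

lemma R_domain_common: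
  assumes "\<beta> > 0" "\<beta>' > 0" "N > 0" "N' > 0"
  shows "min \<beta> \<beta>' > 0" "max N N' > 0" "R_domain (min \<beta> \<beta>') (max N N') \<subseteq> R_domain \<beta> N"
    "R_domain (min \<beta> \<beta>') (max N N') \<subseteq> R_domain \<beta>' N'"
  using assms by (auto intro: R_domain_mono[THEN subsetD, rotated -1])

text \<open>All representatives on all cones are quantified over, because each step of the induction
  brings its own cone and its own R-functions. The cone of agreement may shrink with every step, so
  it appears existentially.\<close>

lemma free_add_power_R_transform:
  assumes "conv_power free_add_conv \<mu> n \<tau>" and \<mu>: "real_distribution \<mu>"
  shows "real_distribution \<tau> \<and> (\<forall>\<alpha>>0. \<forall>M>0. \<forall>\<alpha>'>0. \<forall>M'>0. \<forall>R R'.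
     R_transform_on \<tau> (R_domain \<alpha> M) R \<longrightarrow> R_transform_on \<mu> (R_domain \<alpha>' M') R' \<longrightarrow>
     (\<exists>\<beta>>0. \<exists>N>0. \<forall>z\<in>R_domain \<beta> N. R z = of_nat n * R' z))"
  using assms(1)
proof induction
  case one
  then show ?case using R_transform_unique[OF \<mu>] \<mu> by simp
next
  case (Suc n \<tau> \<tau>')
  show ?case
  proof (intro conjI allI impI)
    show \<tau>': "real_distribution \<tau>'" using Suc(2) by (simp add: free_add_conv_def)
    fix \<alpha> M \<alpha>' M' :: real and R R'
    assume pos: "\<alpha> > 0" "M > 0" "\<alpha>' > 0" "M' > 0"
      and R: "R_transform_on \<tau>' (R_domain \<alpha> M) R" and R': "R_transform_on \<mu> (R_domain \<alpha>' M') R'"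
    obtain a L S1 S2 where aL: "a > 0" "L > 0" and S: "R_transform_on \<tau> (R_domain a L) S1"
       "R_transform_on \<mu> (R_domain a L) S2" "R_transform_on \<tau>' (R_domain a L) (\<lambda>z. S1 z + S2 z)"
      using Suc(2) unfolding free_add_conv_def by blast
    obtain b1 N1 where 1: "b1 > 0" "N1 > 0" "\<And>z. z \<in> R_domain b1 N1 \<Longrightarrow> R z = S1 z + S2 z"
      using R_transform_unique[OF \<tau>' pos(1) aL(1) pos(2) aL(2) R S(3)] by blast
    obtain b2 N2 where 2: "b2 > 0" "N2 > 0" "\<And>z. z \<in> R_domain b2 N2 \<Longrightarrow> S2 z = R' z"
      using R_transform_unique[OF \<mu> aL(1) pos(3) aL(2) pos(4) S(2) R'] by blast
    obtain b3 N3 where 3: "b3 > 0" "N3 > 0" "\<And>z. z \<in> R_domain b3 N3 \<Longrightarrow> S1 z = of_nat n * R' z"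
      using Suc.IH[THEN conjunct2, rule_format, OF aL pos(3,4) S(1) R'] by blast
    note c1 = R_domain_common[OF 1(1) 2(1) 1(2) 2(2)]
    note c2 = R_domain_common[OF c1(1) 3(1) c1(2) 3(2)]
    show "\<exists>\<beta>>0. \<exists>N>0. \<forall>z\<in>R_domain \<beta> N. R z = of_nat (Suc n) * R' z"
    proof (intro exI conjI ballI)
      fix z assume z: "z \<in> R_domain (min (min b1 b2) b3) (max (max N1 N2) N3)"
      then have "z \<in> R_domain b1 N1" "z \<in> R_domain b2 N2" "z \<in> R_domain b3 N3" using c1 c2 by blast+
      then show "R z = of_nat (Suc n) * R' z" using 1(3) 2(3) 3(3) by (simp add: algebra_simps)
    qed (use c2 in auto)
  qed
qed

lemma Im_inverse_pos:
  fixes w :: complex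
  assumes "Im w < 0" shows "Im (1 / w) > 0"
  using assms by (simp add: Im_divide divide_neg_pos sum_power2_gt_zero_iff)

text \<open>From \<open>R\<^sub>\<tau> = n R\<^sub>\<mu>\<close> one gets
  \<open>K\<^sub>\<mu> y = K\<^sub>\<tau> y / n + (1 - 1 / n) / y\<close>; putting
  \<open>y = G\<^sub>\<tau> z\<close> gives the subordination function explicitly. The identity is
  first known on the image of a cone under \<open>K\<^sub>\<tau>\<close>. Since the subordination
  function maps the upper half-plane into itself, analytic continuation frees it from the
  cone.\<close>

theorem free_add_power_subordination:
  assumes conv: "conv_power free_add_conv \<mu> n \<tau>" and \<mu>: "real_distribution \<mu>" and z: "Im z > 0"
  shows "cauchy_transform \<mu> (z / of_nat n + (1 - 1 / of_nat n) / cauchy_transform \<tau> z) = cauchy_transform \<tau> z"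
  using conv
proof cases
  case one
  then show ?thesis by simp
next
  case (Suc k \<tau>')
  define m where "m = Suc k"
  have nm: "n = m" "m > 0" using Suc by (auto simp: m_def)
  have \<tau>: "real_distribution \<tau>" using Suc(3) by (simp add: free_add_conv_def)
  obtain a L S1 S2 where aL: "a > 0" "L > 0" and S: 
     "R_transform_on \<mu> (R_domain a L) S2" "R_transform_on \<tau> (R_domain a L) (\<lambda>z. S1 z + S2 z)"
    using Suc(3) unfolding free_add_conv_def by blast
  obtain b N where b: "b > 0" "N > 0" "\<And>z. z \<in> R_domain b N \<Longrightarrow> S1 z + S2 z = of_nat n * S2 z"
    using free_add_power_R_transform[OF conv \<mu>, THEN conjunct2, rule_format, OF aL aL S(2,1)] by blast
  define D where "D = R_domain (min a b) (max L N)"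
  note c = R_domain_common[OF aL(1) b(1) aL(2) b(2), folded D_def]
  obtain K\<mu> where K\<mu>: "inverse_cauchy_on \<mu> (R_domain a L) K\<mu>" "\<And>z. z \<in> R_domain a L \<Longrightarrow> S2 z = K\<mu> z - 1 / z"
    using S(1) by (auto simp: R_transform_on_def)
  obtain K\<tau> where K\<tau>: "inverse_cauchy_on \<tau> (R_domain a L) K\<tau>" "\<And>z. z \<in> R_domain a L \<Longrightarrow> S1 z + S2 z = K\<tau> z - 1 / z"
    using S(2) by (auto simp: R_transform_on_def)
  define \<omega> where "\<omega> z = z / of_nat n + (1 - 1 / of_nat n) / cauchy_transform \<tau> z" for z
  have n0: "(of_nat n :: complex) \<noteq> 0" using nm by simp
  have n1: "1 - 1 / real n \<ge> 0" using nm by simp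
  have \<omega>_upper: "Im (\<omega> z) > 0" if "Im z > 0" for z
  proof -
    have "(1 - 1 / of_nat n) / cauchy_transform \<tau> z = of_real (1 - 1 / real n) * (1 / cauchy_transform \<tau> z)"
      by simp
    then have "Im ((1 - 1 / of_nat n) / cauchy_transform \<tau> z) = (1 - 1 / real n) * Im (1 / cauchy_transform \<tau> z)"
      by (metis Im_complex_of_real Re_complex_of_real add.right_neutral mult_zero_left times_complex.simps(2))
    also have "\<dots> \<ge> 0"
      using n1 Im_inverse_pos[OF Im_cauchy_transform_neg[OF \<tau> that]] by (intro mult_nonneg_nonneg) auto
    finally have "Im ((1 - 1 / of_nat n) / cauchy_transform \<tau> z) \<ge> 0" .
    moreover have "Im (z / of_nat n) > 0" using that nm by (simp add: Im_divide_of_nat)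
    ultimately show ?thesis unfolding \<omega>_def by simp
  qed
  have G0: "cauchy_transform \<tau> z \<noteq> 0" if "Im z > 0" for z
    using Im_cauchy_transform_neg[OF \<tau> that] by auto
  let ?H = "{z. Im z > 0}"
  have hol_\<omega>: "\<omega> holomorphic_on ?H"
    unfolding \<omega>_def using G0 n0 by (intro holomorphic_intros cauchy_transform_holomorphic_upper \<tau>) auto
  have "(cauchy_transform \<mu> \<circ> \<omega>) holomorphic_on ?H"
    using \<omega>_upper by (intro holomorphic_on_compose_gen[OF hol_\<omega> cauchy_transform_holomorphic_upper[OF \<mu>]]) auto
  then have hol: "(\<lambda>z. cauchy_transform \<mu> (\<omega> z) - cauchy_transform \<tau> z) holomorphic_on ?H"
    by (intro holomorphic_intros cauchy_transform_holomorphic_upper \<tau>) (simp add: o_def)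
  have D_sub: "z \<in> R_domain a L" "z \<in> R_domain b N" "z \<noteq> 0" if "z \<in> D" for z
    using c that R_domain_nonzero[of L z a] aL by auto
  have K\<tau>D: "Im (K\<tau> z) > 0" "cauchy_transform \<tau> (K\<tau> z) = z" if "z \<in> D" for z
    using K\<tau>(1) D_sub[OF that] by (auto simp: inverse_cauchy_on_def)
  obtain \<xi> where \<xi>: "\<xi> \<in> D" using R_domain_nonempty[of "min a b" "max L N"] c by (auto simp: D_def)
  have "cauchy_transform \<mu> (\<omega> z) - cauchy_transform \<tau> z = 0"
  proof (rule analytic_continuation[OF hol upper_half_plane_open upper_half_plane_connected, where U = "K\<tau> ` D" and \<xi> = "K\<tau> \<xi>"])
    show "K\<tau> \<xi> islimpt K\<tau> ` D"
    proof -
      have "open D" using c unfolding D_def by (intro R_domain_open) auto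
      then have "\<xi> islimpt D" using \<xi> open_imp_islimpt by (metis interior_limit_point interior_open)
      then obtain s where s: "\<And>j. s j \<in> D - {\<xi>}" "s \<longlonglongrightarrow> \<xi>" unfolding islimpt_sequential by blast
      have "continuous_on D K\<tau>"
        using K\<tau>(1) c by (intro holomorphic_on_imp_continuous_on) (auto simp: inverse_cauchy_on_def intro: holomorphic_on_subset)
      then have "(\<lambda>j. K\<tau> (s j)) \<longlonglongrightarrow> K\<tau> \<xi>"
        using s \<xi> unfolding continuous_on_sequentially o_def by auto
      \<comment> \<open>\<open>K\<tau>\<close> is injective on \<open>D\<close>, being inverted by
        the Cauchy transform, so the images really accumulate at
        \<open>K\<tau> \<xi>\<close>.\<close>
      moreover have "K\<tau> (s j) \<in> K\<tau> ` D - {K\<tau> \<xi>}" for j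
        using s(1)[of j] K\<tau>D(2)[of "s j"] K\<tau>D(2)[OF \<xi>] by auto
      ultimately show ?thesis
        unfolding islimpt_sequential by (intro exI[of _ "\<lambda>j. K\<tau> (s j)"]) simp
    qed
    fix v assume "v \<in> K\<tau> ` D"
    then obtain y where y: "y \<in> D" "v = K\<tau> y" by auto
    have "K\<tau> y = of_nat n * S2 y + 1 / y"
      using K\<tau>(2)[OF D_sub(1)[OF y(1)]] b(3)[OF D_sub(2)[OF y(1)]] by simp
    then have "\<omega> v = K\<mu> y"
      using n0 K\<mu>(2)[of y] D_sub[OF y(1)] unfolding \<omega>_def y(2) K\<tau>D(2)[OF y(1)]
      by (simp add: field_simps)
    moreover have "cauchy_transform \<mu> (K\<mu> y) = y"
      using K\<mu>(1) D_sub[OF y(1)] by (auto simp: inverse_cauchy_on_def)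
    ultimately show "cauchy_transform \<mu> (\<omega> v) - cauchy_transform \<tau> v = 0"
      using K\<tau>D(2)[OF y(1)] y by simp
  qed (use z K\<tau>D \<xi> in auto)
  then show ?thesis by (simp add: \<omega>_def)
qed

section \<open>Additive powers of measures on the half-line\<close>

lemma conv_power_pos: "conv_power conv \<mu> n \<rho> \<Longrightarrow> n > 0"
  by (induction rule: conv_power.induct) auto

lemma Im_of_real_mult: "Im (complex_of_real a * w) = a * Im w"
  by simp

context nonneg_prob
begin

text \<open>From \<open>z / (z - x) = 1 + x / (z - x)\<close>, whose imaginary part has the sign of
  \<open>- x\<close>. This is the converse of
  \<open>Im_mult_cauchy_transform_nonpos_imp_nonneg\<close>.\<close>

lemma Im_mult_cauchy_transform_nonpos:
  assumes z: "Im z > 0" shows "Im (z * cauchy_transform \<mu> z) \<le> 0"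
proof -
  have int: "integrable \<mu> (\<lambda>x. z * (1 / (z - of_real x)))"
    by (intro integrable_mult_right integrable_cauchy_kernel_upper[OF real_distribution z])
  have "Im (z * cauchy_transform \<mu> z) = Im (\<integral>x. z * (1 / (z - of_real x)) \<partial>\<mu>)"
    unfolding cauchy_transform_def Bochner_Integration.integral_mult_right_zero ..
  also have "\<dots> = (\<integral>x. Im (z * (1 / (z - of_real x))) \<partial>\<mu>)"
    using int by (rule integral_Im[symmetric])
  also have "\<dots> \<le> (\<integral>x. 0 \<partial>\<mu>)"
  proof (rule integral_mono_AE)
    show "integrable \<mu> (\<lambda>x. Im (z * (1 / (z - of_real x))))" using int by (rule integrable_Im)
    show "AE x in \<mu>. Im (z * (1 / (z - of_real x))) \<le> 0"
      using AE_nonneg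
    proof eventually_elim
      case (elim x)
      have "z - of_real x \<noteq> 0" using z by (auto simp: complex_eq_iff)
      then have "z * (1 / (z - of_real x)) = 1 + of_real x * (1 / (z - of_real x))"
        by (simp add: field_simps)
      then have "Im (z * (1 / (z - of_real x))) = x * Im (1 / (z - of_real x))"
        by (simp only: plus_complex.sel Im_of_real_mult one_complex.sel add_0)
      also have "\<dots> \<le> 0"
        unfolding Im_cauchy_kernel using z elim by (intro mult_nonneg_nonpos) auto
      finally show ?case .
    qed
  qed simp
  finally show ?thesis by simp
qed

lemma cauchy_transform_tendsto_neg:
  assumes t: "t < 0" and X: "X \<longlonglongrightarrow> of_real (1 / t)"
  shows "(\<lambda>n. cauchy_transform \<mu> (X n)) \<longlonglongrightarrow> of_real (t * (1 + psi_transform \<mu> t))"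
proof -
  have "isCont (cauchy_transform \<mu>) (of_real (1 / t))"
  proof (rule continuous_on_interior)
    show "continuous_on (- (complex_of_real ` {0..})) (cauchy_transform \<mu>)"
      by (rule holomorphic_on_imp_continuous_on[OF cauchy_transform_holomorphic[OF real_distribution]])
         (use AE_nonneg in auto)
    have "open (- (complex_of_real ` {0..}))" by (intro open_Compl closed_of_real_image) auto
    moreover have "1 / t < 0" using t by simp
    then have "complex_of_real (1 / t) \<notin> complex_of_real ` {0..}"
      by (auto simp only: image_iff of_real_eq_iff atLeast_iff)
    ultimately show "of_real (1 / t) \<in> interior (- (complex_of_real ` {0..}))"
      by (simp only: interior_open Compl_iff not_False_eq_True)
  qed
  from isCont_tendsto_compose[OF this X] show ?thesis
    using cauchy_transform_neg[OF t] by simp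
qed

end

text \<open>The transform identities for additive powers hold in the upper half-plane only; the
  point \<open>1 / t\<close> of the negative axis is reached from above along this vertical
  sequence.\<close>

definition approach :: "real \<Rightarrow> nat \<Rightarrow> complex" where
  "approach t k = of_real (1 / t) + \<i> * of_real (1 / real (Suc k))"

lemma approach_upper: "Im (approach t k) > 0"
  by (simp add: approach_def)

lemma approach_tendsto: "approach t \<longlonglongrightarrow> of_real (1 / t)"
proof -
  have "(\<lambda>k. 1 / real (Suc k)) \<longlonglongrightarrow> 0"
    using LIMSEQ_inverse_real_of_nat by (simp add: inverse_eq_divide)
  then have "(\<lambda>k. of_real (1 / t) + \<i> * of_real (1 / real (Suc k))) \<longlonglongrightarrow> of_real (1 / t) + \<i> * complex_of_real 0"
    by (intro tendsto_intros)
  then show ?thesis unfolding approach_def by simp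
qed

text \<open>With \<open>\<omega>\<close> the subordination function and
  \<open>G = G\<^sub>\<tau> z = G\<^sub>\<mu> \<omega>\<close>, one has
  \<open>z * G = n * (\<omega> * G) - (n - 1)\<close>. So the sign condition for
  \<open>\<tau>\<close> at \<open>z\<close> is the one for \<open>\<mu>\<close> at
  \<open>\<omega>\<close>.\<close>

theorem free_add_power_nonneg:
  assumes conv: "conv_power free_add_conv \<mu> n \<tau>" and \<mu>: "prob_on_nonneg \<mu>"
  shows "prob_on_nonneg \<tau>"
proof (rule Im_mult_cauchy_transform_nonpos_imp_nonneg)
  interpret M: nonneg_prob \<mu> using \<mu> by (simp add: prob_on_nonneg_iff)
  have n: "n > 0" using conv_power_pos[OF conv] .
  show \<tau>: "real_distribution \<tau>" using free_add_power_R_transform[OF conv M.real_distribution] by blast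
  fix z assume z: "Im z > 0"
  define G where "G = cauchy_transform \<tau> z"
  define \<omega> where "\<omega> = z / of_nat n + (1 - 1 / of_nat n) / G"
  have G: "Im G < 0" unfolding G_def by (rule Im_cauchy_transform_neg[OF \<tau> z])
  then have G0: "G \<noteq> 0" by auto
  have n1: "0 \<le> 1 - 1 / real n" using n by simp
  have "(1 - 1 / of_nat n) / G = of_real (1 - 1 / real n) * (1 / G)" by simp
  then have "Im \<omega> = Im (z / of_nat n) + Im (of_real (1 - 1 / real n) * (1 / G))" by (simp only: \<omega>_def plus_complex.sel)
  also have "\<dots> = Im z / real n + (1 - 1 / real n) * Im (1 / G)"
    by (simp only: Im_divide_of_nat Im_of_real_mult)
  also have "\<dots> > 0"
    using z n n1 Im_inverse_pos[OF G] by (intro add_pos_nonneg mult_nonneg_nonneg) auto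
  finally have \<omega>: "Im \<omega> > 0" .
  have sub: "cauchy_transform \<mu> \<omega> = G"
    using free_add_power_subordination[OF conv M.real_distribution z] by (simp add: \<omega>_def G_def)
  have "z * G = of_nat n * (\<omega> * G) - of_nat (n - 1)"
    using n G0 by (simp add: \<omega>_def field_simps of_nat_diff)
  also have "\<dots> = of_real (real n) * (\<omega> * G) - of_real (real (n - 1))" by simp
  finally have "Im (z * G) = real n * Im (\<omega> * G)"
    by (simp only: minus_complex.sel Im_of_real_mult Im_complex_of_real diff_0_right)
  also have "\<dots> \<le> 0"
    using M.Im_mult_cauchy_transform_nonpos[OF \<omega>] unfolding sub by (intro mult_nonneg_nonpos) auto
  finally show "Im (z * cauchy_transform \<tau> z) \<le> 0" by (simp add: G_def)
qed

text \<open>The subordination identity at \<open>z = 1 / t\<close>. There the transform of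
  \<open>\<tau>\<close> is \<open>t * (1 + U)\<close>, and the subordination function takes the
  value \<open>1 / s\<close> with \<open>s = t * (1 + U) / (1 + U / n)\<close>; comparing
  \<open>s * (1 + psi_transform \<mu> s)\<close> with \<open>t * (1 + U)\<close> gives the value
  \<open>U / n\<close>.\<close>

theorem free_add_power_psi:
  assumes conv: "conv_power free_add_conv \<mu> n \<tau>" and \<mu>: "prob_on_nonneg \<mu>" and t: "t < 0"
    and U: "U = psi_transform \<tau> t"
  shows "t * (1 + U) / (1 + U / real n) < 0" "psi_transform \<mu> (t * (1 + U) / (1 + U / real n)) = U / real n"
proof -
  interpret M: nonneg_prob \<mu> using \<mu> by (simp add: prob_on_nonneg_iff)
  interpret T: nonneg_prob \<tau> using free_add_power_nonneg[OF conv \<mu>] by (simp add: prob_on_nonneg_iff)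
  have n: "real n \<ge> 1" using conv_power_pos[OF conv] by simp
  have U1: "- 1 < U" "U \<le> 0" using T.psi_gt_minus_1[OF t] T.psi_nonpos[OF t] by (auto simp: U)
  have "- U / real n \<le> - U" using divide_left_mono[of 1 "real n" "- U"] n U1 by simp
  then have Un: "1 + U / real n > 0" using U1 by simp
  define s where "s = t * (1 + U) / (1 + U / real n)"
  show s: "t * (1 + U) / (1 + U / real n) < 0"
    using t U1 Un by (intro divide_neg_pos mult_neg_pos) auto
  have inv_s: "1 / t / real n + (1 - 1 / real n) / (t * (1 + U)) = 1 / s"
    using t U1 Un n unfolding s_def by (simp add: divide_simps)
  define G where "G k = cauchy_transform \<tau> (approach t k)" for k
  define w where "w k = approach t k / of_nat n + (1 - 1 / of_nat n) / G k" for k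
  have G: "G \<longlonglongrightarrow> of_real (t * (1 + U))"
    unfolding G_def U by (rule T.cauchy_transform_tendsto_neg[OF t approach_tendsto])
  have tU: "complex_of_real (t * (1 + U)) \<noteq> 0" using t U1 by (simp del: of_real_mult of_real_add)
  have "w \<longlonglongrightarrow> of_real (1 / t) / of_nat n + (1 - 1 / of_nat n) / of_real (t * (1 + U))"
    unfolding w_def using n tU by (intro tendsto_intros G approach_tendsto) auto
  also have "of_real (1 / t) / of_nat n + (1 - 1 / of_nat n) / of_real (t * (1 + U)) = complex_of_real (1 / s)"
    unfolding inv_s[symmetric] by simp
  finally have w: "w \<longlonglongrightarrow> of_real (1 / s)" .
  have "(\<lambda>k. cauchy_transform \<mu> (w k)) \<longlonglongrightarrow> of_real (s * (1 + psi_transform \<mu> s))"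
    using s by (intro M.cauchy_transform_tendsto_neg w) (simp add: s_def)
  moreover have "cauchy_transform \<mu> (w k) = G k" for k
    unfolding w_def G_def by (rule free_add_power_subordination[OF conv M.real_distribution approach_upper])
  ultimately have "complex_of_real (s * (1 + psi_transform \<mu> s)) = of_real (t * (1 + U))"
    using LIMSEQ_unique[OF _ G] by simp
  then have "s * (1 + psi_transform \<mu> s) = t * (1 + U)" by (simp only: of_real_eq_iff)
  also have "t * (1 + U) = s * (1 + U / real n)" using Un by (simp add: s_def)
  finally have "1 + psi_transform \<mu> s = 1 + U / real n"
    using s[folded s_def] by (simp only: mult_left_cancel[OF less_imp_neq])
  then show "psi_transform \<mu> (t * (1 + U) / (1 + U / real n)) = U / real n"
    by (simp add: s_def)
qed

section \<open>Boolean additive powers\<close>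

lemma boolean_power_K_transform:
  assumes "conv_power boolean_conv \<mu> n \<tau>" and "real_distribution \<mu>"
  shows "real_distribution \<tau> \<and> (\<forall>z. Im z > 0 \<longrightarrow> K_transform \<tau> z = of_nat n * K_transform \<mu> z)"
  using assms by (induction rule: conv_power.induct) (auto simp: boolean_conv_def algebra_simps)

text \<open>Since \<open>K z / z = 1 - 1 / (z * G z)\<close>, the imaginary part of
  \<open>1 / (z * G z)\<close> is multiplied by \<open>n\<close>. Taking reciprocals reverses the
  sign of the imaginary part, so the sign condition is inherited.\<close>

theorem boolean_power_nonneg:
  assumes conv: "conv_power boolean_conv \<mu> n \<tau>" and \<mu>: "prob_on_nonneg \<mu>"
  shows "prob_on_nonneg \<tau>"
proof (rule Im_mult_cauchy_transform_nonpos_imp_nonneg)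
  interpret M: nonneg_prob \<mu> using \<mu> by (simp add: prob_on_nonneg_iff)
  note K = boolean_power_K_transform[OF conv M.real_distribution]
  show \<tau>: "real_distribution \<tau>" using K by blast
  fix z assume z: "Im z > 0"
  define G where "G = z * cauchy_transform \<tau> z"
  define H where "H = z * cauchy_transform \<mu> z"
  have z0: "z \<noteq> 0" using z by auto
  have G0: "G \<noteq> 0" "H \<noteq> 0"
    using Im_cauchy_transform_neg[OF \<tau> z] Im_cauchy_transform_neg[OF M.real_distribution z] z0
    by (auto simp: G_def H_def)
  have "z * (1 - 1 / G) = z * (of_nat n * (1 - 1 / H))"
    using K z z0 by (simp add: K_transform_def G_def H_def algebra_simps)
  then have "1 - 1 / G = of_nat n * (1 - 1 / H)" using z0 by (simp only: mult_cancel_left) simp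
  also have "\<dots> = of_real (real n) * (1 - 1 / H)" by simp
  finally have "Im (1 - 1 / G) = real n * Im (1 - 1 / H)" by (simp only: Im_of_real_mult)
  then have "Im (1 / G) = real n * Im (1 / H)" by simp
  moreover have "Im (1 / H) \<ge> 0"
    using M.Im_mult_cauchy_transform_nonpos[OF z] by (simp add: H_def[symmetric] Im_divide divide_nonpos_nonneg)
  ultimately have "Im (1 / G) \<ge> 0" by simp
  then have "- Im G / ((Re G)\<^sup>2 + (Im G)\<^sup>2) \<ge> 0" by (simp add: Im_divide)
  moreover have "(Re G)\<^sup>2 + (Im G)\<^sup>2 > 0" using G0 by (simp add: sum_power2_gt_zero_iff complex_eq_iff)
  ultimately show "Im (z * cauchy_transform \<tau> z) \<le> 0" by (simp add: G_def[symmetric] zero_le_divide_iff divide_le_0_iff)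
qed

text \<open>At \<open>1 / t\<close> the K-transform equals \<open>psi / (1 + psi)\<close> divided by
  \<open>t\<close>, so additivity of K becomes additivity of this quotient.\<close>

theorem boolean_power_psi:
  assumes conv: "conv_power boolean_conv \<mu> n \<tau>" and \<mu>: "prob_on_nonneg \<mu>" and t: "t < 0"
  shows "psi_transform \<tau> t / (1 + psi_transform \<tau> t) = real n * (psi_transform \<mu> t / (1 + psi_transform \<mu> t))"
proof -
  interpret M: nonneg_prob \<mu> using \<mu> by (simp add: prob_on_nonneg_iff)
  interpret T: nonneg_prob \<tau> using boolean_power_nonneg[OF conv \<mu>] by (simp add: prob_on_nonneg_iff)
  have nz: "1 + psi_transform \<tau> t > 0" "1 + psi_transform \<mu> t > 0"
    using T.psi_gt_minus_1[OF t] M.psi_gt_minus_1[OF t] by auto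
  have K: "(\<lambda>k. K_transform \<kappa> (approach t k)) \<longlonglongrightarrow> of_real (1 / t - 1 / (t * (1 + psi_transform \<kappa> t)))"
    if "nonneg_prob \<kappa>" "1 + psi_transform \<kappa> t > 0" for \<kappa>
  proof -
    have "complex_of_real (t * (1 + psi_transform \<kappa> t)) \<noteq> 0"
      unfolding of_real_eq_0_iff using t that(2) by simp
    then have "(\<lambda>k. K_transform \<kappa> (approach t k)) \<longlonglongrightarrow> of_real (1 / t) - 1 / of_real (t * (1 + psi_transform \<kappa> t))"
      unfolding K_transform_def
      by (intro tendsto_intros approach_tendsto nonneg_prob.cauchy_transform_tendsto_neg[OF that(1) t])
    then show ?thesis by simp
  qed
  have "K_transform \<tau> (approach t k) = of_nat n * K_transform \<mu> (approach t k)" for k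
    using boolean_power_K_transform[OF conv M.real_distribution] approach_upper by blast
  then have "(\<lambda>k. of_nat n * K_transform \<mu> (approach t k)) \<longlonglongrightarrow> of_real (1 / t - 1 / (t * (1 + psi_transform \<tau> t)))"
    using K[OF T.nonneg_prob_axioms nz(1)] by simp
  moreover have "(\<lambda>k. of_nat n * K_transform \<mu> (approach t k)) \<longlonglongrightarrow> of_nat n * of_real (1 / t - 1 / (t * (1 + psi_transform \<mu> t)))"
    by (intro tendsto_intros K[OF M.nonneg_prob_axioms nz(2)])
  ultimately have "complex_of_real (1 / t - 1 / (t * (1 + psi_transform \<tau> t))) = of_nat n * of_real (1 / t - 1 / (t * (1 + psi_transform \<mu> t)))"
    by (rule LIMSEQ_unique)
  then have "1 / t - 1 / (t * (1 + psi_transform \<tau> t)) = real n * (1 / t - 1 / (t * (1 + psi_transform \<mu> t)))"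
    by (metis of_real_eq_iff of_real_mult of_real_of_nat_eq)
  moreover have "1 / t - 1 / (t * (1 + p)) = (p / (1 + p)) / t" if "1 + p > 0" for p
    using that t by (simp add: divide_simps)
  ultimately have "(psi_transform \<tau> t / (1 + psi_transform \<tau> t)) / t = (real n * (psi_transform \<mu> t / (1 + psi_transform \<mu> t))) / t"
    using nz by simp
  then show ?thesis using t by (simp only: divide_cancel_right) simp
qed

section \<open>The limit laws\<close>

text \<open>A common frame for the free and the Boolean limit. The function \<open>\<phi>\<close>
  expresses the limit of \<open>n * v\<close> through \<open>q\<close>, where \<open>v\<close> is
  the argument at which the S-transform is taken.\<close>

locale phase =
  fixes \<phi> :: "real \<Rightarrow> real" and g :: real
  assumes g_pos: "g > 0"
    and phase_strict_mono: "q < r \<Longrightarrow> r < 0 \<Longrightarrow> \<phi> q < \<phi> r"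
    and phase_neg: "q < 0 \<Longrightarrow> \<phi> q < 0"
    and phase_continuous: "continuous_on {..<0} \<phi>"
    and phase_tendsto_0: "(\<phi> \<longlongrightarrow> 0) (at_left 0)"
begin

definition \<Gamma> :: "real \<Rightarrow> real" where "\<Gamma> q = q * exp (- (g * \<phi> q))"

text \<open>On the negative axis, minus \<open>\<Gamma>\<close> is the product of the positive
  factors \<open>- q\<close> and \<open>exp (- (g * \<phi> q))\<close>, the first of which decreases
  strictly and the second weakly.\<close>

lemma Gamma_strict_mono:
  assumes "q < r" "r < 0" shows "\<Gamma> q < \<Gamma> r"
proof -
  have "exp (- (g * \<phi> r)) \<le> exp (- (g * \<phi> q))"
    using phase_strict_mono[OF assms] g_pos by simp
  then have "(- r) * exp (- (g * \<phi> r)) \<le> (- r) * exp (- (g * \<phi> q))"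
    using assms by (intro mult_left_mono) auto
  also have "\<dots> < (- q) * exp (- (g * \<phi> q))"
    using assms by (intro mult_strict_right_mono) auto
  finally show ?thesis by (simp add: \<Gamma>_def)
qed

lemma Gamma_neg: "q < 0 \<Longrightarrow> \<Gamma> q < 0"
  by (simp add: \<Gamma>_def mult_neg_pos)

lemma Gamma_le: "q < 0 \<Longrightarrow> \<Gamma> q \<le> q"
  using phase_neg[of q] g_pos mult_left_mono_neg[of 1 "exp (- (g * \<phi> q))" q]
  by (simp add: \<Gamma>_def mult_pos_neg less_imp_le)

lemma Gamma_continuous: "continuous_on {..<0} \<Gamma>"
  unfolding \<Gamma>_def by (intro continuous_intros phase_continuous)

lemma Gamma_tendsto_0: "(\<Gamma> \<longlongrightarrow> 0) (at_left 0)"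
proof -
  have "((\<lambda>q. q * exp (- (g * \<phi> q))) \<longlongrightarrow> 0 * exp (- (g * 0))) (at_left 0)"
    by (intro tendsto_intros phase_tendsto_0)
  then show ?thesis by (simp add: \<Gamma>_def[abs_def])
qed

lemma Gamma_surj:
  assumes t: "t < 0" shows "\<exists>q<0. \<Gamma> q = t"
proof -
  have "eventually (\<lambda>r. t < \<Gamma> r \<and> t < r \<and> r < 0) (at_left 0)"
    using order_tendstoD(1)[OF Gamma_tendsto_0 t] eventually_at_left_real[OF t]
    by eventually_elim auto
  then obtain r where r: "t < \<Gamma> r" "t < r" "r < 0"
    using eventually_happens'[of "at_left (0::real)"] by auto
  \<comment> \<open>The value \<open>t\<close> itself serves as left end point, by
    \<open>Gamma_le\<close>.\<close>
  have "\<exists>q\<ge>t. q \<le> r \<and> \<Gamma> q = t"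
    using r Gamma_le[OF t] by (intro IVT' continuous_on_subset[OF Gamma_continuous]) auto
  then obtain q where "q \<le> r" "\<Gamma> q = t" by blast
  then show ?thesis using r by (intro exI[of _ q]) auto
qed

lemma Gamma_inj: "q < 0 \<Longrightarrow> r < 0 \<Longrightarrow> \<Gamma> q = \<Gamma> r \<Longrightarrow> q = r"
  using Gamma_strict_mono by (metis less_irrefl linorder_less_linear)

section \<open>The inverse function and the law it describes\<close>

definition Q :: "real \<Rightarrow> real" where "Q t = (THE q. q < 0 \<and> \<Gamma> q = t)"

lemma Q_Gamma: "q < 0 \<Longrightarrow> Q (\<Gamma> q) = q"
  unfolding Q_def using Gamma_inj by (intro the_equality) auto

lemma Q_neg: "t < 0 \<Longrightarrow> Q t < 0" and Gamma_Q: "t < 0 \<Longrightarrow> \<Gamma> (Q t) = t"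
  using Gamma_surj[of t] Q_Gamma by metis+

lemma Q_ge: "t < 0 \<Longrightarrow> t \<le> Q t"
  using Gamma_le[OF Q_neg[of t]] Gamma_Q[of t] by simp

lemma Q_strict_mono:
  assumes "s < t" "t < 0" shows "Q s < Q t"
proof (rule ccontr)
  have s: "s < 0" using assms by simp
  assume "\<not> Q s < Q t"
  then have "\<Gamma> (Q t) \<le> \<Gamma> (Q s)"
    using Gamma_strict_mono[of "Q t" "Q s"] Q_neg[OF s] by (cases "Q s = Q t") auto
  then show False using assms s by (simp add: Gamma_Q)
qed

lemma Q_tendsto_0: "(Q \<longlongrightarrow> 0) (at_left 0)"
proof (rule real_tendsto_sandwich)
  have ev: "eventually (\<lambda>t::real. t < 0) (at_left 0)" by (auto simp: eventually_at_filter)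
  show "eventually (\<lambda>t. t \<le> Q t) (at_left 0)" using ev by eventually_elim (rule Q_ge)
  show "eventually (\<lambda>t. Q t \<le> 0) (at_left 0)" using ev by eventually_elim (simp add: Q_neg less_imp_le)
  show "((\<lambda>t. t) \<longlongrightarrow> 0) (at_left (0::real))" by (rule tendsto_ident_at)
qed auto

lemma Q_div: "t < 0 \<Longrightarrow> Q t / t = exp (g * \<phi> (Q t))"
  using Gamma_Q[of t] Q_neg[of t]
  by (simp add: \<Gamma>_def divide_eq_eq exp_minus field_simps)

text \<open>The hypothesis says that \<open>t / \<Gamma> (q n)\<close> tends to \<open>1\<close>.
  Strict monotonicity of \<open>\<Gamma>\<close> carries the convergence of its values over to the
  arguments.\<close>

lemma tendsto_Q:
  assumes t: "t < 0" and q: "\<And>n. q n < 0"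
    and lim: "(\<lambda>n. t / q n * exp (g * \<phi> (q n))) \<longlonglongrightarrow> 1"
  shows "q \<longlonglongrightarrow> Q t"
proof -
  have "(\<lambda>n. t / (t / q n * exp (g * \<phi> (q n)))) \<longlonglongrightarrow> t / 1"
    by (intro tendsto_intros lim) auto
  moreover have "t / (t / q n * exp (g * \<phi> (q n))) = \<Gamma> (q n)" for n
    using t q[of n] by (simp add: \<Gamma>_def exp_minus field_simps)
  ultimately have L: "(\<lambda>n. \<Gamma> (q n)) \<longlonglongrightarrow> \<Gamma> (Q t)" using Gamma_Q[OF t] by simp
  show ?thesis
  proof (rule order_tendstoI)
    fix a assume a: "a < Q t"
    then have "\<Gamma> a < \<Gamma> (Q t)" using Q_neg[OF t] by (rule Gamma_strict_mono)
    from order_tendstoD(1)[OF L this] show "eventually (\<lambda>n. a < q n) sequentially"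
    proof eventually_elim
      case (elim n)
      show ?case
      proof (rule ccontr)
        assume "\<not> a < q n"
        then have "\<Gamma> (q n) \<le> \<Gamma> a"
          using Gamma_strict_mono[of "q n" a] a Q_neg[OF t] by (cases "q n = a") auto
        then show False using elim by simp
      qed
    qed
  next
    fix a assume a: "Q t < a"
    show "eventually (\<lambda>n. q n < a) sequentially"
    proof (cases "a < 0")
      case True
      with a have "\<Gamma> (Q t) < \<Gamma> a" by (intro Gamma_strict_mono)
      from order_tendstoD(2)[OF L this] show ?thesis
      proof eventually_elim
        case (elim n)
        show ?case
        proof (rule ccontr)
          assume "\<not> q n < a"
          then have "\<Gamma> a \<le> \<Gamma> (q n)"
            using Gamma_strict_mono[of a "q n"] q[of n] by (cases "q n = a") auto
          then show False using elim by simp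
        qed
      qed
    next
      case False
      then show ?thesis using q less_le_trans by (intro always_eventually) (auto simp: not_less)
    qed
  qed
qed

definition has_phase :: "real measure \<Rightarrow> bool" where
  "has_phase \<mu> \<longleftrightarrow> prob_on_nonneg \<mu> \<and>
     (\<forall>t<0. psi_transform \<mu> t / (1 + psi_transform \<mu> t) = Q t)"

lemma has_phase_psi:
  assumes "has_phase \<mu>" "t < 0" shows "psi_transform \<mu> t = Q t / (1 - Q t)"
proof -
  interpret nonneg_prob \<mu> using assms by (simp add: has_phase_def prob_on_nonneg_iff)
  have "1 + psi_transform \<mu> t > 0" using psi_gt_minus_1[OF assms(2)] by simp
  moreover have "Q t = psi_transform \<mu> t / (1 + psi_transform \<mu> t)" using assms by (simp add: has_phase_def)
  ultimately have "psi_transform \<mu> t * (1 - Q t) = Q t"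
    by (simp add: eq_divide_eq algebra_simps)
  then show ?thesis using Q_neg[OF assms(2)] by (simp add: eq_divide_eq)
qed

lemma has_phase_unique: "has_phase \<mu> \<Longrightarrow> has_phase \<nu> \<Longrightarrow> \<mu> = \<nu>"
  by (rule nonneg_measure_eqI) (simp_all only: has_phase_psi, simp_all only: has_phase_def)

text \<open>A description rather than a construction: uniqueness is \<open>has_phase_unique\<close>,
  and existence comes from the converging sequence itself in \<open>weak_conv_law\<close>. The law
  thus depends on \<open>\<phi>\<close> and \<open>g\<close> alone, not on the measure whose powers
  are taken.\<close>

definition law :: "real measure" where "law = (THE \<mu>. has_phase \<mu>)"

lemma has_phase_law: "has_phase \<mu> \<Longrightarrow> law = \<mu>"
  unfolding law_def using has_phase_unique by blast

lemma weak_conv_law: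
  assumes \<mu>: "\<And>n. prob_on_nonneg (\<mu> n)"
    and lim: "\<And>t. t < 0 \<Longrightarrow> (\<lambda>n. psi_transform (\<mu> n) t / (1 + psi_transform (\<mu> n) t)) \<longlonglongrightarrow> Q t"
  shows "weak_conv_m \<mu> law" "has_phase law"
proof -
  have psi_lim: "(\<lambda>n. psi_transform (\<mu> n) t) \<longlonglongrightarrow> Q t / (1 - Q t)" if t: "t < 0" for t
  proof -
    have "(\<lambda>n. (psi_transform (\<mu> n) t / (1 + psi_transform (\<mu> n) t)) / (1 - psi_transform (\<mu> n) t / (1 + psi_transform (\<mu> n) t)))
       \<longlonglongrightarrow> Q t / (1 - Q t)"
      using Q_neg[OF t] by (intro tendsto_intros lim t) auto
    moreover have "p / (1 + p) / (1 - p / (1 + p)) = p" if "1 + p > 0" for p :: real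
      using that by (simp add: divide_simps)
    moreover have "1 + psi_transform (\<mu> n) t > 0" for n
      using nonneg_prob.psi_gt_minus_1[OF \<mu>[unfolded prob_on_nonneg_iff] t, of n] by simp
    ultimately show ?thesis by simp
  qed
  have "((\<lambda>t. Q t / (1 - Q t)) \<longlongrightarrow> 0 / (1 - 0)) (at_left 0)"
    by (intro tendsto_intros Q_tendsto_0) auto
  then have z: "((\<lambda>t. Q t / (1 - Q t)) \<longlongrightarrow> 0) (at_left 0)" by simp
  obtain M where M: "prob_on_nonneg M" "weak_conv_m \<mu> M" "\<And>t. t < 0 \<Longrightarrow> psi_transform M t = Q t / (1 - Q t)"
    using psi_continuity[OF \<mu> psi_lim z] by blast
  have "has_phase M"
    unfolding has_phase_def
  proof (intro conjI allI impI M(1))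
    fix t :: real assume t: "t < 0"
    show "psi_transform M t / (1 + psi_transform M t) = Q t"
      unfolding M(3)[OF t] using Q_neg[OF t] by (simp add: divide_simps)
  qed
  then show "weak_conv_m \<mu> law" "has_phase law" using M(2) has_phase_law by auto
qed

end

section \<open>Convergence of the additive powers of multiplicative powers\<close>

lemma dilation_psi:
  assumes "real_distribution \<mu>"
  shows "psi_transform (dilation r \<mu>) t = psi_transform \<mu> (r * t)"
proof -
  interpret real_distribution \<mu> by fact
  show ?thesis
    unfolding psi_transform_def dilation_def by (subst integral_distr) (auto simp: mult_ac)
qed

lemma dilation_nonneg:
  assumes \<mu>: "prob_on_nonneg \<mu>" and r: "r \<ge> 0" shows "prob_on_nonneg (dilation r \<mu>)"
proof -
  interpret nonneg_prob \<mu> using \<mu> by (simp add: prob_on_nonneg_iff)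
  have "real_distribution (dilation r \<mu>)"
    unfolding dilation_def by (intro real_distribution_distr) simp
  moreover have "AE x in dilation r \<mu>. 0 \<le> x"
    unfolding dilation_def using AE_nonneg r by (subst AE_distr_iff) (auto elim!: eventually_mono)
  ultimately show ?thesis by (simp add: prob_on_nonneg_def)
qed

text \<open>Convolution powers start at \<open>n = 1\<close>, so the term with index
  \<open>0\<close> is arbitrary and the limit is taken along the shifted sequence.\<close>

lemma weak_conv_m_Suc: "weak_conv_m (\<lambda>n. \<mu> (Suc n)) M \<Longrightarrow> weak_conv_m \<mu> M"
  unfolding weak_conv_m_def weak_conv_def by (auto intro: LIMSEQ_imp_Suc)

locale phase_limit = square_integrable_law \<nu> + phase \<phi> "Var \<nu> / (mean \<nu>)\<^sup>2"
  for \<nu> :: "real measure" and \<phi> :: "real \<Rightarrow> real"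
begin

text \<open>The common last step of both limits. From \<open>m\<^sub>0 * S \<ge> 1\<close> one gets
  \<open>t / q n \<ge> 1\<close>, hence \<open>t \<le> q n < 0\<close>; this bounds
  \<open>\<phi> (q n)\<close> and makes \<open>S_transform_power_limit\<close> applicable before
  \<open>q\<close> is known to converge.\<close>

lemma phase_limit_core:
  assumes t: "t < 0" and q: "\<And>n. q n < 0" and v: "eventually (\<lambda>n. v n \<in> S_domain \<nu>) sequentially"
    and v0: "v \<longlonglongrightarrow> 0" and vq: "(\<lambda>n. real n * v n - \<phi> (q n)) \<longlonglongrightarrow> 0"
    and eq: "eventually (\<lambda>n. t / q n = (mean \<nu> * S_transform \<nu> (v n)) ^ n) sequentially"
  shows "q \<longlonglongrightarrow> Q t"
proof -
  obtain N where N: "\<And>n. n \<ge> N \<Longrightarrow> v n \<in> S_domain \<nu> \<and> t / q n = (mean \<nu> * S_transform \<nu> (v n)) ^ n"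
    using eventually_conj[OF v eq] unfolding eventually_sequentially by blast
  have q_ge: "t \<le> q (n + N)" for n
  proof -
    have "1 \<le> t / q (n + N)"
      using N[of "n + N"] mean_S_ge_1[of "v (n + N)"] by simp
    then show ?thesis using q[of "n + N"] by (simp add: le_divide_eq)
  qed
  have "\<bar>\<phi> (q (n + N))\<bar> \<le> \<bar>\<phi> t\<bar>" for n
    using q_ge[of n] q[of "n + N"] phase_neg[OF t] phase_neg[OF q] phase_strict_mono[of t "q (n + N)"]
    by (cases "t = q (n + N)") (auto simp: less_le)
  then have bdd: "Bseq (\<lambda>n. \<phi> (q (n + N)))" by (intro BseqI'[of _ "\<bar>\<phi> t\<bar>"]) auto
  have "(\<lambda>n. (mean \<nu> * S_transform \<nu> (v (n + N))) ^ (n + N) * exp (Var \<nu> / (mean \<nu>)\<^sup>2 * \<phi> (q (n + N)))) \<longlonglongrightarrow> 1"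
    by (rule S_transform_power_limit[OF _ LIMSEQ_ignore_initial_segment[OF v0] LIMSEQ_ignore_initial_segment[OF vq] bdd])
       (use N in auto)
  then have "(\<lambda>n. t / q (n + N) * exp (Var \<nu> / (mean \<nu>)\<^sup>2 * \<phi> (q (n + N)))) \<longlonglongrightarrow> 1"
    using N by simp
  then have "(\<lambda>n. q (n + N)) \<longlonglongrightarrow> Q t" by (rule tendsto_Q[OF t q])
  then show ?thesis by (rule LIMSEQ_offset)
qed

end

lemma (in square_integrable_law) eventually_S_domain:
  assumes "eventually (\<lambda>n. v n < 0) sequentially" "v \<longlonglongrightarrow> 0"
  shows "eventually (\<lambda>n. v n \<in> S_domain \<nu>) sequentially"
proof -
  have "eventually (\<lambda>n. measure \<nu> {0} - 1 < v n) sequentially"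
    using order_tendstoD(1)[OF assms(2)] atom_lt_1[OF not_return_0] by simp
  with assms(1) show ?thesis by eventually_elim (simp add: S_domain_def)
qed

text \<open>Bounds the slope of \<open>psi\<close> by \<open>m\<^sub>0^n\<close>, the value expected
  for the mean of the power. In the Boolean case this forces \<open>v\<close> to tend to
  \<open>0\<close>; in the free case \<open>v = U / n\<close> does so at once.\<close>

lemma (in square_integrable_law) free_mult_power_psi_ge:
  assumes \<rho>: "conv_power free_mult_conv \<nu> n \<rho>" and t: "t < 0"
  shows "t * mean \<nu> ^ n \<le> psi_transform \<rho> t"
proof -
  note R = free_mult_power_S_transform[OF \<rho> _ not_return_0]
  have \<nu>: "prob_on_nonneg \<nu>" by (simp add: prob_on_nonneg_iff nonneg_prob_axioms)
  have \<rho>0: "\<rho> \<noteq> return borel 0" using R \<nu> by blast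
  interpret R: nonneg_prob \<rho> using R \<nu> by (simp add: prob_on_nonneg_iff)
  \<comment> \<open>Halving puts \<open>u\<close> strictly between \<open>0\<close> and both
    \<open>psi_transform \<rho> t\<close> and the left end of the S-domain of
    \<open>\<nu>\<close>.\<close>
  define u where "u = max (psi_transform \<rho> t / 2) ((measure \<nu> {0} - 1) / 2)"
  have "x / 2 < 0 \<and> x < x / 2" if "x < 0" for x :: real using that by simp
  from this[OF R.psi_neg[OF \<rho>0 t]] this[of "measure \<nu> {0} - 1"]
  have "u < 0" "u > psi_transform \<rho> t" "u > measure \<nu> {0} - 1"
    using atom_lt_1[OF not_return_0] unfolding u_def less_max_iff_disj max_less_iff_conj by auto
  then have u: "u < 0" "u > psi_transform \<rho> t" "u \<in> S_domain \<nu>"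
    by (auto simp: S_domain_def)
  have u\<rho>: "u \<in> S_domain \<rho>" using R \<nu> u(3) by blast
  define s where "s = chi_transform \<rho> u"
  have s: "s < 0" "psi_transform \<rho> s = u" using R.psi_chi[OF \<rho>0 u\<rho>] by (auto simp: s_def)
  have "t \<le> s"
    using R.psi_strict_mono[OF \<rho>0, of s t] s u t by (cases "t \<le> s") auto
  then have "psi_transform \<rho> t / t \<le> u / s" using R.psi_div_mono[of t s] s by simp
  also have "u / s = (1 + u) / S_transform \<rho> u"
    using u s R.psi_gt_minus_1[OF s(1)] by (simp add: S_transform_def s_def[symmetric])
  also have "\<dots> = (1 + u) / S_transform \<nu> u ^ n" using R \<nu> u(3) by simp
  also have "\<dots> \<le> 1 / S_transform \<nu> u ^ n"
    using S_transform_pos[OF not_return_0 u(3)] u by (intro divide_right_mono) auto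
  also have "\<dots> \<le> mean \<nu> ^ n"
  proof -
    have "1 \<le> (mean \<nu> * S_transform \<nu> u) ^ n" using mean_S_ge_1[OF u(3)] by (rule one_le_power)
    then show ?thesis
      using S_transform_pos[OF not_return_0 u(3)] by (simp add: divide_le_eq power_mult_distrib)
  qed
  finally show ?thesis using t by (simp add: neg_divide_le_eq mult.commute)
qed

lemma phase_free:
  assumes "g > 0" shows "phase (\<lambda>q. q / (1 - q)) g"
proof
  show "q / (1 - q) < r / (1 - r)" if "q < r" "r < 0" for q r :: real
    using that by (simp add: divide_simps) (simp add: algebra_simps)
  show "q / (1 - q) < 0" if "q < 0" for q :: real
    using that by (simp add: divide_neg_pos)
  show "continuous_on {..<0} (\<lambda>q::real. q / (1 - q))"
    by (intro continuous_intros) auto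
  have "((\<lambda>q::real. q / (1 - q)) \<longlongrightarrow> 0 / (1 - 0)) (at_left 0)"
    by (intro tendsto_intros) auto
  then show "((\<lambda>q::real. q / (1 - q)) \<longlongrightarrow> 0) (at_left 0)" by simp
qed fact

lemma phase_boolean:
  assumes "g > 0" shows "phase (\<lambda>q. q) g"
  by unfold_locales (use assms in \<open>auto intro: tendsto_ident_at\<close>)

context square_integrable_law
begin

lemma phase_limit_free: "nondegenerate \<nu> \<Longrightarrow> phase_limit \<nu> (\<lambda>q. q / (1 - q))"
  using phase_free[of "Var \<nu> / (mean \<nu>)\<^sup>2"] Var_pos mean_pos
  by (simp add: phase_limit_def square_integrable_law_axioms)

lemma phase_limit_boolean: "nondegenerate \<nu> \<Longrightarrow> phase_limit \<nu> (\<lambda>q. q)"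
  using phase_boolean[of "Var \<nu> / (mean \<nu>)\<^sup>2"] Var_pos mean_pos
  by (simp add: phase_limit_def square_integrable_law_axioms)

lemma prob_on_nonneg: "prob_on_nonneg \<nu>"
  by (simp add: prob_on_nonneg_iff nonneg_prob_axioms)

theorem free_powers_converge:
  assumes nd: "nondegenerate \<nu>"
    and \<rho>: "\<And>n. n \<ge> 1 \<Longrightarrow> conv_power free_mult_conv \<nu> n (\<rho> n)"
    and \<tau>: "\<And>n. n \<ge> 1 \<Longrightarrow> conv_power free_add_conv (\<rho> n) n (\<tau> n)"
  defines "\<phi> \<equiv> \<lambda>q. q / (1 - q)" and "g \<equiv> Var \<nu> / (mean \<nu>)\<^sup>2"
  shows "weak_conv_m (\<lambda>n. dilation (1 / (real n * mean \<nu> ^ n)) (\<tau> n)) (phase.law \<phi> g)"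
    "phase.has_phase \<phi> g (phase.law \<phi> g)"
proof -
  interpret phase_limit \<nu> \<phi> unfolding \<phi>_def by (rule phase_limit_free[OF nd])
  define \<mu> where "\<mu> n = dilation (1 / (real n * mean \<nu> ^ n)) (\<tau> n)" for n
  have R: "prob_on_nonneg (\<rho> n)" "\<rho> n \<noteq> return borel 0"
     "\<And>u. u \<in> S_domain \<nu> \<Longrightarrow> S_transform (\<rho> n) u = S_transform \<nu> u ^ n" if "n \<ge> 1" for n
    using free_mult_power_S_transform[OF \<rho>[OF that] prob_on_nonneg not_return_0] by auto
  have T: "prob_on_nonneg (\<tau> n)" if "n \<ge> 1" for n
    using free_add_power_nonneg[OF \<tau>[OF that] R(1)[OF that]] .
  have \<mu>: "prob_on_nonneg (\<mu> (Suc n))" for n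
    unfolding \<mu>_def using mean_pos by (intro dilation_nonneg T) auto
  have lim: "(\<lambda>n. psi_transform (\<mu> (Suc n)) t / (1 + psi_transform (\<mu> (Suc n)) t)) \<longlonglongrightarrow> Q t" if t: "t < 0" for t
  proof -
    define U where "U n = psi_transform (\<mu> n) t" for n
    \<comment> \<open>The value \<open>-1\<close> at index \<open>0\<close> keeps \<open>q\<close>
      negative for every index, as \<open>phase_limit_core\<close> requires.\<close>
    define q where "q n = (if n = 0 then - 1 else U n / (1 + U n))" for n
    define v where "v n = U n / real n" for n
    \<comment> \<open>The point from \<open>free_add_power_psi\<close>, with \<open>t\<close>
      rescaled by the dilation; there \<open>psi\<close> of the multiplicative power equals
      \<open>U n / n\<close>.\<close>
    define s where "s n = (t / (real n * mean \<nu> ^ n)) * (1 + U n) / (1 + U n / real n)" for n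
    have U: "s n < 0" "psi_transform (\<rho> n) (s n) = v n" "- 1 < U n" "U n < 0" "v n < 0" if n: "n \<ge> 1" for n
    proof -
      have tn: "t / (real n * mean \<nu> ^ n) < 0" using t n mean_pos by (simp add: divide_neg_pos)
      have Un: "U n = psi_transform (\<tau> n) (t / (real n * mean \<nu> ^ n))"
        unfolding U_def \<mu>_def using dilation_psi[OF prob_on_nonneg_real_distribution[OF T[OF n]]] by simp
      show s: "s n < 0" "psi_transform (\<rho> n) (s n) = v n"
        using free_add_power_psi[OF \<tau>[OF n] R(1)[OF n] tn Un] by (simp_all add: s_def v_def)
      show "- 1 < U n"
        unfolding Un using T[OF n] tn by (intro nonneg_prob.psi_gt_minus_1) (auto simp: prob_on_nonneg_iff)
      show v: "v n < 0"
        using nonneg_prob.psi_neg[OF R(1)[OF n, unfolded prob_on_nonneg_iff] R(2)[OF n] s(1)] s(2) by simp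
      then show "U n < 0" using n by (simp add: v_def divide_less_0_iff)
    qed
    have v0: "v \<longlonglongrightarrow> 0"
    proof (rule Lim_null_comparison)
      show "eventually (\<lambda>n. norm (v n) \<le> 1 / real n) sequentially"
        using eventually_ge_at_top[of 1]
      proof eventually_elim
        case (elim n)
        then have "\<bar>U n\<bar> \<le> 1" using U(3,4)[OF elim] by simp
        from divide_right_mono[OF this, of "real n"] show ?case by (simp add: v_def)
      qed
    qed (rule lim_1_over_n)
    have evn: "eventually (\<lambda>n. n \<ge> 1) sequentially" by (rule eventually_ge_at_top)
    have ev: "eventually (\<lambda>n. v n \<in> S_domain \<nu>) sequentially"
    proof (rule eventually_S_domain[OF _ v0])
      show "eventually (\<lambda>n. v n < 0) sequentially" using evn by eventually_elim (rule U(5))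
    qed
    have "q \<longlonglongrightarrow> Q t"
    proof (rule phase_limit_core[OF t _ ev v0])
      show "q n < 0" for n using U(3,4)[of n] by (auto simp: q_def divide_neg_pos)
      \<comment> \<open>Exact in the free case: \<open>n * v n\<close> is \<open>U n\<close>, and
        \<open>\<phi>\<close> inverts the map from \<open>U\<close> to
        \<open>U / (1 + U)\<close>.\<close>
      have "eventually (\<lambda>n. real n * v n - \<phi> (q n) = 0) sequentially"
        using evn
      proof eventually_elim
        case (elim n)
        then show ?case using U(3)[OF elim] by (simp add: v_def q_def \<phi>_def divide_simps)
      qed
      then show "(\<lambda>n. real n * v n - \<phi> (q n)) \<longlonglongrightarrow> 0" by (rule tendsto_eventually)
      show "eventually (\<lambda>n. t / q n = (mean \<nu> * S_transform \<nu> (v n)) ^ n) sequentially"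
        using evn ev
      proof eventually_elim
        case (elim n)
        note U = U[OF elim(1)]
        have "S_transform \<nu> (v n) ^ n = S_transform (\<rho> n) (v n)" using R(3)[OF elim] by simp
        also have "\<dots> = s n * (1 + v n) / v n"
          using nonneg_prob.S_transform_psi[OF R(1)[OF elim(1), unfolded prob_on_nonneg_iff] R(2)[OF elim(1)] U(1)]
          by (simp add: U(2))
        also have "s n * (1 + v n) = (t / (real n * mean \<nu> ^ n)) * (1 + U n)"
        proof -
          have "real n + U n > 0" using U(3) elim(1) by simp
          moreover have "real n + U n = real n * (1 + v n)" using elim(1) by (simp add: v_def field_simps)
          ultimately have "1 + v n \<noteq> 0" by auto
          then show ?thesis by (simp add: s_def v_def)
        qed
        finally have "S_transform \<nu> (v n) ^ n = t / (real n * mean \<nu> ^ n) * (1 + U n) / (U n / real n)"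
          by (simp only: v_def)
        then have "mean \<nu> ^ n * S_transform \<nu> (v n) ^ n = t * (1 + U n) / U n"
          using mean_pos elim(1) by simp
        then show ?case using elim(1) by (simp add: q_def power_mult_distrib)
      qed
    qed
    then have "(\<lambda>n. q (Suc n)) \<longlonglongrightarrow> Q t" by (rule LIMSEQ_Suc)
    then show ?thesis by (simp add: q_def U_def)
  qed
  show "weak_conv_m (\<lambda>n. dilation (1 / (real n * mean \<nu> ^ n)) (\<tau> n)) (phase.law \<phi> g)"
    "phase.has_phase \<phi> g (phase.law \<phi> g)"
    using weak_conv_law[OF \<mu> lim] weak_conv_m_Suc[of \<mu>] unfolding \<mu>_def g_def by blast+
qed

theorem boolean_powers_converge:
  assumes nd: "nondegenerate \<nu>"
    and \<rho>: "\<And>n. n \<ge> 1 \<Longrightarrow> conv_power free_mult_conv \<nu> n (\<rho> n)"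
    and \<tau>: "\<And>n. n \<ge> 1 \<Longrightarrow> conv_power boolean_conv (\<rho> n) n (\<tau> n)"
  defines "\<phi> \<equiv> \<lambda>q::real. q" and "g \<equiv> Var \<nu> / (mean \<nu>)\<^sup>2"
  shows "weak_conv_m (\<lambda>n. dilation (1 / (real n * mean \<nu> ^ n)) (\<tau> n)) (phase.law \<phi> g)"
    "phase.has_phase \<phi> g (phase.law \<phi> g)"
proof -
  interpret phase_limit \<nu> \<phi> unfolding \<phi>_def by (rule phase_limit_boolean[OF nd])
  define \<mu> where "\<mu> n = dilation (1 / (real n * mean \<nu> ^ n)) (\<tau> n)" for n
  have R: "prob_on_nonneg (\<rho> n)" "\<rho> n \<noteq> return borel 0"
     "\<And>u. u \<in> S_domain \<nu> \<Longrightarrow> S_transform (\<rho> n) u = S_transform \<nu> u ^ n" if "n \<ge> 1" for n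
    using free_mult_power_S_transform[OF \<rho>[OF that] prob_on_nonneg not_return_0] by auto
  have T: "prob_on_nonneg (\<tau> n)" if "n \<ge> 1" for n
    using boolean_power_nonneg[OF \<tau>[OF that] R(1)[OF that]] .
  have \<mu>: "prob_on_nonneg (\<mu> (Suc n))" for n
    unfolding \<mu>_def using mean_pos by (intro dilation_nonneg T) auto
  have lim: "(\<lambda>n. psi_transform (\<mu> (Suc n)) t / (1 + psi_transform (\<mu> (Suc n)) t)) \<longlonglongrightarrow> Q t" if t: "t < 0" for t
  proof -
    define s where "s n = t / (real n * mean \<nu> ^ n)" for n
    define v where "v n = psi_transform (\<rho> n) (s n)" for n
    define q where "q n = (if n = 0 then - 1 else real n * (v n / (1 + v n)))" for n
    have s: "s n < 0" if "n \<ge> 1" for n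
      using t that mean_pos by (simp add: s_def divide_neg_pos)
    have v: "- 1 < v n" "v n < 0" "t \<le> real n * v n" if n: "n \<ge> 1" for n
    proof -
      interpret R: nonneg_prob "\<rho> n" using R(1)[OF n] by (simp add: prob_on_nonneg_iff)
      show "- 1 < v n" "v n < 0"
        using R.psi_gt_minus_1[OF s[OF n]] R.psi_neg[OF R(2)[OF n] s[OF n]] by (auto simp: v_def)
      have "s n * mean \<nu> ^ n \<le> v n" unfolding v_def by (rule free_mult_power_psi_ge[OF \<rho>[OF n] s[OF n]])
      then show "t \<le> real n * v n" using n mean_pos by (simp add: s_def divide_le_eq mult.commute)
    qed
    have evn: "eventually (\<lambda>n. n \<ge> 1) sequentially" by (rule eventually_ge_at_top)
    have v0: "v \<longlonglongrightarrow> 0"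
    proof (rule Lim_null_comparison)
      show "eventually (\<lambda>n. norm (v n) \<le> - t * (1 / real n)) sequentially"
        using evn
      proof eventually_elim
        case (elim n)
        then have "t / real n \<le> v n" using v(3)[OF elim] by (simp add: pos_divide_le_eq mult.commute)
        then show ?case using v(2)[OF elim] by simp
      qed
      show "(\<lambda>n. - t * (1 / real n)) \<longlonglongrightarrow> 0"
        using tendsto_mult[OF tendsto_const lim_1_over_n, of "- t"] by simp
    qed
    have ev: "eventually (\<lambda>n. v n \<in> S_domain \<nu>) sequentially"
    proof (rule eventually_S_domain[OF _ v0])
      show "eventually (\<lambda>n. v n < 0) sequentially" using evn by eventually_elim (rule v(2))
    qed
    have "q \<longlonglongrightarrow> Q t"
    proof (rule phase_limit_core[OF t _ ev v0])
      show "q n < 0" for n using v(1,2)[of n] by (auto simp: q_def mult_pos_neg divide_neg_pos)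
      show "(\<lambda>n. real n * v n - \<phi> (q n)) \<longlonglongrightarrow> 0"
      \<comment> \<open>Here \<open>n * v\<close> and \<open>q = n * v / (1 + v)\<close> agree only
        asymptotically. Their difference is \<open>n * v\<close> times \<open>v / (1 + v)\<close>,
        with the first factor bounded by \<open>\<bar>t\<bar>\<close>.\<close>
      proof (rule Lim_null_comparison)
        have "(\<lambda>n. \<bar>t\<bar> * \<bar>v n / (1 + v n)\<bar>) \<longlonglongrightarrow> \<bar>t\<bar> * \<bar>0 / (1 + 0)\<bar>"
          by (intro tendsto_intros v0) auto
        then show "(\<lambda>n. \<bar>t\<bar> * \<bar>v n / (1 + v n)\<bar>) \<longlonglongrightarrow> 0" by simp
        show "eventually (\<lambda>n. norm (real n * v n - \<phi> (q n)) \<le> \<bar>t\<bar> * \<bar>v n / (1 + v n)\<bar>) sequentially"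
          using evn
        proof eventually_elim
          case (elim n)
          have "real n * v n - \<phi> (q n) = (real n * v n) * (v n / (1 + v n))"
            using elim v(1)[OF elim] by (simp add: q_def \<phi>_def divide_simps) (simp add: algebra_simps)
          moreover have "\<bar>real n * v n\<bar> \<le> \<bar>t\<bar>"
            using v(3)[OF elim] mult_nonneg_nonpos[OF of_nat_0_le_iff less_imp_le[OF v(2)[OF elim]], of n] by linarith
          ultimately show ?case
            by (simp only: real_norm_def abs_mult[of "real n * v n"]) (rule mult_right_mono, simp_all)
        qed
      qed
      show "eventually (\<lambda>n. t / q n = (mean \<nu> * S_transform \<nu> (v n)) ^ n) sequentially"
        using evn ev
      proof eventually_elim
        case (elim n)
        have "S_transform \<nu> (v n) ^ n = S_transform (\<rho> n) (v n)" using R(3)[OF elim] by simp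
        also have "\<dots> = s n * (1 + v n) / v n"
          using nonneg_prob.S_transform_psi[OF R(1)[OF elim(1), unfolded prob_on_nonneg_iff] R(2)[OF elim(1)] s[OF elim(1)]]
          by (simp add: v_def)
        finally show ?case
          using mean_pos elim(1) v[OF elim(1)] by (simp add: s_def q_def power_mult_distrib)
      qed
    qed
    then have lim': "(\<lambda>n. q (Suc n)) \<longlonglongrightarrow> Q t" by (rule LIMSEQ_Suc)
    have "q (Suc n) = psi_transform (\<mu> (Suc n)) t / (1 + psi_transform (\<mu> (Suc n)) t)" for n
    proof -
      have n: "Suc n \<ge> 1" by simp
      have "psi_transform (\<mu> (Suc n)) t = psi_transform (\<tau> (Suc n)) (s (Suc n))"
        unfolding \<mu>_def s_def using dilation_psi[OF prob_on_nonneg_real_distribution[OF T[OF n]]] by simp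
      then show ?thesis
        using boolean_power_psi[OF \<tau>[OF n] R(1)[OF n] s[OF n]] by (simp add: q_def v_def)
    qed
    then show ?thesis using lim' by simp
  qed
  show "weak_conv_m (\<lambda>n. dilation (1 / (real n * mean \<nu> ^ n)) (\<tau> n)) (phase.law \<phi> g)"
    "phase.has_phase \<phi> g (phase.law \<phi> g)"
    using weak_conv_law[OF \<mu> lim] weak_conv_m_Suc[of \<mu>] unfolding \<mu>_def g_def by blast+
qed

end

section \<open>Cauchy-Stieltjes kernel families on the half-line\<close>

text \<open>Otherwise null balls would cover the line, and by Lindelof countably many of them would.
  The infimum of the support in \<open>csk_b\<close> is meaningful only because of this.\<close>

lemma (in real_distribution) msupport_nonempty: "msupport M \<noteq> {}"
proof
  assume empty: "msupport M = {}"
  define \<F> where "\<F> = {ball x e | x e. e > 0 \<and> measure M (ball x e) = 0}"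
  have "x \<in> \<Union>\<F>" for x :: real
  proof -
    have "x \<notin> msupport M" using empty by simp
    then obtain e where e: "e > 0" "\<not> measure M (ball x e) > 0" by (auto simp: msupport_def)
    then have "measure M (ball x e) = 0" using measure_nonneg[of M "ball x e"] by linarith
    then show ?thesis using e by (intro UnionI[of "ball x e"]) (auto simp: \<F>_def)
  qed
  then have "\<Union>\<F> = UNIV" by auto
  moreover obtain \<F>' where \<F>': "\<F>' \<subseteq> \<F>" "countable \<F>'" "\<Union>\<F>' = \<Union>\<F>"
    by (rule Lindelof[of \<F>]) (auto simp: \<F>_def)
  moreover have "(\<Union>B\<in>\<F>'. B) \<in> null_sets M"
    using \<F>'(1) by (intro null_sets_UN' \<F>'(2)) (auto simp: \<F>_def emeasure_eq_measure intro!: null_setsI)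
  ultimately have "emeasure M UNIV = 0" by (auto dest: null_setsD1)
  then show False using emeasure_space_1 by simp
qed

context nonneg_prob
begin

lemma msupport_nonneg: "msupport \<mu> \<subseteq> {0..}"
proof
  fix x assume x: "x \<in> msupport \<mu>"
  show "x \<in> {0..}"
  proof (rule ccontr)
    assume "x \<notin> {0..}"
    then have "x < 0" by simp
    then have "measure \<mu> (ball x (- x)) > 0" using x by (simp add: msupport_def)
    moreover have "AE y in \<mu>. y \<notin> ball x (- x)"
      using AE_nonneg by eventually_elim (auto simp: dist_real_def)
    then have "measure \<mu> (ball x (- x)) = 0" by (subst prob_eq_0) auto
    ultimately show False by simp
  qed
qed

lemma msupport_bdd_below: "bdd_below (msupport \<mu>)"
  using msupport_nonneg by (auto simp: bdd_below_def)

lemma csk_thetas_eq: "csk_thetas \<mu> = {..<0}"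
proof -
  have "Inf (msupport \<mu>) \<ge> 0"
    using msupport_nonempty msupport_nonneg by (intro cInf_greatest) auto
  then have "csk_b \<mu> = 0" by (simp add: csk_b_def)
  then show ?thesis by (auto simp: csk_thetas_def theta_minus_def)
qed

lemma integral_csk_P:
  fixes f :: "real \<Rightarrow> real"
  assumes t: "t < 0" and [measurable]: "f \<in> borel_measurable borel"
  shows "(\<integral>x. f x \<partial>csk_P \<mu> t) = (\<integral>x. f x / (1 - t * x) \<partial>\<mu>) / (1 + psi_transform \<mu> t)"
proof -
  define M where "M = 1 + psi_transform \<mu> t"
  have M: "csk_M \<mu> t = M" "M > 0" using M_eq_psi[OF t] psi_gt_minus_1[OF t] by (auto simp: csk_M_def M_def)
  have "(\<integral>x. f x \<partial>csk_P \<mu> t) = (\<integral>x. (1 / (M * (1 - t * x))) *\<^sub>R f x \<partial>\<mu>)"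
    unfolding csk_P_def M(1)
  proof (rule integral_density)
    show "AE x in \<mu>. 0 \<le> 1 / (M * (1 - t * x))"
      using AE_nonneg
    proof eventually_elim
      case (elim x)
      show ?case using psi_kernel_bounds(1)[OF t elim] M(2) by simp
    qed
  qed auto
  also have "\<dots> = (\<integral>x. (1 / M) * (f x / (1 - t * x)) \<partial>\<mu>)"
    by (intro Bochner_Integration.integral_cong) auto
  finally show ?thesis by (simp only: Bochner_Integration.integral_mult_right_zero M_def) simp
qed

lemma csk_k_eq:
  assumes t: "t < 0"
  shows "csk_k \<mu> t = psi_transform \<mu> t / (1 + psi_transform \<mu> t) / t"
proof -
  have "csk_k \<mu> t = (psi_transform \<mu> t / t) / (1 + psi_transform \<mu> t)"
    unfolding csk_k_def mean_def psi_div_eq(1)[OF t] by (rule integral_csk_P[OF t]) simp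
  then show ?thesis by (simp add: mult.commute)
qed

text \<open>The kernel lowers the degree by one,
  \<open>x^2 / (1 - t * x) = (x / (1 - t * x) - x) / t\<close>, so a second moment of the family
  member is expressed through the first moment of the generator.\<close>

lemma csk_second_moment:
  assumes t: "t < 0" and int: "integrable \<mu> (\<lambda>x. x)"
  defines "m \<equiv> csk_k \<mu> t"
  shows "(\<integral>x. (x - m)\<^sup>2 \<partial>csk_P \<mu> t) = (m - mean \<mu> / (1 + psi_transform \<mu> t)) / t - m\<^sup>2"
proof -
  define M where "M = 1 + psi_transform \<mu> t"
  have M: "M > 0" using psi_gt_minus_1[OF t] by (simp add: M_def)
  have m: "psi_transform \<mu> t / t = m * M" using csk_k_eq[OF t] M by (simp add: m_def M_def)
  have "(\<integral>x. (x - m)\<^sup>2 / (1 - t * x) \<partial>\<mu>)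
     = (\<integral>x. (1 / t - 2 * m) * (x / (1 - t * x)) + m\<^sup>2 * (1 / (1 - t * x)) - (1 / t) * x \<partial>\<mu>)"
  proof (rule integral_cong_AE)
    show "AE x in \<mu>. (x - m)\<^sup>2 / (1 - t * x)
        = (1 / t - 2 * m) * (x / (1 - t * x)) + m\<^sup>2 * (1 / (1 - t * x)) - (1 / t) * x"
      using AE_nonneg
    proof eventually_elim
      case (elim x)
      define d where "d = 1 - t * x"
      have d: "d \<noteq> 0" "x * t = 1 - d" using psi_kernel_bounds(1)[OF t elim] by (auto simp: d_def mult.commute)
      have "(1 / t - 2 * m) * (x / d) + m\<^sup>2 * (1 / d) - (1 / t) * x
          = (x * (1 - d) / t - 2 * m * x + m\<^sup>2) / d"
        using d(1) t by (simp add: field_simps)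
      also have "x * (1 - d) / t = x\<^sup>2" using t by (simp add: d(2)[symmetric] power2_eq_square)
      finally show ?case by (simp add: d_def[symmetric] power2_diff mult.commute)
    qed
  qed auto
  also have "\<dots> = (\<integral>x. (1 / t - 2 * m) * (x / (1 - t * x)) + m\<^sup>2 * (1 / (1 - t * x)) \<partial>\<mu>) - (\<integral>x. (1 / t) * x \<partial>\<mu>)"
    by (intro Bochner_Integration.integral_diff Bochner_Integration.integrable_add integrable_mult_right psi_div_eq(2)[OF t] M_integrable[OF t] int)
  also have "\<dots> = (\<integral>x. (1 / t - 2 * m) * (x / (1 - t * x)) \<partial>\<mu>) + (\<integral>x. m\<^sup>2 * (1 / (1 - t * x)) \<partial>\<mu>) - (\<integral>x. (1 / t) * x \<partial>\<mu>)"
    by (subst Bochner_Integration.integral_add) (intro integrable_mult_right psi_div_eq(2)[OF t] M_integrable[OF t] refl)+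
  also have "\<dots> = (1 / t - 2 * m) * (m * M) + m\<^sup>2 * M - (1 / t) * mean \<mu>"
    unfolding Bochner_Integration.integral_mult_right_zero psi_div_eq(1)[OF t, symmetric] M_eq_psi[OF t] m mean_def M_def ..
  also have "\<dots> / M = (m - mean \<mu> / M) / t - m\<^sup>2"
    using M t by (simp add: field_simps power2_eq_square)
  finally show ?thesis
    using t by (simp add: integral_csk_P M_def)
qed

end

section \<open>Mean map and variance function of the limit laws\<close>

context phase
begin

lemma has_phase_csk_k:
  assumes "has_phase \<mu>" "t < 0" shows "csk_k \<mu> t = exp (g * \<phi> (Q t))"
proof -
  interpret nonneg_prob \<mu> using assms by (simp add: has_phase_def prob_on_nonneg_iff)
  have "psi_transform \<mu> t / (1 + psi_transform \<mu> t) = Q t" using assms by (simp add: has_phase_def)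
  then show ?thesis using csk_k_eq[OF assms(2)] Q_div[OF assms(2)] by (simp only:)
qed

lemma csk_k_strict_mono:
  assumes \<mu>: "has_phase \<mu>" and st: "s < t" "t < 0" shows "csk_k \<mu> s < csk_k \<mu> t"
proof -
  have "s < 0" using st by simp
  then show ?thesis
    using has_phase_csk_k[OF \<mu>] st g_pos phase_strict_mono[OF Q_strict_mono[OF st] Q_neg[OF st(2)]] by simp
qed

text \<open>As \<open>t\<close> increases to \<open>0\<close>, \<open>x / (1 - t * x)\<close>
  increases to \<open>x\<close>, while its integral \<open>(Q t / t) / (1 - Q t)\<close> tends to
  \<open>1\<close>. Monotone convergence yields integrability and the value together.\<close>

lemma has_phase_mean:
  assumes \<mu>: "has_phase \<mu>" shows "integrable \<mu> (\<lambda>x. x)" "mean \<mu> = 1"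
proof -
  interpret nonneg_prob \<mu> using \<mu> by (simp add: has_phase_def prob_on_nonneg_iff)
  define t where "t n = - (1 / real (Suc n))" for n
  have t: "t n < 0" for n by (simp add: t_def)
  have t0: "t \<longlonglongrightarrow> 0"
    using tendsto_minus[OF LIMSEQ_inverse_real_of_nat] by (simp add: t_def[abs_def] inverse_eq_divide)
  have tl: "filterlim t (at_left 0) sequentially"
    using t t0 by (intro tendsto_imp_filterlim_at_left) auto
  have Qt: "(\<lambda>n. Q (t n)) \<longlonglongrightarrow> 0" by (rule filterlim_compose[OF Q_tendsto_0 tl])
  then have Ql: "filterlim (\<lambda>n. Q (t n)) (at_left 0) sequentially"
    using Q_neg t by (intro tendsto_imp_filterlim_at_left) auto
  have "(\<lambda>n. exp (g * \<phi> (Q (t n))) / (1 - Q (t n))) \<longlonglongrightarrow> exp (g * 0) / (1 - 0)"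
    by (intro tendsto_intros Qt filterlim_compose[OF phase_tendsto_0 Ql]) auto
  moreover have "exp (g * \<phi> (Q (t n))) / (1 - Q (t n)) = (\<integral>x. x / (1 - t n * x) \<partial>\<mu>)" for n
    unfolding psi_div_eq(1)[OF t, symmetric] has_phase_psi[OF \<mu> t] Q_div[OF t, symmetric] by simp
  ultimately have lim: "(\<lambda>n. \<integral>x. x / (1 - t n * x) \<partial>\<mu>) \<longlonglongrightarrow> 1" by simp
  have mono: "AE x in \<mu>. mono (\<lambda>n. x / (1 - t n * x))"
    using AE_nonneg
  proof eventually_elim
    case (elim x)
    show ?case
    proof (intro monoI divide_left_mono elim)
      fix i j :: nat assume "i \<le> j"
      then have "t i \<le> t j" by (simp add: t_def frac_le)
      then show "1 - t j * x \<le> 1 - t i * x" using elim by (simp add: mult_right_mono)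
      show "0 < (1 - t i * x) * (1 - t j * x)"
        using psi_kernel_bounds(1)[OF t elim, of i] psi_kernel_bounds(1)[OF t elim, of j] by simp
    qed
  qed
  have pw: "AE x in \<mu>. (\<lambda>n. x / (1 - t n * x)) \<longlonglongrightarrow> x"
  proof (intro AE_I2)
    fix x
    have "(\<lambda>n. x / (1 - t n * x)) \<longlonglongrightarrow> x / (1 - 0 * x)" by (intro tendsto_intros t0) auto
    then show "(\<lambda>n. x / (1 - t n * x)) \<longlonglongrightarrow> x" by simp
  qed
  show "integrable \<mu> (\<lambda>x. x)"
    by (rule integrable_monotone_convergence[OF psi_div_eq(2)[OF t] mono pw lim]) simp
  show "mean \<mu> = 1"
    unfolding mean_def by (rule integral_monotone_convergence[OF psi_div_eq(2)[OF t] mono pw lim]) simp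
qed

text \<open>A point mass would have a constant mean map, whereas this one is strictly
  increasing.\<close>

lemma has_phase_generator:
  assumes \<mu>: "has_phase \<mu>" shows "csk_generator \<mu>"
proof -
  interpret nonneg_prob \<mu> using \<mu> by (simp add: has_phase_def prob_on_nonneg_iff)
  have "nondegenerate \<mu>"
    unfolding nondegenerate_def
  proof (intro allI notI)
    fix a assume eq: "\<mu> = return borel a"
    have a: "a \<ge> 0" using AE_nonneg unfolding eq by (simp add: AE_return)
    have k: "csk_k \<mu> t = a" if t: "t < 0" for t
    proof -
      have psi: "psi_transform \<mu> t = t * a / (1 - t * a)" unfolding psi_transform_def eq by (subst integral_return) auto
      have "1 + psi_transform \<mu> t = 1 / (1 - t * a)"
        unfolding psi using psi_kernel_bounds(6)[OF t a] by simp
      then have "psi_transform \<mu> t / (1 + psi_transform \<mu> t) = t * a"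
        using psi psi_kernel_bounds(1)[OF t a] by simp
      then show ?thesis using csk_k_eq[OF t] t by simp
    qed
    show False using csk_k_strict_mono[OF \<mu>, of "- 2" "- 1"] k[of "- 2"] k[of "- 1"] by simp
  qed
  then show ?thesis by (simp add: csk_generator_def real_distribution msupport_bdd_below)
qed

text \<open>The mean map is \<open>exp (g * \<phi> (Q t))\<close>. Its equation is solved for
  \<open>q\<close> first, by the intermediate value theorem for \<open>\<phi>\<close>, and the
  parameter of the family is then recovered as \<open>\<Gamma> q\<close>.\<close>

lemma has_phase_csk_V:
  assumes \<mu>: "has_phase \<mu>" and m: "m \<in> {m_minus \<mu><..<mean \<mu>}"
  shows "0 < m \<and> m < 1 \<and> (\<exists>q<0. g * \<phi> q = ln m \<and> csk_V \<mu> m = m * (m - 1) / q + m * (1 - m))"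
proof -
  interpret nonneg_prob \<mu> using \<mu> by (simp add: has_phase_def prob_on_nonneg_iff)
  have m1: "m_minus \<mu> < m" "m < 1" using m has_phase_mean[OF \<mu>] by auto
  have "m_minus \<mu> \<ge> 0"
    unfolding m_minus_def csk_thetas_eq using has_phase_csk_k[OF \<mu>] by (intro cInf_greatest) auto
  then have m0: "0 < m" using m1 by simp
  have "\<exists>k\<in>csk_k \<mu> ` {..<0}. k < m"
    using m1 unfolding m_minus_def csk_thetas_eq by (intro cInf_lessD) auto
  then obtain s where s: "s < 0" "csk_k \<mu> s < m" by auto
  then have "g * \<phi> (Q s) < ln m" using has_phase_csk_k[OF \<mu>] m0 by (metis exp_gt_zero exp_ln_iff exp_less_cancel_iff)
  then have lo: "\<phi> (Q s) < ln m / g" using g_pos by (simp add: pos_less_divide_eq mult.commute)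
  have "ln m / g < 0" using m0 m1 g_pos by (simp add: divide_less_0_iff)
  from order_tendstoD(1)[OF phase_tendsto_0 this] eventually_at_left_real[OF Q_neg[OF s(1)]]
  have "eventually (\<lambda>r. ln m / g < \<phi> r \<and> Q s < r \<and> r < 0) (at_left 0)" by eventually_elim auto
  then obtain r where r: "ln m / g < \<phi> r" "Q s < r" "r < 0"
    using eventually_happens'[of "at_left (0::real)"] by auto
  have "\<exists>q\<ge>Q s. q \<le> r \<and> \<phi> q = ln m / g"
    using r lo by (intro IVT' continuous_on_subset[OF phase_continuous]) auto
  then obtain q where q: "q \<le> r" "\<phi> q = ln m / g" by blast
  have q0: "q < 0" using q r by simp
  define \<theta> where "\<theta> = \<Gamma> q"
  have \<theta>: "\<theta> < 0" "Q \<theta> = q" using Gamma_neg[OF q0] Q_Gamma[OF q0] by (auto simp: \<theta>_def)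
  have k: "csk_k \<mu> \<theta> = m" using has_phase_csk_k[OF \<mu> \<theta>(1)] \<theta>(2) q(2) g_pos m0 by simp
  have q\<theta>: "q / \<theta> = m" using Q_div[OF \<theta>(1)] \<theta>(2) q(2) g_pos m0 by simp
  have "inj_on (csk_k \<mu>) {..<0}" by (intro linorder_inj_onI) (auto dest: csk_k_strict_mono[OF \<mu>])
  then have psi: "csk_psi \<mu> m = \<theta>"
    unfolding csk_psi_def csk_thetas_eq k[symmetric] using \<theta> by (intro the_inv_into_f_f) auto
  have M: "1 + psi_transform \<mu> \<theta> = 1 / (1 - q)"
    unfolding has_phase_psi[OF \<mu> \<theta>(1)] \<theta>(2) using q0 by (simp add: divide_simps)
  have "csk_V \<mu> m = (\<integral>x. (x - csk_k \<mu> \<theta>)\<^sup>2 \<partial>csk_P \<mu> \<theta>)"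
    using m1 has_phase_mean[OF \<mu>] by (simp add: csk_V_def csk_Q_def psi k)
  also have "\<dots> = (m - mean \<mu> / (1 + psi_transform \<mu> \<theta>)) / \<theta> - m\<^sup>2"
    using csk_second_moment[OF \<theta>(1) has_phase_mean(1)[OF \<mu>]] by (simp add: k)
  also have "\<dots> = (m - (1 - q)) / \<theta> - m\<^sup>2" unfolding M has_phase_mean(2)[OF \<mu>] by simp
  also have "\<theta> = q / m" using q\<theta> \<theta>(1) m0 by (simp add: field_simps)
  also have "(m - (1 - q)) / (q / m) - m\<^sup>2 = m * (m - 1) / q + m * (1 - m)"
    using q0 m0 by (simp add: field_simps power2_eq_square)
  finally show ?thesis
    using m0 m1 q0 q(2) g_pos by auto
qed

end

section \<open>The two limit theorems with their variance functions\<close>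

context square_integrable_law
begin

theorem free_limit:
  assumes nd: "nondegenerate \<nu>" and \<rho>: "\<forall>n\<ge>1. conv_power free_mult_conv \<nu> n (\<rho> n)"
    and \<tau>: "\<forall>n\<ge>1. conv_power free_add_conv (\<rho> n) n (\<tau> n)"
  defines "\<gamma> \<equiv> Var \<nu> / (mean \<nu>)\<^sup>2"
  defines "\<eta> \<equiv> phase.law (\<lambda>q. q / (1 - q)) \<gamma>"
  shows "weak_conv_m (\<lambda>n. dilation (1 / (real n * mean \<nu> ^ n)) (\<tau> n)) \<eta>"
    "csk_generator \<eta>" "integrable \<eta> (\<lambda>x. x)" "mean \<eta> = 1"
    "{m_minus \<eta><..<mean \<eta>} \<subseteq> {0<..<1}"
    "\<And>m. m \<in> {m_minus \<eta><..<mean \<eta>} \<Longrightarrow> csk_V \<eta> m = \<gamma> * m * (m - 1) / ln m"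
proof -
  have g: "\<gamma> > 0" using Var_pos[OF nd] mean_pos by (simp add: \<gamma>_def)
  interpret phase "\<lambda>q. q / (1 - q)" \<gamma> by (rule phase_free[OF g])
  show "weak_conv_m (\<lambda>n. dilation (1 / (real n * mean \<nu> ^ n)) (\<tau> n)) \<eta>"
    using free_powers_converge(1)[OF nd, of \<rho> \<tau>] \<rho> \<tau> by (simp add: \<gamma>_def \<eta>_def)
  have ph: "has_phase \<eta>"
    using free_powers_converge(2)[OF nd, of \<rho> \<tau>] \<rho> \<tau> by (simp add: \<gamma>_def \<eta>_def)
  show "csk_generator \<eta>" "integrable \<eta> (\<lambda>x. x)" "mean \<eta> = 1"
    by (fact has_phase_generator[OF ph] has_phase_mean[OF ph])+
  note V = has_phase_csk_V[OF ph]
  show "{m_minus \<eta><..<mean \<eta>} \<subseteq> {0<..<1}"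
    using V by (meson greaterThanLessThan_iff subsetI)
  fix m assume "m \<in> {m_minus \<eta><..<mean \<eta>}"
  then obtain q where q: "q < 0" "\<gamma> * (q / (1 - q)) = ln m" "csk_V \<eta> m = m * (m - 1) / q + m * (1 - m)"
    using V by blast
  \<comment> \<open>The \<open>-1\<close> accounts for the summand \<open>m * (1 - m)\<close>. In
    the Boolean case \<open>\<gamma> / ln m\<close> is \<open>1 / q\<close>, and that summand
    stays.\<close>
  have "\<gamma> / ln m = 1 / q - 1"
    unfolding q(2)[symmetric] using q(1) g by (simp add: diff_divide_distrib)
  then have "\<gamma> * m * (m - 1) / ln m = m * (m - 1) * (1 / q - 1)"
    by (metis mult.assoc mult.commute times_divide_eq_right)
  also have "\<dots> = csk_V \<eta> m" unfolding q(3) using q(1) by (simp add: field_simps)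
  finally show "csk_V \<eta> m = \<gamma> * m * (m - 1) / ln m" ..
qed

theorem boolean_limit:
  assumes nd: "nondegenerate \<nu>" and \<rho>: "\<forall>n\<ge>1. conv_power free_mult_conv \<nu> n (\<rho> n)"
    and \<beta>: "\<forall>n\<ge>1. conv_power boolean_conv (\<rho> n) n (\<beta> n)"
  defines "\<gamma> \<equiv> Var \<nu> / (mean \<nu>)\<^sup>2"
  defines "\<sigma> \<equiv> phase.law (\<lambda>q. q) \<gamma>"
  shows "weak_conv_m (\<lambda>n. dilation (1 / (real n * mean \<nu> ^ n)) (\<beta> n)) \<sigma>"
    "csk_generator \<sigma>" "integrable \<sigma> (\<lambda>x. x)" "mean \<sigma> = 1"
    "{m_minus \<sigma><..<mean \<sigma>} \<subseteq> {0<..<1}"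
    "\<And>m. m \<in> {m_minus \<sigma><..<mean \<sigma>} \<Longrightarrow> csk_V \<sigma> m = \<gamma> * m * (m - 1) / ln m + m * (1 - m)"
proof -
  have g: "\<gamma> > 0" using Var_pos[OF nd] mean_pos by (simp add: \<gamma>_def)
  interpret phase "\<lambda>q. q" \<gamma> by (rule phase_boolean[OF g])
  show "weak_conv_m (\<lambda>n. dilation (1 / (real n * mean \<nu> ^ n)) (\<beta> n)) \<sigma>"
    using boolean_powers_converge(1)[OF nd, of \<rho> \<beta>] \<rho> \<beta> by (simp add: \<gamma>_def \<sigma>_def)
  have ph: "has_phase \<sigma>"
    using boolean_powers_converge(2)[OF nd, of \<rho> \<beta>] \<rho> \<beta> by (simp add: \<gamma>_def \<sigma>_def)
  show "csk_generator \<sigma>" "integrable \<sigma> (\<lambda>x. x)" "mean \<sigma> = 1"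
    by (fact has_phase_generator[OF ph] has_phase_mean[OF ph])+
  note V = has_phase_csk_V[OF ph]
  show "{m_minus \<sigma><..<mean \<sigma>} \<subseteq> {0<..<1}"
    using V by (meson greaterThanLessThan_iff subsetI)
  fix m assume "m \<in> {m_minus \<sigma><..<mean \<sigma>}"
  then obtain q where q: "\<gamma> * q = ln m" "csk_V \<sigma> m = m * (m - 1) / q + m * (1 - m)"
    using V by blast
  show "csk_V \<sigma> m = \<gamma> * m * (m - 1) / ln m + m * (1 - m)"
    unfolding q(2) q(1)[symmetric] using g by simp
qed

end

text \<open>Both laws are chosen before \<open>\<nu>\<close>, as functions of
  \<open>\<gamma>\<close> alone, since \<open>phase.law\<close> depends only on
  \<open>\<phi>\<close> and \<open>\<gamma>\<close>.\<close>

theorem theorem3p1: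
  shows "\<exists>\<eta> \<sigma> :: real \<Rightarrow> real measure. \<forall>(\<nu> :: real measure) (\<rho> :: nat \<Rightarrow> real measure) (m\<^sub>0 :: real) (\<gamma> :: real).
    prob_on_nonneg \<nu> \<and> nondegenerate \<nu> \<and> integrable \<nu> (\<lambda>x. x^2) \<and>
    m\<^sub>0 = mean \<nu> \<and> m\<^sub>0 > 0 \<and> \<gamma> = Var \<nu> / m\<^sub>0^2 \<and>
    (\<forall>n\<ge>1. conv_power free_mult_conv \<nu> n (\<rho> n)) \<longrightarrow>
      (\<forall>\<tau> :: nat \<Rightarrow> real measure. (\<forall>n\<ge>1. conv_power free_add_conv (\<rho> n) n (\<tau> n)) \<longrightarrow>
         weak_conv_m (\<lambda>n. dilation (1 / (real n * m\<^sub>0^n)) (\<tau> n)) (\<eta> \<gamma>) \<and>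
         csk_generator (\<eta> \<gamma>) \<and>
         integrable (\<eta> \<gamma>) (\<lambda>x. x) \<and> mean (\<eta> \<gamma>) = 1 \<and>
         {m_minus (\<eta> \<gamma>)<..<mean (\<eta> \<gamma>)} \<subseteq> {0<..<1} \<and>
         (\<forall>m\<in>{m_minus (\<eta> \<gamma>)<..<mean (\<eta> \<gamma>)}.
            csk_V (\<eta> \<gamma>) m = m * (m - 1) / (m\<^sub>0^2 * ln m) * csk_V \<nu> m\<^sub>0 \<and>
            csk_V (\<eta> \<gamma>) m = \<gamma> * m * (m - 1) / ln m))
      \<and>
      (\<forall>\<beta> :: nat \<Rightarrow> real measure. (\<forall>n\<ge>1. conv_power boolean_conv (\<rho> n) n (\<beta> n)) \<longrightarrow>
         weak_conv_m (\<lambda>n. dilation (1 / (real n * m\<^sub>0^n)) (\<beta> n)) (\<sigma> \<gamma>) \<and>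
         csk_generator (\<sigma> \<gamma>) \<and>
         integrable (\<sigma> \<gamma>) (\<lambda>x. x) \<and> mean (\<sigma> \<gamma>) = 1 \<and>
         {m_minus (\<sigma> \<gamma>)<..<mean (\<sigma> \<gamma>)} \<subseteq> {0<..<1} \<and>
         (\<forall>m\<in>{m_minus (\<sigma> \<gamma>)<..<mean (\<sigma> \<gamma>)}.
            csk_V (\<sigma> \<gamma>) m = m * (m - 1) / (m\<^sub>0^2 * ln m) * csk_V \<nu> m\<^sub>0 + m * (1 - m) \<and>
            csk_V (\<sigma> \<gamma>) m = \<gamma> * m * (m - 1) / ln m + m * (1 - m)))"
proof (rule exI[of _ "phase.law (\<lambda>q. q / (1 - q))"], rule exI[of _ "phase.law (\<lambda>q. q)"],
    intro allI impI, elim conjE, goal_cases)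
  case (1 \<nu> \<rho> m\<^sub>0 \<gamma>)
  then interpret square_integrable_law \<nu>
    by (simp add: square_integrable_law_def square_integrable_law_axioms_def prob_on_nonneg_iff)
  have V: "m * (m - 1) / ((mean \<nu>)\<^sup>2 * ln m) * csk_V \<nu> (mean \<nu>)
      = Var \<nu> / (mean \<nu>)\<^sup>2 * m * (m - 1) / ln m" for m
    by (simp add: csk_V_def)
  show ?case
    unfolding 1(4) 1(6)[unfolded 1(4)] V
    by (intro conjI allI impI ballI; (rule free_limit[OF 1(2,7)] boolean_limit[OF 1(2,7)]; assumption))
qed

end
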